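(* Let $(\mathbb X,\mathcal X)$ be a measurable space, let $\lambda$ be a $\sigma$-finite measure on it, and let $\eta$ be a (proper) Poisson point process on $\mathbb X$ with intensity measure $\lambda$. Let $F\ge 0$ be a $\sigma(\eta)$-measurable random variable such that $D_xF\le 0$ for all $x\in\mathbb X$. Then, for every $t\ge 0$ and every $p>1$, $$\|P_tF\|_{1+(p-1)e^{t}}\le \|F\|_p,$$ where $(P_t)_{t\ge0}$ is the Ornstein-Uhlenbeck semigroup associated with $\eta$.
   Context: $(\Omega,\mathcal F,\mathbb P)$ is the underlying probability space, with expectation $\mathbb E$, and $\|F\|_p=\mathbb E[|F|^p]^{1/p}\in[0,\infty]$ (the inequality is trivial when the right-hand side is infinite). Point processes: $\mathbf N$ is the space of measures on $(\mathbb X,\mathcal X)$ that are countable sums of finite measures with values in $\{0,1,2,\dots\}$; $\mathcal N$ is the $\sigma$-algebra on $\mathbf N$ generated by the sets $\{\mu:\mu(B)=k\}$, $B\in\mathcal X$, $k\in\{0,1,2,\dots\}$. A Poisson point process (Poisson random measure) $\eta$ with intensity $\lambda$ is a random element of $(\mathbf N,\mathcal N)$ such that $\eta(B)$ is Poisson distributed with mean $\lambda(B)$ for every $B\in\mathcal X$ and $\eta(B_1),\dots,\eta(B_m)$ are independent for pairwise disjoint $B_1,\dots,B_m\in\mathcal X$. The process is taken proper: $\eta=\sum_{n=1}^{\kappa}\delta_{X_n}$ for some $\mathbb X$-valued random variables $X_n$ and a $\{0,1,2,\dots\}\cup\{\infty\}$-valued random variable $\kappa$ (this is no restriction up to equality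 in distribution). A $\sigma(\eta)$-measurable random variable is written $F=F(\eta)$ for a measurable map $F:\mathbf N\to\mathbb R$. The add-one cost operator is $D_xF=D_xF(\eta):=F(\eta+\delta_x)-F(\eta)$, $x\in\mathbb X$. Ornstein-Uhlenbeck semigroup (Mehler form): let $(U_n)_{n\ge1}$ be i.i.d. uniform on $[0,1]$, independent of $(\kappa,(X_n)_{n\ge1})$, and for $u\in[0,1]$ set $\eta_u:=\sum_{n=1}^{\kappa}1_{\{U_n\le u\}}\delta_{X_n}$. For $F\in L^1(\mathbb P)$ and $t\ge0$, $$P_tF:=\mathbb E\big[F(\eta_{e^{-t}}+\eta'_{1-e^{-t}})\,\big|\,\eta\big],$$ where $\eta'_{1-e^{-t}}$ is a Poisson point process with intensity $(1-e^{-t})\lambda$ independent of $(\eta,\eta_{e^{-t}})$. *)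

theory Defs
  imports "HOL-Probability.Probability"
begin

definition measure_sum :: "'a measure \<Rightarrow> (nat \<Rightarrow> 'a measure) \<Rightarrow> 'a measure" where
  "measure_sum M \<nu> = measure_of (space M) (sets M) (\<lambda>B. \<Sum>n. emeasure (\<nu> n) B)"

definition measure_add :: "'a measure \<Rightarrow> 'a measure \<Rightarrow> 'a measure \<Rightarrow> 'a measure" where
  "measure_add M \<mu> \<nu> = measure_of (space M) (sets M) (\<lambda>B. emeasure \<mu> B + emeasure \<nu> B)"

lemma sets_measure_sum [simp, measurable_cong]: "sets (measure_sum M \<nu>) = sets M"
  and space_measure_sum [simp]: "space (measure_sum M \<nu>) = space M"
  by (simp_all add: measure_sum_def)

lemma sets_measure_add [simp, measurable_cong]: "sets (measure_add M \<mu> \<nu>) = sets M"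
  and space_measure_add [simp]: "space (measure_add M \<mu> \<nu>) = space M"
  by (simp_all add: measure_add_def)

lemma emeasure_measure_sum:
  assumes "\<And>n. sets (\<nu> n) = sets M" "B \<in> sets M"
  shows "emeasure (measure_sum M \<nu>) B = (\<Sum>n. emeasure (\<nu> n) B)"
proof (rule emeasure_measure_of[OF measure_sum_def])
  show "countably_additive (sets (measure_sum M \<nu>)) (\<lambda>B. \<Sum>n. emeasure (\<nu> n) B)"
  proof (rule countably_additiveI)
    fix A :: "nat \<Rightarrow> 'a set"
    assume A: "range A \<subseteq> sets (measure_sum M \<nu>)" "disjoint_family A"
    have "(\<Sum>i. \<Sum>n. emeasure (\<nu> n) (A i)) = (\<Sum>n. \<Sum>i. emeasure (\<nu> n) (A i))"
      unfolding nn_integral_count_space_nat[symmetric]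
      by (rule pair_sigma_finite.Fubini')
         (simp_all add: pair_sigma_finite_def sigma_finite_measure_count_space)
    also have "\<dots> = (\<Sum>n. emeasure (\<nu> n) (\<Union>i. A i))"
      using A assms(1) by (intro suminf_cong suminf_emeasure) auto
    finally show "(\<Sum>i. \<Sum>n. emeasure (\<nu> n) (A i)) = (\<Sum>n. emeasure (\<nu> n) (\<Union>i. A i))" .
  qed
qed (use assms in \<open>auto simp: positive_def dest: sets.sets_into_space\<close>)

lemma emeasure_measure_add:
  assumes "sets \<mu> = sets M" "sets \<nu> = sets M" "B \<in> sets M"
  shows "emeasure (measure_add M \<mu> \<nu>) B = emeasure \<mu> B + emeasure \<nu> B"
proof (rule emeasure_measure_of[OF measure_add_def])
  show "countably_additive (sets (measure_add M \<mu> \<nu>)) (\<lambda>B. emeasure \<mu> B + emeasure \<nu> B)"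
    using assms by (auto simp: countably_additive_def suminf_emeasure suminf_add[symmetric])
qed (use assms in \<open>auto simp: positive_def dest: sets.sets_into_space\<close>)

definition point_measures :: "'a measure \<Rightarrow> 'a measure set" where
  "point_measures M = {\<mu>. \<exists>\<nu>. \<mu> = measure_sum M \<nu> \<and>
     (\<forall>n. sets (\<nu> n) = sets M \<and> finite_measure (\<nu> n) \<and>
          (\<forall>B\<in>sets M. \<exists>k::nat. emeasure (\<nu> n) B = of_nat k))}"

definition point_measure_algebra :: "'a measure \<Rightarrow> 'a measure measure" where
  "point_measure_algebra M = sigma (point_measures M)
     {{\<mu> \<in> point_measures M. emeasure \<mu> B = of_nat k} | B (k::nat). B \<in> sets M}"

(* Written out because the library's poisson_pmf excludes mean 0; mean infinity is included
   with the usual convention that the variable is then almost surely infinite. *)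
definition poisson_distributed :: "'w measure \<Rightarrow> ('w \<Rightarrow> ennreal) \<Rightarrow> ennreal \<Rightarrow> bool" where
  "poisson_distributed \<Omega> Y c \<longleftrightarrow>
     (if c = \<infinity> then AE \<omega> in \<Omega>. Y \<omega> = \<infinity>
      else \<forall>k::nat. measure \<Omega> {\<omega> \<in> space \<Omega>. Y \<omega> = of_nat k}
             = exp (- enn2real c) * enn2real c ^ k / fact k)"

definition poisson_process ::
    "'w measure \<Rightarrow> 'a measure \<Rightarrow> 'a measure \<Rightarrow> ('w \<Rightarrow> 'a measure) \<Rightarrow> bool" where
  "poisson_process \<Omega> M L \<eta> \<longleftrightarrow>
     \<eta> \<in> measurable \<Omega> (point_measure_algebra M) \<and>
     (\<forall>B\<in>sets M. poisson_distributed \<Omega> (\<lambda>\<omega>. emeasure (\<eta> \<omega>) B) (emeasure L B)) \<and>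
     (\<forall>m (B :: nat \<Rightarrow> 'a set).
        (\<forall>i<m. B i \<in> sets M) \<longrightarrow> disjoint_family_on B {..<m} \<longrightarrow>
        prob_space.indep_vars \<Omega> (\<lambda>_. borel) (\<lambda>i \<omega>. emeasure (\<eta> \<omega>) (B i)) {..<m})"

(* Points and marks are indexed from 0, so a process with k points has the points X 0, ..., X (k - 1). *)
definition sum_of_points :: "'a measure \<Rightarrow> enat \<Rightarrow> (nat \<Rightarrow> 'a) \<Rightarrow> 'a measure" where
  "sum_of_points M k x =
     measure_sum M (\<lambda>n. if enat n < k then return M (x n) else null_measure M)"

definition thinned_sum_of_points ::
    "'a measure \<Rightarrow> enat \<Rightarrow> (nat \<Rightarrow> 'a) \<Rightarrow> (nat \<Rightarrow> real) \<Rightarrow> real \<Rightarrow> 'a measure" where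
  "thinned_sum_of_points M k x v u =
     measure_sum M (\<lambda>n. if enat n < k \<and> v n \<le> u then return M (x n) else null_measure M)"

definition proper_representation ::
    "'w measure \<Rightarrow> 'a measure \<Rightarrow> ('w \<Rightarrow> 'a measure) \<Rightarrow> ('w \<Rightarrow> enat) \<Rightarrow> (nat \<Rightarrow> 'w \<Rightarrow> 'a) \<Rightarrow> bool" where
  "proper_representation \<Omega> M \<eta> \<kappa> X \<longleftrightarrow>
     \<kappa> \<in> measurable \<Omega> (count_space UNIV) \<and>
     (\<forall>n. X n \<in> measurable \<Omega> M) \<and>
     (\<forall>\<omega>\<in>space \<Omega>. \<eta> \<omega> = sum_of_points M (\<kappa> \<omega>) (\<lambda>n. X n \<omega>))"

(* The library's indep_var only relates random variables with values in the same type. *)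
definition independent_rvs ::
    "'w measure \<Rightarrow> 'b measure \<Rightarrow> ('w \<Rightarrow> 'b) \<Rightarrow> 'c measure \<Rightarrow> ('w \<Rightarrow> 'c) \<Rightarrow> bool" where
  "independent_rvs \<Omega> A Y B Z \<longleftrightarrow>
     Y \<in> measurable \<Omega> A \<and> Z \<in> measurable \<Omega> B \<and>
     prob_space.indep_set \<Omega> (sets (vimage_algebra (space \<Omega>) Y A)) (sets (vimage_algebra (space \<Omega>) Z B))"

definition uniform_marks ::
    "'w measure \<Rightarrow> 'a measure \<Rightarrow> ('w \<Rightarrow> enat) \<Rightarrow> (nat \<Rightarrow> 'w \<Rightarrow> 'a) \<Rightarrow> (nat \<Rightarrow> 'w \<Rightarrow> real) \<Rightarrow> bool" where
  "uniform_marks \<Omega> M \<kappa> X U \<longleftrightarrow>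
     (\<forall>n. U n \<in> borel_measurable \<Omega> \<and> distr \<Omega> borel (U n) = uniform_measure lborel {0..1}) \<and>
     prob_space.indep_vars \<Omega> (\<lambda>_. borel) U UNIV \<and>
     independent_rvs \<Omega>
       (count_space UNIV \<Otimes>\<^sub>M PiM UNIV (\<lambda>_. M)) (\<lambda>\<omega>. (\<kappa> \<omega>, \<lambda>n. X n \<omega>))
       (PiM UNIV (\<lambda>_. borel)) (\<lambda>\<omega> n. U n \<omega>)"

definition thinning ::
    "'a measure \<Rightarrow> ('w \<Rightarrow> enat) \<Rightarrow> (nat \<Rightarrow> 'w \<Rightarrow> 'a) \<Rightarrow> (nat \<Rightarrow> 'w \<Rightarrow> real) \<Rightarrow> real \<Rightarrow> 'w \<Rightarrow> 'a measure" where
  "thinning M \<kappa> X U u \<omega> = thinned_sum_of_points M (\<kappa> \<omega>) (\<lambda>n. X n \<omega>) (\<lambda>n. U n \<omega>) u"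

definition add_one_cost :: "'a measure \<Rightarrow> 'a \<Rightarrow> ('a measure \<Rightarrow> real) \<Rightarrow> 'a measure \<Rightarrow> real" where
  "add_one_cost M x F \<mu> = F (measure_add M \<mu> (return M x)) - F \<mu>"

(* Mehler form of the Ornstein-Uhlenbeck semigroup at one fixed time t; the argument \<eta>' is the
   independent process with intensity (1 - exp (- t)) times that of \<eta>. *)
definition ou_semigroup ::
    "'w measure \<Rightarrow> 'a measure \<Rightarrow> ('w \<Rightarrow> 'a measure) \<Rightarrow> ('w \<Rightarrow> enat) \<Rightarrow> (nat \<Rightarrow> 'w \<Rightarrow> 'a) \<Rightarrow>
     (nat \<Rightarrow> 'w \<Rightarrow> real) \<Rightarrow> ('w \<Rightarrow> 'a measure) \<Rightarrow> real \<Rightarrow> ('a measure \<Rightarrow> real) \<Rightarrow> 'w \<Rightarrow> real" where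
  "ou_semigroup \<Omega> M \<eta> \<kappa> X U \<eta>' t F =
     real_cond_exp \<Omega> (vimage_algebra (space \<Omega>) \<eta> (point_measure_algebra M))
       (\<lambda>\<omega>. F (measure_add M (thinning M \<kappa> X U (exp (- t)) \<omega>) (\<eta>' \<omega>)))"

definition Lp_norm :: "'w measure \<Rightarrow> real \<Rightarrow> ('w \<Rightarrow> real) \<Rightarrow> ennreal" where
  "Lp_norm \<Omega> p Y =
     (let I = (\<integral>\<^sup>+\<omega>. ennreal (\<bar>Y \<omega>\<bar> powr p) \<partial>\<Omega>)
      in if I = \<infinity> then \<infinity> else ennreal (enn2real I powr (1 / p)))"

end

theory Submission
  imports Defs
begin

text \<open>Write \<open>u = exp (- t)\<close> and \<open>q = 1 + (p - 1) / u\<close>, and let \<open>\<zeta>\<close> be the thinned process plus the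
  independent one. By duality the claim is the bilinear bound
  \<open>E[F(\<zeta>) G(\<eta>)] \<le> \<parallel>F\<parallel>\<^sub>p \<parallel>G\<parallel>\<^sub>r\<close> with \<open>1/r = 1 - 1/q\<close>. Bilinear bounds tensorise without effort, and
  replacing \<open>F\<close> and \<open>G\<close> by their conditional means given the counts in finitely many disjoint cells
  reduces everything to a single Poisson count; by the Mecke formula the conditional mean of a decreasing
  functional is decreasing in each count. A Poisson count of mean \<open>c\<close> is a sum of \<open>n\<close> counts of mean
  \<open>\<theta> = c/n\<close>, so it suffices to prove the one-count bound for decreasing functions up to a factor
  \<open>exp (O(\<theta>\<^sup>2))\<close>. To first order in \<open>\<theta>\<close> only the values at 0 and 1 matter, and the bound becomes an elementary
  inequality in one variable, which is where monotonicity of \<open>F\<close> is needed.\<close>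

text \<open>For general functionals the inequality is false when t > 0. On a set of small measure
  \<theta>, the indicator of having at least one point has p-norm about \<theta> to the power 1/p.
  Its smoothed version is at least \<open>u\<close> on an event of probability about \<theta>, so
  its q-norm is of order \<theta> to the power 1/q, which is larger since q > p. Monotonicity
  therefore has to be carried through every reduction. Only one of the two functions in the bilinear
  bound lies in a monotone class; the dual function stays arbitrary. The class survives fixing or
  averaging coordinates, adding an independent count and conditioning on counts. Conditioning does
  not increase the norms, by Jensen, and its L1 error for \<open>F (\<zeta> \<omega>)\<close> equals
  that for \<open>F (\<eta> \<omega>)\<close> because \<zeta> and \<eta> have the same law. The
  relation q - 1 = (p - 1) / u does its work at a single point, a comparison of derivatives; the
  second-order errors, added over c / \<theta> steps, tend to 0.\<close>

section \<open>Poisson laws and their coupling\<close>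

text \<open>The library's \<open>poisson_pmf\<close> excludes mean 0.\<close>

definition poi :: "real \<Rightarrow> nat pmf" where
  "poi c = (if 0 < c then poisson_pmf c else return_pmf 0)"

lemma pmf_poi: "0 \<le> c \<Longrightarrow> pmf (poi c) k = c ^ k / fact k * exp (- c)"
  by (cases "c = 0") (auto simp: poi_def zero_power power_0_left)

lemma poi_0 [simp]: "poi 0 = return_pmf 0"
  by (simp add: poi_def)

lemma poi_add:
  assumes "0 \<le> a" "0 \<le> b"
  shows "map_pmf (\<lambda>(x, y). x + y) (pair_pmf (poi a) (poi b)) = poi (a + b)"
proof (rule pmf_eqI)
  fix k :: nat
  have eq: "(\<lambda>(x, y). x + y) -` {k} = (\<lambda>i. (i, k - i)) ` {..k}"
    by (auto simp: image_iff)
  have "pmf (map_pmf (\<lambda>(x, y). x + y) (pair_pmf (poi a) (poi b))) k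
      = (\<Sum>i\<le>k. pmf (poi a) i * pmf (poi b) (k - i))"
    unfolding pmf_map eq
    by (subst measure_measure_pmf_finite) (auto simp: sum.reindex inj_on_def pmf_pair)
  also have "\<dots> = (\<Sum>i\<le>k. of_nat (k choose i) * a ^ i * b ^ (k - i)) / fact k * exp (- (a + b))"
    unfolding sum_divide_distrib sum_distrib_right
  proof (intro sum.cong refl)
    fix i assume "i \<in> {..k}"
    then show "pmf (poi a) i * pmf (poi b) (k - i)
        = of_nat (k choose i) * a ^ i * b ^ (k - i) / fact k * exp (- (a + b))"
      using assms by (simp add: pmf_poi binomial_fact field_simps exp_diff exp_minus exp_add)
  qed
  also have "\<dots> = pmf (poi (a + b)) k"
    using assms by (simp add: pmf_poi binomial_ring)
  finally show "pmf (map_pmf (\<lambda>(x, y). x + y) (pair_pmf (poi a) (poi b))) k = pmf (poi (a + b)) k" .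
qed

text \<open>The joint law of the counts of \<open>\<eta>\<close> and \<open>\<zeta>\<close> in a set of measure \<open>c\<close>: \<open>a\<close> counts the retained
  points, \<open>b\<close> the deleted ones and \<open>d\<close> the points of the independent process.\<close>

definition poisson_coupling :: "real \<Rightarrow> real \<Rightarrow> (nat \<times> nat) pmf" where
  "poisson_coupling u c = map_pmf (\<lambda>(a, b, d). (a + b, a + d))
     (pair_pmf (poi (u * c)) (pair_pmf (poi ((1 - u) * c)) (poi ((1 - u) * c))))"

text \<open>Adding two independent triples coordinate by coordinate requires the six independent
  factors to be grouped by role. The regrouping map is injective, and both laws give each point the
  same product of six weights.\<close>

lemma pair_pmf_regroup:
  fixes A :: "'a pmf" and A' :: "'b pmf" and B :: "'c pmf" and B' :: "'d pmf" and C :: "'e pmf" and C' :: "'f pmf"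
  shows "map_pmf (\<lambda>((a, b, c), (a', b', c')). ((a, a'), (b, b'), (c, c')))
     (pair_pmf (pair_pmf A (pair_pmf B C)) (pair_pmf A' (pair_pmf B' C')))
   = pair_pmf (pair_pmf A A') (pair_pmf (pair_pmf B B') (pair_pmf C C'))" (is "map_pmf ?h ?P = ?Q")
proof (rule pmf_eqI)
  fix z :: "('a \<times> 'b) \<times> ('c \<times> 'd) \<times> 'e \<times> 'f"
  obtain a a' b b' c c' where z: "z = ((a, a'), (b, b'), (c, c'))"
    by (metis surj_pair)
  have "inj ?h" by (auto simp: inj_def)
  then have "pmf (map_pmf ?h ?P) (?h ((a, b, c), (a', b', c'))) = pmf ?P ((a, b, c), (a', b', c'))"
    by (rule pmf_map_inj')
  then show "pmf (map_pmf ?h ?P) z = pmf ?Q z"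
    by (simp add: z pmf_pair)
qed

text \<open>Retained, deleted and new counts are each additive in the mean, and both observed counts
  are sums of them, so the coupling is a convolution semigroup in \<open>c\<close>. This allows a
  large mean to be cut into many small ones.\<close>

lemma poisson_coupling_add:
  assumes u: "0 \<le> u" "u \<le> 1" and c: "0 \<le> c" "0 \<le> d"
  shows "map_pmf (\<lambda>((x, x'), (y, y')). (x + y, x' + y'))
           (pair_pmf (poisson_coupling u c) (poisson_coupling u d)) = poisson_coupling u (c + d)"
proof -
  let ?s = "\<lambda>(x, y). x + y :: nat"
  let ?T = "\<lambda>c. pair_pmf (poi (u * c)) (pair_pmf (poi ((1 - u) * c)) (poi ((1 - u) * c)))"
  have "?T (c + d) = pair_pmf (map_pmf ?s (pair_pmf (poi (u * c)) (poi (u * d))))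
      (pair_pmf (map_pmf ?s (pair_pmf (poi ((1 - u) * c)) (poi ((1 - u) * d))))
         (map_pmf ?s (pair_pmf (poi ((1 - u) * c)) (poi ((1 - u) * d)))))"
    using u c by (simp add: poi_add distrib_left)
  also have "\<dots> = map_pmf (\<lambda>(x, (y, z)). (?s x, (?s y, ?s z)))
     (map_pmf (\<lambda>((a, b, c), (a', b', c')). ((a, a'), (b, b'), (c, c'))) (pair_pmf (?T c) (?T d)))"
    unfolding pair_pmf_regroup
    by (simp add: map_pair[symmetric] case_prod_unfold pair_map_pmf1 pair_map_pmf2 pmf.map_comp o_def)
  finally show ?thesis
    unfolding poisson_coupling_def
    by (simp add: map_pair[symmetric] case_prod_unfold pair_map_pmf1 pair_map_pmf2 pmf.map_comp o_def add_ac)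
qed

lemma expectation_pmf_bounded:
  fixes f :: "'a \<Rightarrow> real"
  assumes "\<And>x. 0 \<le> f x" "\<And>x. f x \<le> B"
  shows "integrable (measure_pmf P) f" "0 \<le> measure_pmf.expectation P f" "measure_pmf.expectation P f \<le> B"
proof -
  show i: "integrable (measure_pmf P) f"
    by (rule measure_pmf.integrable_const_bound[where B=B]) (use assms in auto)
  show "0 \<le> measure_pmf.expectation P f" using assms by simp
  show "measure_pmf.expectation P f \<le> B"
    by (rule measure_pmf.integral_le_const[OF i]) (use assms in auto)
qed

text \<open>Fubini, run through nonnegative integrals: bounded nonnegative functions have partial
  expectations of the same kind, so both orders of integration stay inside one class.\<close>

lemma expectation_pair_pmf_bounded:
  fixes f :: "'a \<times> 'b \<Rightarrow> real"
  assumes "\<And>x. 0 \<le> f x" "\<And>x. f x \<le> B"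
  shows "measure_pmf.expectation (pair_pmf P Q) f
    = measure_pmf.expectation P (\<lambda>x. measure_pmf.expectation Q (\<lambda>y. f (x, y)))"
proof -
  note b = expectation_pmf_bounded[OF assms] expectation_pmf_bounded[of "\<lambda>y. f (_, y)", OF assms]
  have "ennreal (measure_pmf.expectation (pair_pmf P Q) f) = (\<integral>\<^sup>+z. ennreal (f z) \<partial>pair_pmf P Q)"
    using b assms by (subst nn_integral_eq_integral) auto
  also have "\<dots> = (\<integral>\<^sup>+x. ennreal (measure_pmf.expectation Q (\<lambda>y. f (x, y))) \<partial>P)"
    unfolding nn_integral_pair_pmf' using b assms by (subst nn_integral_eq_integral) auto
  also have "\<dots> = ennreal (measure_pmf.expectation P (\<lambda>x. measure_pmf.expectation Q (\<lambda>y. f (x, y))))"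
    by (rule nn_integral_eq_integral) (use expectation_pmf_bounded[of "\<lambda>x. measure_pmf.expectation Q (\<lambda>y. f (x, y))" B] b in auto)
  finally show ?thesis
    using b assms by (subst (asm) ennreal_inj) (auto intro!: integral_nonneg_AE)
qed

section \<open>Scalar inequalities behind the one-count bound\<close>

lemma powr_power_bound:
  assumes "0 \<le> x" "x \<le> (1::real)" "0 < u" "u \<le> 1"
  shows "1 - x \<le> (1 - u * x) powr (1 / u)"
proof -
  \<comment> \<open>Weighted arithmetic-geometric mean with weights \<open>u\<close> and
    \<open>1 - u\<close>. The form of Young's inequality that is applied asks for positive
    arguments, hence the separate case \<open>x = 1\<close>.\<close>
  have "(1 - x) powr u * 1 powr (1 - u) \<le> u * (1 - x) + (1 - u) * 1"
  proof (cases "x = 1")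
    case False
    show ?thesis by (rule Youngs_inequality_0) (use assms False in auto)
  qed (use assms in auto)
  then have "(1 - x) powr u \<le> 1 - u * x" by (simp add: algebra_simps)
  then have "((1 - x) powr u) powr (1 / u) \<le> (1 - u * x) powr (1 / u)"
    by (rule powr_mono2[rotated 2]) (use assms in auto)
  then show ?thesis using assms by (simp add: powr_powr)
qed

text \<open>This compares the coefficients of \<theta> in the logarithms of the two norms in the
  one-count bound, for a function whose value drops by the fraction \<open>s\<close> from count 0 to
  count 1. On the left stand the two effects of smoothing: count 1 sees the drop with weight
  \<open>u\<close>, and count 0 sees it when a new point arrives, at rate \<open>1 - u\<close>. Both
  sides vanish at \<open>s = 0\<close>, so a comparison of derivatives in \<open>s\<close>
  suffices.\<close>

lemma first_order_inequality:
  fixes p u s :: real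
  assumes p: "1 < p" and u: "0 < u" "u \<le> 1" and s: "0 \<le> s" "s \<le> 1"
    and q: "q = 1 + (p - 1) / u"
  shows "((1 - u * s) powr q - 1) / q - s * (1 - u) \<le> ((1 - s) powr p - 1) / p"
proof -
  have q1: "1 < q" using p u by (simp add: q)
  define \<psi> where "\<psi> s = ((1 - s) powr p - 1) / p + s * (1 - u) - ((1 - u * s) powr q - 1) / q" for s
  have cont: "continuous_on {0..s} (\<lambda>x. \<psi> x)" unfolding \<psi>_def
    using s p u q1 by (auto intro!: continuous_intros continuous_on_powr' mult_le_one)
  have "\<psi> 0 \<le> \<psi> s"
  \<comment> \<open>The open-interval form is used because at \<open>s = 1\<close> a base reaches 0,
    where the derivative rule for real powers does not apply; continuity covers the
    endpoint.\<close>
  proof (rule DERIV_nonneg_imp_increasing_open[OF s(1) _ cont])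
    fix x assume x: "0 < x" "x < s"
    then have x1: "x < 1" using s by simp
    moreover have "u * x \<le> x" using u x by (simp add: mult_left_le_one_le)
    ultimately have ux: "u * x < 1" by simp
    have "(\<psi> has_real_derivative ((1 - u) + u * (1 - u * x) powr (q - 1) - (1 - x) powr (p - 1))) (at x)"
    proof -
      have "((\<lambda>s. (1 - s) powr p) has_real_derivative p * (1 - x) powr (p - of_nat 1) * (- 1)) (at x)"
        by (rule DERIV_fun_powr) (use x1 in \<open>auto intro!: derivative_eq_intros\<close>)
      moreover have "((\<lambda>s. (1 - u * s) powr q) has_real_derivative q * (1 - u * x) powr (q - of_nat 1) * (- u)) (at x)"
        by (rule DERIV_fun_powr) (use ux in \<open>auto intro!: derivative_eq_intros\<close>)
      ultimately have "(\<psi> has_real_derivative (((p * (1 - x) powr (p - of_nat 1) * (- 1)) - 0) / p + 1 * (1 - u)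
          - ((q * (1 - u * x) powr (q - of_nat 1) * (- u)) - 0) / q)) (at x)"
        unfolding \<psi>_def by (intro derivative_intros DERIV_cdivide DERIV_cmult_right)
      then show ?thesis using p q1 by (simp add: algebra_simps)
    qed
    moreover have "0 \<le> (1 - u) + u * (1 - u * x) powr (q - 1) - (1 - x) powr (p - 1)"
    proof -
      \<comment> \<open>Here the value of \<open>q\<close> matters: raising the bound on
        \<open>1 - x\<close> to the power \<open>p - 1\<close> produces exactly the exponent
        \<open>(p - 1) / u = q - 1\<close>. This settles the fraction \<open>u\<close> of the term;
        for the fraction \<open>1 - u\<close> it is enough that the power is at most 1.\<close>
      have "(1 - x) powr (p - 1) \<le> ((1 - u * x) powr (1 / u)) powr (p - 1)"
        by (rule powr_mono2) (use powr_power_bound[of x u] x x1 u p in auto)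
      also have "\<dots> = (1 - u * x) powr (q - 1)" by (simp add: powr_powr q)
      finally have *: "u * (1 - x) powr (p - 1) \<le> u * (1 - u * x) powr (q - 1)" using u by simp
      have "(1 - x) powr (p - 1) \<le> 1" using x x1 p by (intro powr_le1) auto
      then have "0 \<le> (1 - u) * (1 - (1 - x) powr (p - 1))" using u by simp
      then show ?thesis using * by (simp add: algebra_simps)
    qed
    ultimately show "\<exists>y. (\<psi> has_real_derivative y) (at x) \<and> 0 \<le> y" by blast
  qed
  then show ?thesis by (simp add: \<psi>_def)
qed

lemma exp_minus_le_quadratic:
  fixes x :: real
  assumes "0 \<le> x"
  shows "exp (- x) \<le> 1 - x + x\<^sup>2 / 2"
proof -
  define f where "f y = 1 - y + y\<^sup>2 / 2 - exp (- y)" for y :: real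
  have "f 0 \<le> f x"
  proof (rule DERIV_nonneg_imp_nondecreasing[OF assms])
    fix y :: real
    have "(f has_real_derivative (- 1 + y + exp (- y))) (at y)"
      unfolding f_def by (auto intro!: derivative_eq_intros)
    moreover have "0 \<le> - 1 + y + exp (- y)" using exp_ge_add_one_self[of "- y"] by simp
    ultimately show "\<exists>d. (f has_real_derivative d) (at y) \<and> 0 \<le> d" by blast
  qed
  then show ?thesis by (simp add: f_def)
qed

lemma Youngs_inequality_nonneg:
  fixes a b \<alpha> :: real
  assumes "0 < \<alpha>" "\<alpha> < 1" "0 \<le> a" "0 \<le> b"
  shows "a powr \<alpha> * b powr (1 - \<alpha>) \<le> \<alpha> * a + (1 - \<alpha>) * b"
proof (cases "a = 0 \<or> b = 0")
  case False
  then show ?thesis using assms by (intro Youngs_inequality_0) auto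
qed (use assms in auto)

text \<open>The first base is the mean of the q-th power of a function of a Poisson count of mean
  \<theta> that equals 1 except at counts 0 and 1, where smoothing lowers it. The second base is the
  part of a mean that comes from counts 0 and 1, for the p-th power of a function with values 1 and
  \<open>x\<close> there. The constant is chosen before \<theta> and \<open>x\<close>, so that later
  one constant serves arbitrarily fine subdivisions.\<close>

lemma one_step_numeric:
  fixes p u :: real
  assumes p: "1 < p" and u: "0 < u" "u \<le> 1" and q: "q = 1 + (p - 1) / u"
  obtains C where "0 \<le> C" and
    "\<And>\<theta> x. 0 \<le> \<theta> \<Longrightarrow> \<theta> \<le> 1 \<Longrightarrow> 0 \<le> x \<Longrightarrow> x \<le> 1 \<Longrightarrow>
       (1 + exp (- \<theta>) * ((1 - (1 - x) * (1 - exp (- ((1 - u) * \<theta>)))) powr q - 1)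
          + \<theta> * exp (- \<theta>) * ((1 - u * (1 - x)) powr q - 1)) powr (1 / q)
       \<le> exp (C * \<theta>\<^sup>2) * (exp (- \<theta>) * (1 + \<theta> * x powr p)) powr (1 / p)"
proof -
  have q1: "1 < q" using p u by (simp add: q)
  \<comment> \<open>The summands of \<open>C1\<close> collect quadratic errors: \<open>q / 2\<close>
    from expanding \<open>exp (- v)\<close>, \<open>q\<^sup>2 / 2\<close> from expanding the power,
    \<open>q\<close> and 1 from replacing \<open>exp (- \<theta>)\<close> by
    \<open>1 - \<theta>\<close>. The extra \<open>1 / p\<close> in \<open>C\<close> pays for the
    bound of ln (1 + z) from below by z - z^2.\<close>
  define C1 where "C1 = q / 2 + q\<^sup>2 / 2 + q + 1"
  define C where "C = C1 / q + 1 / p"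
  show ?thesis
  proof (rule that)
    show "0 \<le> C" using q1 p by (simp add: C_def C1_def)
    fix \<theta> x :: real
    assume t: "0 \<le> \<theta>" "\<theta> \<le> 1" and x: "0 \<le> x" "x \<le> 1"
    define s v where "s = 1 - x" and "v = (1 - u) * \<theta>"
    have s: "0 \<le> s" "s \<le> 1" using x by (auto simp: s_def)
    have v: "0 \<le> v" "v \<le> \<theta>" using t u by (auto simp: v_def mult_left_le_one_le)
    define H0 where "H0 = 1 - s * (1 - exp (- v))"
    define H1 where "H1 = 1 - u * s"
    define A where "A = H0 powr q - 1"
    define B where "B = H1 powr q - 1"
    have ev: "v - v\<^sup>2 / 2 \<le> 1 - exp (- v)"
      using exp_minus_le_quadratic[OF v(1)] by simp
    have ev': "1 - exp (- v) \<le> v" using exp_ge_add_one_self[of "- v"] by simp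
    have ev0: "0 \<le> 1 - exp (- v)" using v by simp
    have H0: "1 - v \<le> H0" "H0 \<le> 1" "0 \<le> H0"
    proof -
      have "s * (1 - exp (- v)) \<le> 1 - exp (- v)" "0 \<le> s * (1 - exp (- v))"
        using ev0 s by (auto intro: mult_left_le_one_le)
      moreover have "1 - exp (- v) \<le> 1" by simp
      ultimately show "1 - v \<le> H0" "H0 \<le> 1" "0 \<le> H0"
        unfolding H0_def using ev' by linarith+
    qed
    have H1: "0 \<le> H1" "H1 \<le> 1" using u s by (auto simp: H1_def mult_le_one)
    have A0: "A \<le> 0" using H0 q1 powr_mono2[of q H0 1] by (simp add: A_def)
    have B0: "B \<le> 0" "- 1 \<le> B" using H1 q1 powr_mono2[of q H1 1] by (auto simp: B_def)
    have A1: "- (q * \<theta>) \<le> A"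
    proof -
      \<comment> \<open>Bernoulli's inequality for the real exponent \<open>q\<close>, obtained from
        Young's inequality with second factor 1.\<close>
      have "(H0 powr q) powr (1 / q) * 1 powr (1 - 1 / q) \<le> 1 / q * H0 powr q + (1 - 1 / q) * 1"
        using q1 by (intro Youngs_inequality_nonneg) auto
      then have "q * H0 \<le> q * (1 / q * H0 powr q + (1 - 1 / q))"
        using q1 H0 by (intro mult_left_mono) (auto simp: powr_powr)
      then have "1 + q * (H0 - 1) \<le> H0 powr q" using q1 by (simp add: algebra_simps)
      moreover have "q * (1 - H0) \<le> q * \<theta>" using H0 v q1 by (intro mult_left_mono) auto
      ultimately show ?thesis by (simp add: A_def algebra_simps)
    qed
    have A2: "A \<le> - q * s * v + (q / 2 + q\<^sup>2 / 2) * \<theta>\<^sup>2"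
    proof -
      define w where "w = q * s * (v - v\<^sup>2 / 2)"
      have vv: "0 \<le> v - v\<^sup>2 / 2" using v t mult_left_le_one_le[of v v] by (simp add: power2_eq_square)
      have w0: "0 \<le> w" using vv s q1 by (simp add: w_def)
      have "s * (v - v\<^sup>2 / 2) \<le> 1 * \<theta>" using s vv v zero_le_power2[of v] by (intro mult_mono) linarith+
      then have "q * (s * (v - v\<^sup>2 / 2)) \<le> q * \<theta>" using q1 by (intro mult_left_mono) auto
      then have w1: "w \<le> q * \<theta>" by (simp add: w_def mult.assoc)
      have "H0 \<le> exp (- (s * (v - v\<^sup>2 / 2)))"
        using exp_ge_add_one_self[of "- (s * (v - v\<^sup>2 / 2))"] mult_left_mono[OF ev s(1)]
        by (simp add: H0_def)
      then have "H0 powr q \<le> exp (- (s * (v - v\<^sup>2 / 2))) powr q"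
        using H0 q1 by (intro powr_mono2) auto
      also have "\<dots> = exp (- w)" by (simp add: powr_def w_def algebra_simps)
      also have "\<dots> \<le> 1 - w + w\<^sup>2 / 2" by (rule exp_minus_le_quadratic[OF w0])
      finally have "A \<le> - w + w\<^sup>2 / 2" by (simp add: A_def)
      also have "w\<^sup>2 \<le> (q * \<theta>)\<^sup>2" using w0 w1 by (intro power_mono)
      also have "- w = - q * s * v + q * s * (v\<^sup>2 / 2)" by (simp add: w_def algebra_simps)
      also have "q * s * (v\<^sup>2 / 2) \<le> q * 1 * (\<theta>\<^sup>2 / 2)"
        using q1 s v by (intro mult_mono power_mono divide_right_mono) auto
      finally show ?thesis by (simp add: algebra_simps power_mult_distrib)
    qed
    define E where "E = exp (- \<theta>) * A + \<theta> * exp (- \<theta>) * B"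
    have E1: "E \<le> - q * s * v + \<theta> * B + C1 * \<theta>\<^sup>2"
    proof -
      have neg: "A + \<theta> * B \<le> 0" using A0 B0 t by (simp add: add_nonpos_nonpos mult_nonneg_nonpos)
      have "E = exp (- \<theta>) * (A + \<theta> * B)" by (simp add: E_def algebra_simps)
      \<comment> \<open>The factor \<open>A + \<theta> * B\<close> is at most 0, so the lower bound
        \<open>1 - \<theta>\<close> for the exponential turns into an upper bound for the
        product.\<close>
      also have "\<dots> \<le> (1 - \<theta>) * (A + \<theta> * B)"
        using neg exp_ge_add_one_self[of "- \<theta>"] by (intro mult_right_mono_neg) auto
      also have "\<dots> = A + \<theta> * B + \<theta> * (- A) + \<theta> * \<theta> * (- B)" by (simp add: algebra_simps)
      also have "\<theta> * (- A) \<le> \<theta> * (q * \<theta>)" using A1 t by (intro mult_left_mono) auto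
      also have "\<theta> * \<theta> * (- B) \<le> \<theta> * \<theta> * 1" using B0 t by (intro mult_left_mono) auto
      finally show ?thesis using A2 by (simp add: C1_def power2_eq_square algebra_simps)
    qed
    have key: "B / q - s * (1 - u) \<le> (x powr p - 1) / p"
      using first_order_inequality[OF p u s q] by (simp add: B_def H1_def s_def)
    have "E / q \<le> (- q * s * v + \<theta> * B + C1 * \<theta>\<^sup>2) / q"
      using E1 q1 by (intro divide_right_mono) auto
    also have "\<dots> = \<theta> * (B / q - s * (1 - u)) + C1 / q * \<theta>\<^sup>2"
      using q1 by (simp add: v_def field_simps)
    also have "\<dots> \<le> \<theta> * ((x powr p - 1) / p) + C1 / q * \<theta>\<^sup>2"
      using key t by (intro add_right_mono mult_left_mono) auto
    also have "\<dots> = C * \<theta>\<^sup>2 + (- \<theta> + (\<theta> * x powr p - \<theta>\<^sup>2)) / p"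
      using p q1 by (simp add: C_def field_simps)
    also have "\<dots> \<le> C * \<theta>\<^sup>2 + (- \<theta> + ln (1 + \<theta> * x powr p)) / p"
    proof -
      have xp: "0 \<le> x powr p" "x powr p \<le> 1" using x p by (auto intro: powr_le1)
      have z: "0 \<le> \<theta> * x powr p" "\<theta> * x powr p \<le> 1" using xp t by (auto intro: mult_le_one)
      have "(\<theta> * x powr p)\<^sup>2 \<le> \<theta>\<^sup>2" using xp t by (intro power_mono) (auto intro: mult_right_le_one_le)
      then have "\<theta> * x powr p - \<theta>\<^sup>2 \<le> ln (1 + \<theta> * x powr p)"
        using ln_one_plus_pos_lower_bound[OF z] by simp
      then show ?thesis using p by (intro add_left_mono divide_right_mono) auto
    qed
    finally have EE: "E / q \<le> C * \<theta>\<^sup>2 + (- \<theta> + ln (1 + \<theta> * x powr p)) / p" .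
    have pos: "0 < 1 + \<theta> * x powr p" using t by (simp add: add_pos_nonneg)
    \<comment> \<open>\<open>1 + E\<close> is a mean of nonnegative numbers whose weights are the
      probabilities of the counts 0, 1 and at least 2. Its sign has to be known before roots are
      compared.\<close>
    have E0: "0 \<le> 1 + E"
    proof -
      have "(1 + \<theta>) * exp (- \<theta>) \<le> exp \<theta> * exp (- \<theta>)"
        using exp_ge_add_one_self[of \<theta>] by (intro mult_right_mono) auto
      then have "0 \<le> 1 - exp (- \<theta>) - \<theta> * exp (- \<theta>)" by (simp add: exp_minus algebra_simps)
      moreover have "1 + E = (1 - exp (- \<theta>) - \<theta> * exp (- \<theta>)) + exp (- \<theta>) * H0 powr q + \<theta> * exp (- \<theta>) * H1 powr q"
        by (simp add: E_def A_def B_def algebra_simps)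
      moreover have "0 \<le> exp (- \<theta>) * H0 powr q" "0 \<le> \<theta> * exp (- \<theta>) * H1 powr q"
        using t by auto
      ultimately show ?thesis by linarith
    qed
    have "(1 + E) powr (1 / q) \<le> exp E powr (1 / q)"
      using E0 q1 exp_ge_add_one_self[of E] by (intro powr_mono2) auto
    also have "\<dots> = exp (E / q)" by (simp add: powr_def)
    also have "\<dots> \<le> exp (C * \<theta>\<^sup>2 + (- \<theta> + ln (1 + \<theta> * x powr p)) / p)" using EE by simp
    also have "\<dots> = exp (C * \<theta>\<^sup>2) * (exp (- \<theta>) * (1 + \<theta> * x powr p)) powr (1 / p)"
      using pos by (simp add: powr_def exp_add ln_mult)
    finally show "(1 + exp (- \<theta>) * ((1 - (1 - x) * (1 - exp (- ((1 - u) * \<theta>)))) powr q - 1)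
          + \<theta> * exp (- \<theta>) * ((1 - u * (1 - x)) powr q - 1)) powr (1 / q)
       \<le> exp (C * \<theta>\<^sup>2) * (exp (- \<theta>) * (1 + \<theta> * x powr p)) powr (1 / p)"
      by (simp add: E_def A_def B_def H0_def H1_def s_def v_def algebra_simps)
  qed
qed

section \<open>Hoelder's inequality and bilinear bounds for coupled variables\<close>

lemma Holder_powr:
  fixes a b :: "'a \<Rightarrow> real"
  assumes \<alpha>: "0 < \<alpha>" "\<alpha> < 1" and i: "integrable M a" "integrable M b"
    and n: "\<And>x. 0 \<le> a x" "\<And>x. 0 \<le> b x"
  shows "integrable M (\<lambda>x. a x powr \<alpha> * b x powr (1 - \<alpha>))"
    "(\<integral>x. a x powr \<alpha> * b x powr (1 - \<alpha>) \<partial>M) \<le> (\<integral>x. a x \<partial>M) powr \<alpha> * (\<integral>x. b x \<partial>M) powr (1 - \<alpha>)"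
proof -
  have [measurable]: "a \<in> borel_measurable M" "b \<in> borel_measurable M" using i by auto
  note Y = Youngs_inequality_nonneg[OF \<alpha>]
  show int: "integrable M (\<lambda>x. a x powr \<alpha> * b x powr (1 - \<alpha>))"
    by (rule Bochner_Integration.integrable_bound[of _ "\<lambda>x. \<alpha> * a x + (1 - \<alpha>) * b x"])
       (use i n \<alpha> Y in \<open>auto simp: abs_mult\<close>)
  define A B where "A = (\<integral>x. a x \<partial>M)" and "B = (\<integral>x. b x \<partial>M)"
  have AB: "0 \<le> A" "0 \<le> B" using n by (auto simp: A_def B_def)
  show "(\<integral>x. a x powr \<alpha> * b x powr (1 - \<alpha>) \<partial>M) \<le> (\<integral>x. a x \<partial>M) powr \<alpha> * (\<integral>x. b x \<partial>M) powr (1 - \<alpha>)"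
  proof (cases "A = 0 \<or> B = 0")
    case True
    then have "(AE x in M. a x = 0) \<or> (AE x in M. b x = 0)"
      using integral_nonneg_eq_0_iff_AE[OF i(1)] integral_nonneg_eq_0_iff_AE[OF i(2)] n
      by (auto simp: A_def B_def)
    then have "AE x in M. a x powr \<alpha> * b x powr (1 - \<alpha>) = 0" by auto
    then have "(\<integral>x. a x powr \<alpha> * b x powr (1 - \<alpha>) \<partial>M) = 0" by (rule integral_eq_zero_AE)
    then show ?thesis by simp
  next
    case False
    then have pos: "0 < A" "0 < B" using AB by auto
    define K where "K = A powr \<alpha> * B powr (1 - \<alpha>)"
    have K: "0 < K" using pos by (simp add: K_def)
    have "(\<integral>x. a x powr \<alpha> * b x powr (1 - \<alpha>) \<partial>M)
        \<le> (\<integral>x. K * (\<alpha> * (a x / A) + (1 - \<alpha>) * (b x / B)) \<partial>M)"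
    proof (rule integral_mono[OF int])
      show "integrable M (\<lambda>x. K * (\<alpha> * (a x / A) + (1 - \<alpha>) * (b x / B)))" using i by auto
      fix x
      \<comment> \<open>Young's inequality is applied pointwise after dividing by the integrals; the
        constant \<open>K\<close> restores the scale. If an integral is 0, the product vanishes
        almost everywhere, which is the case split off before.\<close>
      have "a x powr \<alpha> * b x powr (1 - \<alpha>) = K * ((a x / A) powr \<alpha> * (b x / B) powr (1 - \<alpha>))"
        using n pos by (simp add: K_def powr_divide)
      also have "\<dots> \<le> K * (\<alpha> * (a x / A) + (1 - \<alpha>) * (b x / B))"
        using K n pos by (intro mult_left_mono Y) auto
      finally show "a x powr \<alpha> * b x powr (1 - \<alpha>) \<le> K * (\<alpha> * (a x / A) + (1 - \<alpha>) * (b x / B))" .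
    qed
    also have "\<dots> = K * (\<alpha> * (A / A) + (1 - \<alpha>) * (B / B))"
      using i by (simp add: A_def B_def)
    also have "\<dots> = K" using pos by simp
    finally show ?thesis by (simp add: K_def A_def B_def)
  qed
qed

text \<open>The first component of \<open>J\<close> carries \<gamma>, the second \<phi>. They stand
  for powers: with \<phi> = f^p, \<gamma> = g^r, \<alpha> = 1/p and \<beta> = 1/r the bound reads
  E[f(X') g(X)] \<le> K |f|_p |g|_r. Written this way the right-hand side contains plain
  expectations, so partial expectations of \<phi> and \<gamma> can be inserted again. Only \<phi> is
  confined to the class \<open>D\<close>.\<close>

definition coupling_bound :: "real \<Rightarrow> real \<Rightarrow> real \<Rightarrow> ('a \<times> 'a) pmf \<Rightarrow> 'a pmf \<Rightarrow> ('a \<Rightarrow> real) set \<Rightarrow> bool" where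
  "coupling_bound \<alpha> \<beta> K J P D \<longleftrightarrow>
     (\<forall>\<phi>\<in>D. \<forall>\<gamma> B. (\<forall>x. 0 \<le> \<phi> x \<and> \<phi> x \<le> B) \<longrightarrow> (\<forall>x. 0 \<le> \<gamma> x \<and> \<gamma> x \<le> B) \<longrightarrow>
        (\<integral>\<^sup>+(x, x'). ennreal (\<phi> x' powr \<alpha> * \<gamma> x powr \<beta>) \<partial>measure_pmf J)
        \<le> ennreal (K * measure_pmf.expectation P \<phi> powr \<alpha> * measure_pmf.expectation P \<gamma> powr \<beta>))"

lemma coupling_boundD:
  assumes "coupling_bound \<alpha> \<beta> K J P D" "\<phi> \<in> D"
    "\<And>x. 0 \<le> \<phi> x" "\<And>x. \<phi> x \<le> B" "\<And>x. 0 \<le> \<gamma> x" "\<And>x. \<gamma> x \<le> B"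
  shows "(\<integral>\<^sup>+(x, x'). ennreal (\<phi> x' powr \<alpha> * \<gamma> x powr \<beta>) \<partial>measure_pmf J)
     \<le> ennreal (K * measure_pmf.expectation P \<phi> powr \<alpha> * measure_pmf.expectation P \<gamma> powr \<beta>)"
  using assms unfolding coupling_bound_def by blast

text \<open>Bilinear inequalities tensorise directly: integrate out one factor, then apply the other bound
  to the partial expectations, which inherit the monotonicity.\<close>

lemma coupling_bound_combine:
  fixes comb :: "'a \<Rightarrow> 'b \<Rightarrow> 'c" and D :: "('c \<Rightarrow> real) set"
  assumes J1: "coupling_bound \<alpha> \<beta> K1 J1 P1 D1" and J2: "coupling_bound \<alpha> \<beta> K2 J2 P2 D2"
    and K: "0 \<le> K1" "0 \<le> K2"
    and D: "\<And>\<phi> B x. \<phi> \<in> D \<Longrightarrow> (\<And>z. 0 \<le> \<phi> z) \<Longrightarrow> (\<And>z. \<phi> z \<le> B) \<Longrightarrow> (\<lambda>y. \<phi> (comb x y)) \<in> D2"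
      "\<And>\<phi> B. \<phi> \<in> D \<Longrightarrow> (\<And>z. 0 \<le> \<phi> z) \<Longrightarrow> (\<And>z. \<phi> z \<le> B) \<Longrightarrow>
         (\<lambda>x. measure_pmf.expectation P2 (\<lambda>y. \<phi> (comb x y))) \<in> D1"
  shows "coupling_bound \<alpha> \<beta> (K1 * K2)
    (map_pmf (\<lambda>((x, x'), (y, y')). (comb x y, comb x' y')) (pair_pmf J1 J2))
    (map_pmf (\<lambda>(x, y). comb x y) (pair_pmf P1 P2)) D"
  unfolding coupling_bound_def
proof (intro ballI allI impI)
  fix \<phi> \<gamma> :: "'c \<Rightarrow> real" and B
  assume \<phi>: "\<phi> \<in> D" and "\<forall>x. 0 \<le> \<phi> x \<and> \<phi> x \<le> B" "\<forall>x. 0 \<le> \<gamma> x \<and> \<gamma> x \<le> B"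
  then have b: "\<And>x. 0 \<le> \<phi> x" "\<And>x. \<phi> x \<le> B" "\<And>x. 0 \<le> \<gamma> x" "\<And>x. \<gamma> x \<le> B" by auto
  define \<phi>' \<gamma>' where "\<phi>' x = measure_pmf.expectation P2 (\<lambda>y. \<phi> (comb x y))"
    and "\<gamma>' x = measure_pmf.expectation P2 (\<lambda>y. \<gamma> (comb x y))" for x
  have b': "\<And>x. 0 \<le> \<phi>' x" "\<And>x. \<phi>' x \<le> B" "\<And>x. 0 \<le> \<gamma>' x" "\<And>x. \<gamma>' x \<le> B"
    unfolding \<phi>'_def \<gamma>'_def using b by (auto intro!: expectation_pmf_bounded)
  have "(\<integral>\<^sup>+(z, z'). ennreal (\<phi> z' powr \<alpha> * \<gamma> z powr \<beta>)
       \<partial>map_pmf (\<lambda>((x, x'), (y, y')). (comb x y, comb x' y')) (pair_pmf J1 J2))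
    = (\<integral>\<^sup>+(x, x'). (\<integral>\<^sup>+(y, y'). ennreal (\<phi> (comb x' y') powr \<alpha> * \<gamma> (comb x y) powr \<beta>) \<partial>J2) \<partial>J1)"
    by (simp add: nn_integral_pair_pmf' case_prod_unfold)
  also have "\<dots> \<le> (\<integral>\<^sup>+(x, x'). ennreal (K2 * \<phi>' x' powr \<alpha> * \<gamma>' x powr \<beta>) \<partial>J1)"
  proof (intro nn_integral_mono, clarify)
    fix x x'
    show "(\<integral>\<^sup>+(y, y'). ennreal (\<phi> (comb x' y') powr \<alpha> * \<gamma> (comb x y) powr \<beta>) \<partial>J2)
        \<le> ennreal (K2 * \<phi>' x' powr \<alpha> * \<gamma>' x powr \<beta>)"
      unfolding \<phi>'_def \<gamma>'_def
      by (rule coupling_boundD[OF J2, where B=B]) (use b D(1)[OF \<phi> b(1,2)] in auto)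
  qed
  also have "\<dots> = ennreal K2 * (\<integral>\<^sup>+(x, x'). ennreal (\<phi>' x' powr \<alpha> * \<gamma>' x powr \<beta>) \<partial>J1)"
    using K by (subst nn_integral_cmult[symmetric]) (auto simp: case_prod_unfold ennreal_mult' mult.assoc)
  also have "\<dots> \<le> ennreal K2 * ennreal (K1 * measure_pmf.expectation P1 \<phi>' powr \<alpha> * measure_pmf.expectation P1 \<gamma>' powr \<beta>)"
    by (intro mult_left_mono coupling_boundD[OF J1, where B=B])
      (use b' D(2)[OF \<phi> b(1,2)] in \<open>auto simp: \<phi>'_def[abs_def]\<close>)
  also have "\<dots> = ennreal (K1 * K2 * measure_pmf.expectation P1 \<phi>' powr \<alpha> * measure_pmf.expectation P1 \<gamma>' powr \<beta>)"
    using K by (simp add: ennreal_mult'[symmetric] mult_ac)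
  also have "measure_pmf.expectation P1 \<phi>' = measure_pmf.expectation (map_pmf (\<lambda>(x, y). comb x y) (pair_pmf P1 P2)) \<phi>"
    using b by (simp add: \<phi>'_def[abs_def] expectation_pair_pmf_bounded[where B=B] case_prod_unfold)
  also have "measure_pmf.expectation P1 \<gamma>' = measure_pmf.expectation (map_pmf (\<lambda>(x, y). comb x y) (pair_pmf P1 P2)) \<gamma>"
    using b by (simp add: \<gamma>'_def[abs_def] expectation_pair_pmf_bounded[where B=B] case_prod_unfold)
  finally show "(\<integral>\<^sup>+(z, z'). ennreal (\<phi> z' powr \<alpha> * \<gamma> z powr \<beta>)
       \<partial>map_pmf (\<lambda>((x, x'), (y, y')). (comb x y, comb x' y')) (pair_pmf J1 J2))
    \<le> ennreal (K1 * K2 * measure_pmf.expectation (map_pmf (\<lambda>(x, y). comb x y) (pair_pmf P1 P2)) \<phi> powr \<alpha>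
        * measure_pmf.expectation (map_pmf (\<lambda>(x, y). comb x y) (pair_pmf P1 P2)) \<gamma> powr \<beta>)" .
qed

text \<open>Given the \<eta>-count, the mean of \<open>f\<close> at the \<zeta>-count is dominated
  by a function \<open>H\<close> that sees only the drop from \<open>f 0\<close> to
  \<open>f 1\<close>; Hoelder with \<open>q\<close> and its conjugate then leaves the q-norm of
  \<open>H\<close> to be estimated. Monotonicity enters twice: values of \<open>f\<close> at
  positive counts are at most \<open>f 1\<close>, and all values are at most
  \<open>f 0\<close>.\<close>

lemma coupling_bound_one_step:
  fixes p u :: real
  assumes p: "1 < p" and u: "0 < u" "u \<le> 1" and q: "q = 1 + (p - 1) / u"
  obtains C where "0 \<le> C" and "\<And>\<theta>. 0 \<le> \<theta> \<Longrightarrow> \<theta> \<le> 1 \<Longrightarrow>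
    coupling_bound (1 / p) (1 - 1 / q) (exp (C * \<theta>\<^sup>2)) (poisson_coupling u \<theta>) (poi \<theta>) {\<phi>. decseq \<phi>}"
proof -
  have q1: "1 < q" using p u by (simp add: q)
  obtain C where C: "0 \<le> C"
    "\<And>\<theta> x. 0 \<le> \<theta> \<Longrightarrow> \<theta> \<le> 1 \<Longrightarrow> 0 \<le> x \<Longrightarrow> x \<le> 1 \<Longrightarrow>
       (1 + exp (- \<theta>) * ((1 - (1 - x) * (1 - exp (- ((1 - u) * \<theta>)))) powr q - 1)
          + \<theta> * exp (- \<theta>) * ((1 - u * (1 - x)) powr q - 1)) powr (1 / q)
       \<le> exp (C * \<theta>\<^sup>2) * (exp (- \<theta>) * (1 + \<theta> * x powr p)) powr (1 / p)"
    using one_step_numeric[OF assms] by metis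
  show ?thesis
  proof (rule that[OF C(1)])
    fix \<theta> :: real assume t: "0 \<le> \<theta>" "\<theta> \<le> 1"
    show "coupling_bound (1 / p) (1 - 1 / q) (exp (C * \<theta>\<^sup>2)) (poisson_coupling u \<theta>) (poi \<theta>) {\<phi>. decseq \<phi>}"
      unfolding coupling_bound_def
    proof (intro ballI allI impI)
      fix \<phi> \<gamma> :: "nat \<Rightarrow> real" and B
      assume dec: "\<phi> \<in> {\<phi>. decseq \<phi>}" and "\<forall>x. 0 \<le> \<phi> x \<and> \<phi> x \<le> B" "\<forall>x. 0 \<le> \<gamma> x \<and> \<gamma> x \<le> B"
      then have b: "\<And>x. 0 \<le> \<phi> x" "\<And>x. \<phi> x \<le> B" "\<And>x. 0 \<le> \<gamma> x" "\<And>x. \<gamma> x \<le> B" by auto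
      define f g where "f n = \<phi> n powr (1 / p)" and "g n = \<gamma> n powr (1 - 1 / q)" for n
      define v where "v = (1 - u) * \<theta>"
      define T where "T = pair_pmf (poi (u * \<theta>)) (pair_pmf (poi v) (poi v))"
      have f: "\<And>n. 0 \<le> f n" by (simp add: f_def)
      have g: "\<And>n. 0 \<le> g n" by (simp add: g_def)
      have fdec: "f n \<le> f m" if "m \<le> n" for m n
        using dec that b p by (auto simp: f_def decseq_def intro!: powr_mono2)
      have gB: "g n \<le> B powr (1 - 1 / q)" for n
        using b q1 by (auto simp: g_def intro!: powr_mono2)
      define s0 where "s0 = f 0 - f 1"
      have s0: "0 \<le> s0" "s0 \<le> f 0" using fdec[of 0 1] f by (auto simp: s0_def)
      \<comment> \<open>From \<open>f 0\<close> the drop \<open>s0\<close> is subtracted, weighted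
        by a lower bound for the conditional probability that the coupled count is positive:
        \<open>1 - exp (- v)\<close> given count 0, where a new point must arrive, and
        \<open>u\<close> given count 1, where the point is retained. Counts of 2 and more keep the
        crude value \<open>f 0\<close>; their probability is of order \<theta> squared.\<close>
      define H where "H n = f 0 - s0 * (1 - exp (- v)) * indicator {0} n - u * s0 * indicator {1} n" for n :: nat
      have H: "0 \<le> H n" "H n \<le> f 0" for n
      proof -
        have v0: "0 \<le> v" using t u by (simp add: v_def)
        have "s0 * (1 - exp (- v)) \<le> s0" "0 \<le> s0 * (1 - exp (- v))" "u * s0 \<le> s0" "0 \<le> u * s0"
          using s0 u v0 by (auto intro: mult_left_le mult_left_le_one_le)
        then show "0 \<le> H n" "H n \<le> f 0" using s0 by (auto simp: H_def indicator_def)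
      qed
      define k where "k = (\<lambda>(a, b, d). f (a + d) * g (a + b))"
      \<comment> \<open>On \<open>S0\<close> there is no old point and at least one new one; on
        \<open>S1\<close> there is exactly one old point and it is retained. Both force a positive
        \<zeta>-count. Deletion of a single old point followed by an arrival is given up, being of
        second order.\<close>
      define S0 S1 :: "(nat \<times> nat \<times> nat) set" where "S0 = {0} \<times> {0} \<times> - {0}" and "S1 = {1} \<times> {0} \<times> UNIV"
      define m :: "nat \<times> nat \<times> nat \<Rightarrow> nat" where "m = (\<lambda>(a, b, d). a + b)"
      have int_bd: "integrable (measure_pmf T) h" if "\<And>x. 0 \<le> h x" "\<And>x. h x \<le> B'" for h :: "_ \<Rightarrow> real" and B'
        using expectation_pmf_bounded[of h B'] that by auto
      have int_g: "integrable (measure_pmf T) (\<lambda>x. g (m x))"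
        by (rule int_bd[where B'="B powr (1 - 1 / q)"]) (use g gB in auto)
      have k0: "0 \<le> k x" "k x \<le> f 0 * B powr (1 - 1 / q)" for x
        using f g gB fdec by (auto simp: k_def case_prod_unfold intro!: mult_mono)
      have marg: "map_pmf m T = poi \<theta>"
      proof -
        have "map_pmf m T = map_pmf (\<lambda>(x, y). x + y) (pair_pmf (poi (u * \<theta>)) (map_pmf fst (pair_pmf (poi v) (poi v))))"
          unfolding T_def m_def pair_map_pmf2 pmf.map_comp by (simp add: o_def case_prod_unfold)
        also have "\<dots> = poi (u * \<theta> + v)"
          unfolding map_fst_pair_pmf using t u by (intro poi_add) (auto simp: v_def)
        finally show ?thesis by (simp add: v_def algebra_simps)
      qed
      have uv: "0 \<le> u * \<theta>" "0 \<le> v" using t u by (auto simp: v_def)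
      have P0: "measure_pmf.prob (poi c) {0} = exp (- c)" "measure_pmf.prob (poi c) (- {0}) = 1 - exp (- c)" 
         "measure_pmf.prob (poi c) {1} = c * exp (- c)" if "0 \<le> c" for c
        using that measure_pmf.prob_compl[of "{0}" "poi c"]
        by (simp_all add: measure_pmf_single pmf_poi Compl_eq_Diff_UNIV)
      have S0: "measure_pmf.prob T S0 = exp (- \<theta>) * (1 - exp (- v))"
        unfolding T_def S0_def using uv
        by (simp add: measure_pmf_prob_product P0 mult.assoc[symmetric] exp_add[symmetric]) (simp add: v_def algebra_simps)
      have S1: "measure_pmf.prob T S1 = u * \<theta> * exp (- \<theta>)"
        unfolding T_def S1_def using uv
        by (simp add: measure_pmf_prob_product P0[unfolded One_nat_def] exp_add[symmetric]) (simp add: v_def algebra_simps exp_add[symmetric])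
      have "(\<integral>\<^sup>+(x, x'). ennreal (\<phi> x' powr (1 / p) * \<gamma> x powr (1 - 1 / q)) \<partial>poisson_coupling u \<theta>)
          = (\<integral>\<^sup>+x. ennreal (k x) \<partial>T)"
        by (simp add: poisson_coupling_def T_def v_def f_def g_def case_prod_unfold k_def)
      also have "\<dots> = ennreal (measure_pmf.expectation T k)"
        by (rule nn_integral_eq_integral[OF int_bd[OF k0]]) (use k0 in auto)
      also have "measure_pmf.expectation T k
          \<le> measure_pmf.expectation T (\<lambda>x. f 0 * g (m x) - s0 * g 0 * indicator S0 x - s0 * g 1 * indicator S1 x)"
      proof (rule integral_mono[OF int_bd[OF k0]])
        show "integrable (measure_pmf T) (\<lambda>x. f 0 * g (m x) - s0 * g 0 * indicator S0 x - s0 * g 1 * indicator S1 x)"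
          using int_g int_bd[of "indicator S0" 1] int_bd[of "indicator S1" 1]
          by (intro Bochner_Integration.integrable_diff integrable_mult_right) auto
        fix x :: "nat \<times> nat \<times> nat"
        obtain a b d where x: "x = (a, b, d)" by (metis surj_pair)
        consider "a = 0" "b = 0" "d \<noteq> 0" | "a = 1" "b = 0" | "x \<notin> S0" "x \<notin> S1"
          by (auto simp: x S0_def S1_def)
        then show "k x \<le> f 0 * g (m x) - s0 * g 0 * indicator S0 x - s0 * g 1 * indicator S1 x"
        proof cases
          case 1
          then have "f d * g 0 \<le> f 1 * g 0" using g fdec by (intro mult_right_mono) auto
          then show ?thesis using 1 by (simp add: x S0_def S1_def k_def m_def s0_def algebra_simps)
        next
          case 2
          then have "f (1 + d) * g 1 \<le> f 1 * g 1" using g fdec by (intro mult_right_mono) auto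
          then show ?thesis using 2 by (simp add: x S0_def S1_def k_def m_def s0_def algebra_simps)
        next
          case 3
          have "f (a + d) * g (a + b) \<le> f 0 * g (a + b)" using g fdec by (intro mult_right_mono) auto
          then show ?thesis using 3 by (simp add: x k_def m_def)
        qed
      qed
      also have "\<dots> = f 0 * measure_pmf.expectation (poi \<theta>) g - s0 * g 0 * (exp (- \<theta>) * (1 - exp (- v)))
             - s0 * g 1 * (u * \<theta> * exp (- \<theta>))"
        using int_g int_bd[of "indicator _" 1] by (simp add: S0 S1 marg[symmetric])
      also have "\<dots> = measure_pmf.expectation (poi \<theta>) (\<lambda>n. H n * g n)"
      proof -
        have "integrable (measure_pmf (poi \<theta>)) g"
          by (rule expectation_pmf_bounded) (use g gB in auto)
        moreover have eq: "(\<lambda>n. H n * g n) = (\<lambda>n. f 0 * g n - s0 * (1 - exp (- v)) * g 0 * indicator {0} n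
            - u * s0 * g 1 * indicator {1} n)"
          by (auto simp: H_def indicator_def algebra_simps)
        moreover have "integrable (measure_pmf (poi \<theta>)) (indicator A :: nat \<Rightarrow> real)" for A
          by (rule expectation_pmf_bounded(1)[where B=1]) auto
        ultimately show ?thesis using P0(1,3)[OF t(1)]
          by (simp add: eq)
      qed
      also have "\<dots> \<le> measure_pmf.expectation (poi \<theta>) (\<lambda>n. H n powr q) powr (1 / q) *
           measure_pmf.expectation (poi \<theta>) \<gamma> powr (1 - 1 / q)"
      proof -
        have "H n powr q \<le> f 0 powr q" for n
          using H q1 by (intro powr_mono2) auto
        then have "integrable (measure_pmf (poi \<theta>)) (\<lambda>n. H n powr q)" "integrable (measure_pmf (poi \<theta>)) \<gamma>"
          using expectation_pmf_bounded(1)[of "\<lambda>n. H n powr q"] expectation_pmf_bounded(1)[of \<gamma> B] b by auto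
        from Holder_powr(2)[of "1 / q", OF _ _ this] show ?thesis
          using q1 b H by (simp add: powr_powr g_def)
      qed
      also have "\<dots> \<le> exp (C * \<theta>\<^sup>2) * measure_pmf.expectation (poi \<theta>) \<phi> powr (1 / p) *
           measure_pmf.expectation (poi \<theta>) \<gamma> powr (1 - 1 / q)"
      proof (intro mult_right_mono)
        show "measure_pmf.expectation (poi \<theta>) (\<lambda>n. H n powr q) powr (1 / q)
            \<le> exp (C * \<theta>\<^sup>2) * measure_pmf.expectation (poi \<theta>) \<phi> powr (1 / p)"
        \<comment> \<open>If \<open>f 0\<close> is 0 then so is \<open>H\<close>; otherwise division
          by \<open>f 0\<close> reduces the bound to the scalar inequality for the ratio
          \<open>x\<close> of the values at 1 and 0.\<close>
        proof (cases "f 0 = 0")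
          case True
          then have "H n = 0" for n using H[of n] by auto
          then show ?thesis by simp
        next
          case False
          then have f0: "0 < f 0" using f[of 0] by simp
          define x where "x = f 1 / f 0"
          have x: "0 \<le> x" "x \<le> 1" using f f0 fdec[of 0 1] by (auto simp: x_def)
          define h0 h1 where "h0 = 1 - (1 - x) * (1 - exp (- v))" and "h1 = 1 - u * (1 - x)"
          have Hh: "H 0 = f 0 * h0" "H 1 = f 0 * h1"
            using f0 by (auto simp: H_def h0_def h1_def s0_def x_def field_simps)
          then have h: "0 \<le> h0" "0 \<le> h1" using H[of 0] H[of 1] f0 by (auto simp: zero_le_mult_iff)
          have eq: "(\<lambda>n. H n powr q) = (\<lambda>n. f 0 powr q * (1 + (h0 powr q - 1) * indicator {0} n
              + (h1 powr q - 1) * indicator {1} n))"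
          proof
            fix n :: nat
            consider "n = 0" | "n = 1" | "n \<noteq> 0" "n \<noteq> 1" by blast
            then show "H n powr q = f 0 powr q * (1 + (h0 powr q - 1) * indicator {0} n + (h1 powr q - 1) * indicator {1} n)"
              using Hh f0 h by cases (auto simp: powr_mult H_def)
          qed
          have ind: "integrable (measure_pmf (poi \<theta>)) (indicator A :: nat \<Rightarrow> real)" for A
            by (rule expectation_pmf_bounded(1)[where B=1]) auto
          then have "measure_pmf.expectation (poi \<theta>) (\<lambda>n. H n powr q)
              = f 0 powr q * (1 + exp (- \<theta>) * (h0 powr q - 1) + \<theta> * exp (- \<theta>) * (h1 powr q - 1))"
            using P0(1,3)[OF t(1)] by (simp add: eq)
          then have "measure_pmf.expectation (poi \<theta>) (\<lambda>n. H n powr q) powr (1 / q)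
              = f 0 * (1 + exp (- \<theta>) * (h0 powr q - 1) + \<theta> * exp (- \<theta>) * (h1 powr q - 1)) powr (1 / q)"
            using f0 q1 by (simp add: powr_mult powr_powr)
          also have "\<dots> \<le> f 0 * (exp (C * \<theta>\<^sup>2) * (exp (- \<theta>) * (1 + \<theta> * x powr p)) powr (1 / p))"
            using f0 C(2)[OF t x] by (intro mult_left_mono) (auto simp: h0_def h1_def v_def)
          also have "\<dots> = exp (C * \<theta>\<^sup>2) * (exp (- \<theta>) * (f 0 powr p + \<theta> * f 1 powr p)) powr (1 / p)"
          proof -
            have "f 0 = (f 0 powr p) powr (1 / p)" using p f0 by (simp add: powr_powr)
            then have "f 0 * (exp (- \<theta>) * (1 + \<theta> * x powr p)) powr (1 / p) = (f 0 powr p * (exp (- \<theta>) * (1 + \<theta> * x powr p))) powr (1 / p)"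
              by (simp add: powr_mult)
            also have "f 0 powr p * (exp (- \<theta>) * (1 + \<theta> * x powr p)) = exp (- \<theta>) * (f 0 powr p + \<theta> * f 1 powr p)"
              using f0 f by (simp add: x_def powr_divide field_simps)
            finally show ?thesis by (simp add: algebra_simps)
          qed
          also have "\<dots> \<le> exp (C * \<theta>\<^sup>2) * measure_pmf.expectation (poi \<theta>) \<phi> powr (1 / p)"
          proof (intro mult_left_mono powr_mono2)
            have *: "f n powr p = \<phi> n" for n using b p by (simp add: f_def powr_powr)
            have "exp (- \<theta>) * (f 0 powr p + \<theta> * f 1 powr p)
               = measure_pmf.expectation (poi \<theta>) (\<lambda>n. \<phi> 0 * indicator {0} n + \<phi> 1 * indicator {1} n)"
              unfolding * using P0(1,3)[OF t(1)] ind by (simp add: algebra_simps)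
            \<comment> \<open>Counts of 2 and more are dropped on this side, by nonnegativity of
              \<phi>.\<close>
            also have "\<dots> \<le> measure_pmf.expectation (poi \<theta>) \<phi>"
            proof (rule integral_mono)
              show "integrable (measure_pmf (poi \<theta>)) \<phi>" using expectation_pmf_bounded(1)[of \<phi> B] b by auto
              show "integrable (measure_pmf (poi \<theta>)) (\<lambda>n. \<phi> 0 * indicator {0} n + \<phi> 1 * indicator {1} n)"
                using ind by simp
            qed (use b in \<open>auto simp: indicator_def\<close>)
            finally show "exp (- \<theta>) * (f 0 powr p + \<theta> * f 1 powr p) \<le> measure_pmf.expectation (poi \<theta>) \<phi>" .
          qed (use t p in auto)
          finally show ?thesis .
        qed
      qed simp
      finally show "(\<integral>\<^sup>+(x, x'). ennreal (\<phi> x' powr (1 / p) * \<gamma> x powr (1 - 1 / q)) \<partial>poisson_coupling u \<theta>)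
        \<le> ennreal (exp (C * \<theta>\<^sup>2) * measure_pmf.expectation (poi \<theta>) \<phi> powr (1 / p) *
           measure_pmf.expectation (poi \<theta>) \<gamma> powr (1 - 1 / q))" by (auto intro: ennreal_leI)
    qed
  qed
qed

lemma coupling_bound_return:
  "coupling_bound \<alpha> \<beta> 1 (return_pmf (x, x)) (return_pmf x) D"
  by (auto simp: coupling_bound_def nn_integral_return_pmf)

text \<open>The constants of n independent steps of mean c / n multiply to exp (C c^2 / n). The
  left-hand side does not depend on n, so letting n tend to infinity removes the constant.\<close>

lemma coupling_bound_poisson:
  fixes p u :: real
  assumes p: "1 < p" and u: "0 < u" "u \<le> 1" and q: "q = 1 + (p - 1) / u" and c: "0 \<le> c"
  shows "coupling_bound (1 / p) (1 - 1 / q) 1 (poisson_coupling u c) (poi c) {\<phi>. decseq \<phi>}"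
proof -
  obtain C where C: "\<And>\<theta>. 0 \<le> \<theta> \<Longrightarrow> \<theta> \<le> 1 \<Longrightarrow>
    coupling_bound (1 / p) (1 - 1 / q) (exp (C * \<theta>\<^sup>2)) (poisson_coupling u \<theta>) (poi \<theta>) {\<phi>. decseq \<phi>}"
    using coupling_bound_one_step[OF p u q] by metis
  have zero: "poisson_coupling u 0 = return_pmf (0, 0)"
    by (simp add: poisson_coupling_def)
  have iter: "coupling_bound (1 / p) (1 - 1 / q) (exp (C * \<theta>\<^sup>2) ^ n) (poisson_coupling u (real n * \<theta>))
      (poi (real n * \<theta>)) {\<phi>. decseq \<phi>}" if t: "0 \<le> \<theta>" "\<theta> \<le> 1" for \<theta> n
  proof (induction n)
    case 0
    show ?case by (simp add: zero coupling_bound_return)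
  next
    case (Suc n)
    have "coupling_bound (1 / p) (1 - 1 / q) (exp (C * \<theta>\<^sup>2) ^ n * exp (C * \<theta>\<^sup>2))
       (map_pmf (\<lambda>((x, x'), (y, y')). (x + y, x' + y')) (pair_pmf (poisson_coupling u (real n * \<theta>)) (poisson_coupling u \<theta>)))
       (map_pmf (\<lambda>(x, y). x + y) (pair_pmf (poi (real n * \<theta>)) (poi \<theta>))) {\<phi>. decseq \<phi>}"
    proof (rule coupling_bound_combine[OF Suc C[OF t]])
      fix \<phi> :: "nat \<Rightarrow> real" and B
      assume \<phi>: "\<phi> \<in> {\<phi>. decseq \<phi>}" "\<And>z. 0 \<le> \<phi> z" "\<And>z. \<phi> z \<le> B"
      show "(\<lambda>y. \<phi> (x + y)) \<in> {\<phi>. decseq \<phi>}" for x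
        using \<phi>(1) by (auto simp: decseq_def)
      show "(\<lambda>x. measure_pmf.expectation (poi \<theta>) (\<lambda>y. \<phi> (x + y))) \<in> {\<phi>. decseq \<phi>}"
        using \<phi> by (auto simp: decseq_def intro!: integral_mono expectation_pmf_bounded(1))
    qed auto
    then show ?case
      using t u by (simp add: poisson_coupling_add poi_add algebra_simps)
  qed
  show ?thesis
    unfolding coupling_bound_def
  proof (intro ballI allI impI)
    fix \<phi> \<gamma> :: "nat \<Rightarrow> real" and B
    assume A: "\<phi> \<in> {\<phi>. decseq \<phi>}" "\<forall>x. 0 \<le> \<phi> x \<and> \<phi> x \<le> B" "\<forall>x. 0 \<le> \<gamma> x \<and> \<gamma> x \<le> B"
    define R where "R = measure_pmf.expectation (poi c) \<phi> powr (1 / p) * measure_pmf.expectation (poi c) \<gamma> powr (1 - 1 / q)"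
    define S where "S = (\<integral>\<^sup>+(x, x'). ennreal (\<phi> x' powr (1 / p) * \<gamma> x powr (1 - 1 / q)) \<partial>poisson_coupling u c)"
    \<comment> \<open>The threshold secures both \<open>0 < n\<close> and
      \<open>c / n \<le> 1\<close>, the range in which the one-step bound is available.\<close>
    have le: "S \<le> ennreal (exp (C * c\<^sup>2 * inverse (real n)) * R)" if n: "n \<ge> nat \<lceil>c\<rceil> + 1" for n
    proof -
      have "c \<le> real n" "0 < real n" using n by linarith+
      then have th: "0 \<le> c / real n" "c / real n \<le> 1" using c by auto
      have "exp (C * (c / real n)\<^sup>2) ^ n = exp (C * c\<^sup>2 * inverse (real n))"
        using \<open>0 < real n\<close> by (simp add: exp_of_nat_mult[symmetric] power2_eq_square field_simps)
      moreover have "real n * (c / real n) = c" using \<open>0 < real n\<close> by simp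
      ultimately have "coupling_bound (1 / p) (1 - 1 / q) (exp (C * c\<^sup>2 * inverse (real n))) (poisson_coupling u c)
          (poi c) {\<phi>. decseq \<phi>}"
        using iter[OF th, of n] by metis
      then show ?thesis
        unfolding S_def R_def mult.assoc[symmetric] by (rule coupling_boundD[where B=B]) (use A in auto)
    qed
    have "(\<lambda>n. exp (C * c\<^sup>2 * inverse (real n)) * R) \<longlonglongrightarrow> exp (C * c\<^sup>2 * 0) * R"
      by (intro tendsto_intros lim_inverse_n)
    then have "(\<lambda>n. ennreal (exp (C * c\<^sup>2 * inverse (real n)) * R)) \<longlonglongrightarrow> ennreal R"
      by (intro tendsto_ennrealI) simp
    then have "S \<le> ennreal R"
      by (rule LIMSEQ_le_const) (use le in auto)
    then show "(\<integral>\<^sup>+(x, x'). ennreal (\<phi> x' powr (1 / p) * \<gamma> x powr (1 - 1 / q)) \<partial>poisson_coupling u c)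
      \<le> ennreal (1 * measure_pmf.expectation (poi c) \<phi> powr (1 / p) * measure_pmf.expectation (poi c) \<gamma> powr (1 - 1 / q))"
      by (simp add: S_def R_def)
  qed
qed

text \<open>One coordinate is split off at a time: monotonicity in the others survives fixing it,
  and monotonicity in it survives averaging over the others. The class is described by unit steps in
  single coordinates because this is what the Mecke formula delivers for conditional means.\<close>

lemma coupling_bound_Pi_poisson:
  fixes p u :: real and c :: "'i \<Rightarrow> real"
  assumes p: "1 < p" and u: "0 < u" "u \<le> 1" and q: "q = 1 + (p - 1) / u"
    and A: "finite A" and c: "\<And>i. i \<in> A \<Longrightarrow> 0 \<le> c i"
  shows "coupling_bound (1 / p) (1 - 1 / q) 1
    (map_pmf (\<lambda>h. (\<lambda>i. fst (h i), \<lambda>i. snd (h i))) (Pi_pmf A (0, 0) (\<lambda>i. poisson_coupling u (c i))))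
    (Pi_pmf A 0 (\<lambda>i. poi (c i)))
    {\<phi>. \<forall>i\<in>A. 0 < c i \<longrightarrow> (\<forall>n. \<phi> (n(i := Suc (n i))) \<le> \<phi> n)}"
  using A c
proof (induction A)
  case empty
  show ?case by (simp add: coupling_bound_return)
next
  case (insert i A)
  \<comment> \<open>A coordinate of mean 0 is constantly 0, so its own bound is an equality for
    every function, and the class asks for monotonicity only in coordinates of positive
    mean.\<close>
  define D1 :: "(nat \<Rightarrow> real) set" where "D1 = (if 0 < c i then {\<phi>. decseq \<phi>} else UNIV)"
  have one: "coupling_bound (1 / p) (1 - 1 / q) 1 (poisson_coupling u (c i)) (poi (c i)) D1"
  proof (cases "0 < c i")
    case True
    then show ?thesis by (simp add: D1_def coupling_bound_poisson[OF p u q])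
  next
    case False
    then have "c i = 0" using insert.prems[of i] by auto
    then show ?thesis by (simp add: poisson_coupling_def coupling_bound_return)
  qed
  let ?s = "\<lambda>h. (\<lambda>i. fst (h i) :: nat, \<lambda>i. snd (h i) :: nat)"
  let ?comb = "\<lambda>x y. y(i := x)"
  let ?J = "Pi_pmf A (0, 0) (\<lambda>i. poisson_coupling u (c i))"
  have bound: "coupling_bound (1 / p) (1 - 1 / q) (1 * 1)
     (map_pmf (\<lambda>((x, x'), (y, y')). (?comb x y, ?comb x' y')) (pair_pmf (poisson_coupling u (c i)) (map_pmf ?s ?J)))
     (map_pmf (\<lambda>(x, y). ?comb x y) (pair_pmf (poi (c i)) (Pi_pmf A 0 (\<lambda>i. poi (c i)))))
     {\<phi>. \<forall>i\<in>insert i A. 0 < c i \<longrightarrow> (\<forall>n. \<phi> (n(i := Suc (n i))) \<le> \<phi> n)}"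
  proof (rule coupling_bound_combine[OF one insert.IH])
    fix \<phi> :: "('i \<Rightarrow> nat) \<Rightarrow> real" and B
    assume \<phi>: "\<phi> \<in> {\<phi>. \<forall>i\<in>insert i A. 0 < c i \<longrightarrow> (\<forall>n. \<phi> (n(i := Suc (n i))) \<le> \<phi> n)}"
      "\<And>z. 0 \<le> \<phi> z" "\<And>z. \<phi> z \<le> B"
    show "(\<lambda>y. \<phi> (y(i := x))) \<in> {\<phi>. \<forall>i\<in>A. 0 < c i \<longrightarrow> (\<forall>n. \<phi> (n(i := Suc (n i))) \<le> \<phi> n)}" for x
    proof clarify
      fix j n assume j: "j \<in> A" "0 < c j"
      then have "j \<noteq> i" using insert.hyps by auto
      then show "\<phi> ((n(j := Suc (n j)))(i := x)) \<le> \<phi> (n(i := x))"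
        using \<phi>(1) j by (auto simp: fun_upd_twist dest!: bspec[of _ _ j] spec[of _ "n(i := x)"])
    qed
    show "(\<lambda>x. measure_pmf.expectation (Pi_pmf A 0 (\<lambda>i. poi (c i))) (\<lambda>y. \<phi> (y(i := x)))) \<in> D1"
    proof (cases "0 < c i")
      case True
      have "\<phi> (y(i := Suc x)) \<le> \<phi> (y(i := x))" for x y
        using \<phi>(1) True by (auto dest: spec[of _ "y(i := x)"])
      then show ?thesis
        using \<phi> True by (auto simp: D1_def decseq_Suc_iff intro!: integral_mono expectation_pmf_bounded(1))
    qed (simp add: D1_def)
  qed (use insert.prems in auto)
  have eq: "map_pmf (\<lambda>((x, x'), (y, y')). (?comb x y, ?comb x' y')) (pair_pmf (poisson_coupling u (c i)) (map_pmf ?s ?J))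
      = map_pmf ?s (Pi_pmf (insert i A) (0, 0) (\<lambda>i. poisson_coupling u (c i)))"
    unfolding Pi_pmf_insert[OF insert.hyps] pair_map_pmf2 pmf.map_comp
    by (intro map_pmf_cong refl) (auto simp: fun_eq_iff)
  show ?case
    using bound unfolding eq Pi_pmf_insert[OF insert.hyps] mult_1_left .
qed

section \<open>Point measures and cells\<close>

text \<open>Partial sums of the masses are natural numbers, and the extended naturals are closed
  under suprema; computing in \<open>enat\<close> excludes every other value.\<close>

lemma emeasure_point_measure_cases:
  assumes "\<mu> \<in> point_measures M" "B \<in> sets M"
  shows "emeasure \<mu> B = \<infinity> \<or> (\<exists>k::nat. emeasure \<mu> B = of_nat k)"
proof -
  obtain \<nu> where \<mu>: "\<mu> = measure_sum M \<nu>" and \<nu>: "\<And>n. sets (\<nu> n) = sets M"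
    "\<And>n. \<exists>k::nat. emeasure (\<nu> n) B = of_nat k"
    using assms unfolding point_measures_def by blast
  obtain k where k: "\<And>n. emeasure (\<nu> n) B = of_nat (k n :: nat)"
    using \<nu>(2) by metis
  have "emeasure \<mu> B = (SUP n. \<Sum>i<n. ennreal_of_enat (enat (k i)))"
    using assms(2) \<nu>(1) by (simp add: \<mu> emeasure_measure_sum k suminf_eq_SUP)
  also have "\<dots> = ennreal_of_enat (SUP n. \<Sum>i<n. enat (k i))"
    by (simp add: ennreal_of_enat_Sup image_comp o_def del: ennreal_of_enat_enat)
  finally show ?thesis
    by (cases "SUP n. \<Sum>i<n. enat (k i)") auto
qed

lemma sets_point_measure: "\<mu> \<in> point_measures M \<Longrightarrow> sets \<mu> = sets M"
  unfolding point_measures_def by auto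

lemma space_point_measure_algebra [simp]: "space (point_measure_algebra M) = point_measures M"
  unfolding point_measure_algebra_def by (auto intro!: space_measure_of)

lemma sets_point_measure_algebra:
  "sets (point_measure_algebra M) = sigma_sets (point_measures M)
     {{\<mu> \<in> point_measures M. emeasure \<mu> B = of_nat k} | B (k::nat). B \<in> sets M}"
  unfolding point_measure_algebra_def by (auto intro!: sets_measure_of)

text \<open>Made for masses of point measures, whose \<sigma>-algebra is generated by events of
  finite mass: the event of infinite mass is the complement of their countable union.\<close>

lemma borel_measurable_ennreal_natI:
  fixes f :: "'a \<Rightarrow> ennreal"
  assumes "\<And>x. x \<in> space N \<Longrightarrow> f x = \<infinity> \<or> (\<exists>k::nat. f x = of_nat k)"
    and "\<And>k::nat. {x \<in> space N. f x = of_nat k} \<in> sets N"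
  shows "f \<in> borel_measurable N"
proof (rule measurableI)
  fix S :: "ennreal set"
  assume "S \<in> sets borel"
  let ?U = "\<Union>k. {x \<in> space N. f x = of_nat (k::nat)}"
  have "f -` S \<inter> space N = (\<Union>k\<in>{k::nat. of_nat k \<in> S}. {x \<in> space N. f x = of_nat k})
      \<union> (if \<infinity> \<in> S then space N - ?U else {})"
  proof (intro set_eqI)
    fix x
    show "x \<in> f -` S \<inter> space N \<longleftrightarrow> x \<in> (\<Union>k\<in>{k::nat. of_nat k \<in> S}. {x \<in> space N. f x = of_nat k})
        \<union> (if \<infinity> \<in> S then space N - ?U else {})"
      using assms(1)[of x] by (cases "x \<in> space N") auto
  qed
  also have "\<dots> \<in> sets N"
    using assms(2) by (intro sets.Un sets.countable_UN' sets.Diff) auto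
  finally show "f -` S \<inter> space N \<in> sets N" .
qed auto

lemma measurable_emeasure_point_measure [measurable (raw)]:
  assumes "f \<in> N \<rightarrow>\<^sub>M point_measure_algebra M" "B \<in> sets M"
  shows "(\<lambda>x. emeasure (f x) B) \<in> borel_measurable N"
proof -
  have "(\<lambda>\<mu>. emeasure \<mu> B) \<in> borel_measurable (point_measure_algebra M)"
  proof (rule borel_measurable_ennreal_natI)
    show "{\<mu> \<in> space (point_measure_algebra M). emeasure \<mu> B = of_nat k} \<in> sets (point_measure_algebra M)" for k
      using assms(2) by (auto simp: sets_point_measure_algebra)
  qed (use assms(2) emeasure_point_measure_cases in auto)
  from measurable_compose[OF assms(1) this] show ?thesis .
qed

lemma measurable_point_measure_algebraI:
  assumes "\<And>x. x \<in> space N \<Longrightarrow> f x \<in> point_measures M"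
    and "\<And>B. B \<in> sets M \<Longrightarrow> (\<lambda>x. emeasure (f x) B) \<in> borel_measurable N"
  shows "f \<in> N \<rightarrow>\<^sub>M point_measure_algebra M"
  unfolding point_measure_algebra_def
proof (rule measurable_sigma_sets[OF sets_measure_of])
  fix A assume "A \<in> {{\<mu> \<in> point_measures M. emeasure \<mu> B = of_nat k} |B (k::nat). B \<in> sets M}"
  then obtain B k where A: "A = {\<mu> \<in> point_measures M. emeasure \<mu> B = of_nat (k::nat)}" and [simp]: "B \<in> sets M"
    by blast
  have [measurable]: "(\<lambda>x. emeasure (f x) B) \<in> borel_measurable N" by (rule assms) simp
  have "f -` A \<inter> space N = {x \<in> space N. emeasure (f x) B = of_nat k}"
    using assms(1) by (auto simp: A)
  then show "f -` A \<inter> space N \<in> sets N" by simp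
qed (use assms(1) in auto)

lemma measure_add_point_measures:
  assumes "\<mu> \<in> point_measures M" "\<nu> \<in> point_measures M"
  shows "measure_add M \<mu> \<nu> \<in> point_measures M"
proof -
  obtain \<mu>' where \<mu>: "\<mu> = measure_sum M \<mu>'" and \<mu>': "\<And>n. sets (\<mu>' n) = sets M" "\<And>n. finite_measure (\<mu>' n)"
    "\<And>n B. B \<in> sets M \<Longrightarrow> \<exists>k::nat. emeasure (\<mu>' n) B = of_nat k"
    using assms(1) unfolding point_measures_def by blast
  obtain \<nu>' where \<nu>: "\<nu> = measure_sum M \<nu>'" and \<nu>': "\<And>n. sets (\<nu>' n) = sets M" "\<And>n. finite_measure (\<nu>' n)"
    "\<And>n B. B \<in> sets M \<Longrightarrow> \<exists>k::nat. emeasure (\<nu>' n) B = of_nat k"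
    using assms(2) unfolding point_measures_def by blast
  let ?\<rho> = "\<lambda>n. measure_add M (\<mu>' n) (\<nu>' n)"
  have "measure_add M \<mu> \<nu> = measure_sum M ?\<rho>"
    by (rule measure_eqI)
      (simp_all add: \<mu> \<nu> emeasure_measure_add emeasure_measure_sum \<mu>'(1) \<nu>'(1) suminf_add)
  moreover have "finite_measure (?\<rho> n)" for n
    using \<mu>'(1,2)[of n] \<nu>'(1,2)[of n] sets_eq_imp_space_eq[OF \<mu>'(1)] sets_eq_imp_space_eq[OF \<nu>'(1)]
    by (intro finite_measureI) (auto simp: emeasure_measure_add dest: finite_measure.emeasure_finite)
  moreover have "\<exists>k::nat. emeasure (?\<rho> n) B = of_nat k" if B: "B \<in> sets M" for n B
  proof -
    obtain k l :: nat where "emeasure (\<mu>' n) B = of_nat k" "emeasure (\<nu>' n) B = of_nat l"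
      using \<mu>'(3)[OF B] \<nu>'(3)[OF B] by metis
    then have "emeasure (?\<rho> n) B = of_nat (k + l)"
      using B \<mu>' \<nu>' by (simp add: emeasure_measure_add)
    then show ?thesis by blast
  qed
  ultimately show ?thesis
    unfolding point_measures_def by (intro CollectI exI[of _ ?\<rho>]) auto
qed

lemma return_point_measures:
  assumes x: "x \<in> space M"
  shows "return M x \<in> point_measures M"
proof -
  let ?\<rho> = "\<lambda>n. if n = (0::nat) then return M x else null_measure M"
  have "return M x = measure_sum M ?\<rho>"
  proof (rule measure_eqI)
    fix B assume "B \<in> sets (return M x)"
    then have "emeasure (measure_sum M ?\<rho>) B = (\<Sum>n. emeasure (?\<rho> n) B)"
      by (intro emeasure_measure_sum) auto
    also have "\<dots> = (\<Sum>n\<in>{0}. emeasure (?\<rho> n) B)" by (rule suminf_finite) auto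
    finally show "emeasure (return M x) B = emeasure (measure_sum M ?\<rho>) B" by simp
  qed simp
  moreover have "\<exists>k::nat. emeasure (?\<rho> n) B = of_nat k" if "B \<in> sets M" for n B
    using that by (auto simp: indicator_def intro: exI[of _ 0] exI[of _ 1])
  moreover have "finite_measure (?\<rho> n)" for n
    using x by (auto intro!: finite_measureI)
  ultimately show ?thesis
    unfolding point_measures_def by (intro CollectI exI[of _ ?\<rho>]) auto
qed

lemma emeasure_measure_add_point_measures:
  "\<mu> \<in> point_measures M \<Longrightarrow> \<nu> \<in> point_measures M \<Longrightarrow> B \<in> sets M \<Longrightarrow>
     emeasure (measure_add M \<mu> \<nu>) B = emeasure \<mu> B + emeasure \<nu> B"
  by (rule emeasure_measure_add) (simp_all add: sets_point_measure)

lemma measurable_measure_add [measurable (raw)]: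
  assumes f[measurable]: "f \<in> N \<rightarrow>\<^sub>M point_measure_algebra M" and g[measurable]: "g \<in> N \<rightarrow>\<^sub>M point_measure_algebra M"
  shows "(\<lambda>x. measure_add M (f x) (g x)) \<in> N \<rightarrow>\<^sub>M point_measure_algebra M"
proof (rule measurable_point_measure_algebraI)
  show "measure_add M (f x) (g x) \<in> point_measures M" if "x \<in> space N" for x
    using measurable_space[OF f that] measurable_space[OF g that] by (simp add: measure_add_point_measures)
  fix B assume [measurable]: "B \<in> sets M"
  have "(\<lambda>x. emeasure (f x) B + emeasure (g x) B) \<in> borel_measurable N" by measurable
  then show "(\<lambda>x. emeasure (measure_add M (f x) (g x)) B) \<in> borel_measurable N"
    using measurable_space[OF f] measurable_space[OF g]
    by (subst measurable_cong[where g="\<lambda>x. emeasure (f x) B + emeasure (g x) B"])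
      (auto simp: emeasure_measure_add_point_measures)
qed

lemma measurable_return_point_measure [measurable (raw)]:
  assumes f[measurable]: "f \<in> N \<rightarrow>\<^sub>M M"
  shows "(\<lambda>x. return M (f x)) \<in> N \<rightarrow>\<^sub>M point_measure_algebra M"
proof (rule measurable_point_measure_algebraI)
  show "return M (f x) \<in> point_measures M" if "x \<in> space N" for x
    using measurable_space[OF f that] by (rule return_point_measures)
  fix B assume [measurable]: "B \<in> sets M"
  show "(\<lambda>x. emeasure (return M (f x)) B) \<in> borel_measurable N"
    by simp
qed

section \<open>Finite families of sets and what their masses determine\<close>

definition finite_sets :: "'a measure \<Rightarrow> 'a set set" where
  "finite_sets L = {C \<in> sets L. emeasure L C \<noteq> \<infinity>}"

text \<open>Disjointness makes the counts in the cells independent, and finite measure makes them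
  almost surely finite. Cells need not cover the space.\<close>

definition cells :: "'a measure \<Rightarrow> 'a set set \<Rightarrow> bool" where
  "cells L \<B> \<longleftrightarrow> finite \<B> \<and> disjoint \<B> \<and> \<B> \<subseteq> finite_sets L"

text \<open>By additivity the masses of the members of \<open>\<C>\<close> are then finite sums of
  masses of members of \<open>\<B>\<close>. Further members of \<open>\<B>\<close>, outside every
  set in \<open>\<C>\<close>, are allowed.\<close>

definition refines :: "'a set set \<Rightarrow> 'a set set \<Rightarrow> bool" where
  "refines \<B> \<C> \<longleftrightarrow> (\<forall>C\<in>\<C>. \<exists>\<D>\<subseteq>\<B>. C = \<Union>\<D>)"

lemma refinesD:
  assumes "refines \<B> \<C>" "C \<in> \<C>"
  obtains \<D> where "\<D> \<subseteq> \<B>" "C = \<Union>\<D>"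
proof -
  have "\<exists>\<D>\<subseteq>\<B>. C = \<Union>\<D>" using assms unfolding refines_def by (rule bspec)
  then show thesis by (elim exE conjE) (rule that)
qed

definition determined_by :: "'a measure \<Rightarrow> 'a set set \<Rightarrow> ('a measure \<Rightarrow> 'b) \<Rightarrow> bool" where
  "determined_by M \<C> h \<longleftrightarrow>
     (\<forall>\<mu>\<in>point_measures M. \<forall>\<nu>\<in>point_measures M. (\<forall>C\<in>\<C>. emeasure \<mu> C = emeasure \<nu> C) \<longrightarrow> h \<mu> = h \<nu>)"

lemma finite_sets_subset:
  assumes C: "C \<in> finite_sets L" and B: "B \<in> sets L" "B \<subseteq> C"
  shows "B \<in> finite_sets L"
proof -
  have "emeasure L B \<le> emeasure L C" using assms by (intro emeasure_mono) (auto simp: finite_sets_def)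
  also have "\<dots> < \<infinity>" using C by (auto simp: finite_sets_def less_top)
  finally show ?thesis using B by (simp add: finite_sets_def)
qed

lemma finite_sets_Int: "C \<in> finite_sets L \<Longrightarrow> B \<in> sets L \<Longrightarrow> C \<inter> B \<in> finite_sets L"
  and finite_sets_Diff: "C \<in> finite_sets L \<Longrightarrow> B \<in> sets L \<Longrightarrow> C - B \<in> finite_sets L"
  using finite_sets_subset[of C L "C \<inter> B"] finite_sets_subset[of C L "C - B"]
  by (auto simp: finite_sets_def)

lemma disjoint_split_cells:
  assumes \<B>: "disjoint \<B>"
  shows "disjoint (insert (C - \<Union>\<B>) ((\<lambda>B. B \<inter> C) ` \<B> \<union> (\<lambda>B. B - C) ` \<B>))"
proof -
  have "disjoint ((\<lambda>B. B \<inter> C) ` \<B> \<union> (\<lambda>B. B - C) ` \<B>)"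
  proof (rule disjoint_union)
    show "disjoint ((\<lambda>B. B \<inter> C) ` \<B>)" "disjoint ((\<lambda>B. B - C) ` \<B>)"
      using \<B> by (rule disjoint_image_subset, blast)+
  qed auto
  then show ?thesis
    by (auto simp: pairwise_insert disjnt_def)
qed

lemma cells_subset: "cells L \<B> \<Longrightarrow> \<D> \<subseteq> \<B> \<Longrightarrow> cells L \<D>"
  unfolding cells_def by (meson finite_subset pairwise_subset subset_trans)

text \<open>A new set cuts every cell into a part inside and a part outside, and whatever the old
  cells miss of it becomes one more cell. A set that was a union of old cells is the union of the
  corresponding pieces.\<close>

lemma cells_refinement:
  assumes "finite \<C>" "\<C> \<subseteq> finite_sets L"
  shows "\<exists>\<B>. cells L \<B> \<and> refines \<B> \<C>"
  using assms
proof (induction \<C>)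
  case empty
  show ?case by (rule exI[of _ "{}"]) (simp add: cells_def refines_def)
next
  case (insert C \<C>)
  then obtain \<B> where \<B>: "cells L \<B>" "refines \<B> \<C>" by auto
  have C: "C \<in> finite_sets L" using insert.prems by auto
  define \<B>' where "\<B>' = insert (C - \<Union>\<B>) ((\<lambda>B. B \<inter> C) ` \<B> \<union> (\<lambda>B. B - C) ` \<B>)"
  have B: "finite \<B>" "disjoint \<B>" "\<B> \<subseteq> finite_sets L" using \<B>(1) by (auto simp: cells_def)
  then have s: "C \<in> sets L" "\<B> \<subseteq> sets L" using C by (auto simp: finite_sets_def)
  then have U: "\<Union>\<B> \<in> sets L" using B(1) by (intro sets.finite_Union)
  have "(\<lambda>B. B \<inter> C) ` \<B> \<subseteq> finite_sets L" "(\<lambda>B. B - C) ` \<B> \<subseteq> finite_sets L"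
    by (rule image_subsetI, rule finite_sets_Int finite_sets_Diff, use s B in blast, use s B in blast)+
  then have "cells L \<B>'"
    unfolding cells_def \<B>'_def using B disjoint_split_cells[OF B(2)] finite_sets_Diff[OF C U] by simp
  moreover have "\<exists>\<D>\<subseteq>\<B>'. C = \<Union>\<D>"
  proof (intro exI conjI)
    show "insert (C - \<Union>\<B>) ((\<lambda>B. B \<inter> C) ` \<B>) \<subseteq> \<B>'" unfolding \<B>'_def by blast
    show "C = \<Union>(insert (C - \<Union>\<B>) ((\<lambda>B. B \<inter> C) ` \<B>))"
    proof (rule set_eqI)
      fix x
      show "x \<in> C \<longleftrightarrow> x \<in> \<Union>(insert (C - \<Union>\<B>) ((\<lambda>B. B \<inter> C) ` \<B>))"
        by (cases "x \<in> \<Union>\<B>") (auto simp del: UN_simps)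
    qed
  qed
  moreover have "\<exists>\<D>\<subseteq>\<B>'. E = \<Union>\<D>" if E: "E \<in> \<C>" for E
  proof -
    obtain \<D> where D: "\<D> \<subseteq> \<B>" "E = \<Union>\<D>" by (rule refinesD[OF \<B>(2) E])
    show ?thesis
    proof (intro exI conjI)
      show "(\<lambda>B. B \<inter> C) ` \<D> \<union> (\<lambda>B. B - C) ` \<D> \<subseteq> \<B>'" using D(1) by (auto simp: \<B>'_def)
      show "E = \<Union>((\<lambda>B. B \<inter> C) ` \<D> \<union> (\<lambda>B. B - C) ` \<D>)" using D(2) by auto
    qed
  qed
  ultimately have "refines \<B>' (insert C \<C>)" unfolding refines_def by simp
  with \<open>cells L \<B>'\<close> show ?case by (intro exI conjI)
qed

lemma emeasure_Union_cells:
  assumes "finite \<D>" "disjoint \<D>" "\<D> \<subseteq> sets \<mu>"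
  shows "emeasure \<mu> (\<Union>\<D>) = (\<Sum>D\<in>\<D>. emeasure \<mu> D)"
  using sum_emeasure[of "\<lambda>D. D" \<D> \<mu>] assms by (auto simp: disjoint_family_on_def disjoint_def)

lemma determined_by_refines:
  assumes h: "determined_by M \<C> h" and r: "refines \<B> \<C>" and c: "cells L \<B>" and L: "sets L = sets M"
  shows "determined_by M \<B> h"
  unfolding determined_by_def
proof (intro ballI impI)
  fix \<mu> \<nu> assume m: "\<mu> \<in> point_measures M" "\<nu> \<in> point_measures M" and eq: "\<forall>C\<in>\<B>. emeasure \<mu> C = emeasure \<nu> C"
  have "emeasure \<mu> C = emeasure \<nu> C" if "C \<in> \<C>" for C
  proof -
    obtain \<D> where D: "\<D> \<subseteq> \<B>" "C = \<Union>\<D>" by (rule refinesD[OF r \<open>C \<in> \<C>\<close>])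
    have "finite \<D>" "disjoint \<D>" "\<D> \<subseteq> sets M"
      using cells_subset[OF c D(1)] L by (auto simp: cells_def finite_sets_def)
    then show ?thesis
      using D eq m by (simp add: emeasure_Union_cells sets_point_measure subset_iff)
  qed
  then show "h \<mu> = h \<nu>" using h m unfolding determined_by_def by blast
qed

definition cylinder_sets :: "'a measure \<Rightarrow> 'a measure \<Rightarrow> 'a measure set set" where
  "cylinder_sets M L = {A \<in> sets (point_measure_algebra M).
     \<exists>\<C>. finite \<C> \<and> \<C> \<subseteq> finite_sets L \<and> determined_by M \<C> (\<lambda>\<mu>. \<mu> \<in> A)}"

lemma Int_stable_cylinder_sets: "Int_stable (cylinder_sets M L)"
proof (rule Int_stableI)
  fix A B assume "A \<in> cylinder_sets M L" "B \<in> cylinder_sets M L"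
  then obtain \<C> \<D> where *: "A \<in> sets (point_measure_algebra M)" "finite \<C>" "\<C> \<subseteq> finite_sets L" "determined_by M \<C> (\<lambda>\<mu>. \<mu> \<in> A)"
    "B \<in> sets (point_measure_algebra M)" "finite \<D>" "\<D> \<subseteq> finite_sets L" "determined_by M \<D> (\<lambda>\<mu>. \<mu> \<in> B)"
    unfolding cylinder_sets_def by blast
  have "determined_by M (\<C> \<union> \<D>) (\<lambda>\<mu>. \<mu> \<in> A \<inter> B)"
    using *(4,8) unfolding determined_by_def by blast
  then show "A \<inter> B \<in> cylinder_sets M L"
    using * unfolding cylinder_sets_def by (intro CollectI conjI exI[of _ "\<C> \<union> \<D>"]) auto
qed

lemma cylinder_sets_Pow: "cylinder_sets M L \<subseteq> Pow (point_measures M)"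
  unfolding cylinder_sets_def using sets.sets_into_space[of _ "point_measure_algebra M"] by auto

lemma point_measures_in_cylinder_sets: "point_measures M \<in> cylinder_sets M L"
  unfolding cylinder_sets_def using sets.top[of "point_measure_algebra M"]
  by (auto simp: determined_by_def intro: exI[of _ "{}"])

text \<open>By \<sigma>-finiteness the mass of an arbitrary set is the series of its masses on the
  pieces of a countable partition into sets of finite measure, and each term is measurable for the
  cylinder sets.\<close>

lemma sigma_cylinder_sets:
  assumes "sigma_finite_measure L" and L: "sets L = sets M"
  shows "sets (point_measure_algebra M) = sigma_sets (point_measures M) (cylinder_sets M L)"
proof
  interpret L: sigma_finite_measure L by fact
  let ?N = "sigma (point_measures M) (cylinder_sets M L)"
  have sN: "sets ?N = sigma_sets (point_measures M) (cylinder_sets M L)" "space ?N = point_measures M"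
    by (simp_all add: sets_measure_of space_measure_of cylinder_sets_Pow)
  show "sigma_sets (point_measures M) (cylinder_sets M L) \<subseteq> sets (point_measure_algebra M)"
    using sets.sigma_sets_subset[of "cylinder_sets M L" "point_measure_algebra M"]
    by (auto simp: cylinder_sets_def)
  have fin: "(\<lambda>\<mu>. emeasure \<mu> C) \<in> borel_measurable ?N" if C: "C \<in> finite_sets L" for C
  proof (rule measurableI)
    fix S :: "ennreal set" assume [measurable]: "S \<in> sets borel"
    have [measurable]: "C \<in> sets M" using C L by (auto simp: finite_sets_def)
    have "(\<lambda>\<mu>. emeasure \<mu> C) -` S \<inter> point_measures M \<in> sets (point_measure_algebra M)"
      using measurable_sets[of "\<lambda>\<mu>. emeasure \<mu> C" "point_measure_algebra M" borel S] by simp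
    then have "(\<lambda>\<mu>. emeasure \<mu> C) -` S \<inter> point_measures M \<in> cylinder_sets M L"
      unfolding cylinder_sets_def using C
      by (auto intro!: exI[of _ "{C}"] simp: determined_by_def)
    then show "(\<lambda>\<mu>. emeasure \<mu> C) -` S \<inter> space ?N \<in> sets ?N"
      unfolding sN by auto
  qed auto
  obtain A :: "nat \<Rightarrow> 'a set" where A: "range A \<subseteq> sets L" "(\<Union>i. A i) = space L" "\<And>i. emeasure L (A i) \<noteq> \<infinity>" "disjoint_family A"
    by (rule L.sigma_finite_disjoint) (rule that; assumption)
  show "sets (point_measure_algebra M) \<subseteq> sigma_sets (point_measures M) (cylinder_sets M L)"
    unfolding sets_point_measure_algebra
  proof (rule sigma_sets_mono, rule subsetI)
    fix E assume "E \<in> {{\<mu> \<in> point_measures M. emeasure \<mu> B = of_nat k} | B (k::nat). B \<in> sets M}"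
    then obtain B and k :: nat where E: "E = {\<mu> \<in> point_measures M. emeasure \<mu> B = of_nat k}" and B: "B \<in> sets M"
      by blast
    have *: "emeasure \<mu> B = (\<Sum>i. emeasure \<mu> (A i \<inter> B))" if "\<mu> \<in> point_measures M" for \<mu>
    proof -
      have "B = (\<Union>i. A i \<inter> B)" using A(2) sets.sets_into_space[OF B] sets_eq_imp_space_eq[OF L] by auto
      moreover have "(\<Sum>i. emeasure \<mu> (A i \<inter> B)) = emeasure \<mu> (\<Union>i. A i \<inter> B)"
        using A B L that by (intro suminf_emeasure) (auto simp: sets_point_measure disjoint_family_on_def disjoint_iff)
      ultimately show ?thesis by simp
    qed
    have "(\<lambda>\<mu>. \<Sum>i. emeasure \<mu> (A i \<inter> B)) \<in> borel_measurable ?N"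
      using A B L by (intro borel_measurable_suminf_order fin finite_sets_Int) (auto simp: finite_sets_def)
    then have "{\<mu> \<in> space ?N. (\<Sum>i. emeasure \<mu> (A i \<inter> B)) = of_nat k} \<in> sets ?N" by simp
    moreover have "{\<mu> \<in> space ?N. (\<Sum>i. emeasure \<mu> (A i \<inter> B)) = of_nat k} = {\<mu> \<in> point_measures M. emeasure \<mu> B = of_nat k}"
      unfolding sN using * by auto
    ultimately show "E \<in> sigma_sets (point_measures M) (cylinder_sets M L)"
      unfolding sN E by simp
  qed
qed

section \<open>Laws of Poisson processes and the Mecke formula\<close>

text \<open>Defined on all sets with default 0 off the cells, the shape of an outcome of
  \<open>Pi_pmf\<close>. An infinite mass becomes 0 through \<open>enn2real\<close>, so the counts
  are faithful only where the masses are finite; this is why almost sure finiteness accompanies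
  every use.\<close>

definition cell_counts :: "'a set set \<Rightarrow> 'a measure \<Rightarrow> 'a set \<Rightarrow> nat" where
  "cell_counts \<B> \<mu> = (\<lambda>B. if B \<in> \<B> then nat \<lfloor>enn2real (emeasure \<mu> B)\<rfloor> else 0)"

text \<open>The set is the support of a product law with finitely many non-degenerate factors, and
  supports of discrete laws are countable. Pushing a Poisson law through \<open>from_nat\<close>
  gives a factor of full support on any countable type.\<close>

lemma countable_finite_support:
  assumes "finite A"
  shows "countable {f :: 'i \<Rightarrow> 'b::countable. \<forall>x. x \<notin> A \<longrightarrow> f x = d}"
proof -
  have "set_pmf (Pi_pmf A d (\<lambda>_. map_pmf from_nat (poisson_pmf 1))) = {f. \<forall>x. x \<notin> A \<longrightarrow> f x = d}"
    using assms by (subst set_Pi_pmf) (auto simp: PiE_dflt_def surj_from_nat)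
  then show ?thesis using countable_set_pmf by metis
qed

text \<open>The type of count vectors may be uncountable; preimages of singletons decide
  measurability once the range is confined to a countable set.\<close>

lemma measurable_count_space_UNIV_countable:
  assumes "countable C" "\<And>x. x \<in> space N \<Longrightarrow> f x \<in> C" "\<And>c. c \<in> C \<Longrightarrow> f -` {c} \<inter> space N \<in> sets N"
  shows "f \<in> N \<rightarrow>\<^sub>M count_space UNIV"
proof -
  have "f \<in> N \<rightarrow>\<^sub>M count_space C"
    using assms by (subst measurable_count_space_eq_countable) auto
  then show ?thesis
    by (rule measurable_compose[of f N "count_space C" "\<lambda>x. x"]) simp
qed

lemma measurable_cell_counts [measurable (raw)]:
  assumes f: "f \<in> N \<rightarrow>\<^sub>M point_measure_algebra M" and "finite \<B>" "\<B> \<subseteq> sets M"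
  shows "(\<lambda>x. cell_counts \<B> (f x)) \<in> N \<rightarrow>\<^sub>M count_space UNIV"
proof (rule measurable_count_space_UNIV_countable[OF countable_finite_support[OF assms(2)]])
  fix n :: "'b set \<Rightarrow> nat" assume n: "n \<in> {f. \<forall>x. x \<notin> \<B> \<longrightarrow> f x = 0}"
  have "(\<lambda>x. nat \<lfloor>enn2real (emeasure (f x) B)\<rfloor>) \<in> N \<rightarrow>\<^sub>M count_space UNIV" if "B \<in> \<B>" for B
  proof -
    have [measurable]: "(\<lambda>x. emeasure (f x) B) \<in> borel_measurable N"
      using f that assms(3) by (intro measurable_emeasure_point_measure) auto
    show ?thesis by measurable
  qed
  then have "{x \<in> space N. \<forall>B\<in>\<B>. nat \<lfloor>enn2real (emeasure (f x) B)\<rfloor> = n B} \<in> sets N"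
    using assms(2) by (intro sets.sets_Collect_finite_All) auto
  also have "{x \<in> space N. \<forall>B\<in>\<B>. nat \<lfloor>enn2real (emeasure (f x) B)\<rfloor> = n B}
      = (\<lambda>x. cell_counts \<B> (f x)) -` {n} \<inter> space N"
    using n by (auto simp: cell_counts_def fun_eq_iff)
  finally show "(\<lambda>x. cell_counts \<B> (f x)) -` {n} \<inter> space N \<in> sets N" .
qed (auto simp: cell_counts_def)

lemma cell_counts_eq_iff:
  assumes "\<mu> \<in> point_measures M" "\<B> \<subseteq> sets M" "\<And>B. B \<in> \<B> \<Longrightarrow> emeasure \<mu> B \<noteq> \<infinity>" "\<And>B. B \<notin> \<B> \<Longrightarrow> n B = 0"
  shows "cell_counts \<B> \<mu> = n \<longleftrightarrow> (\<forall>B\<in>\<B>. emeasure \<mu> B = of_nat (n B))"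
proof -
  have "emeasure \<mu> B = of_nat (nat \<lfloor>enn2real (emeasure \<mu> B)\<rfloor>)" if "B \<in> \<B>" for B
  proof -
    obtain k :: nat where "emeasure \<mu> B = of_nat k"
      using emeasure_point_measure_cases[OF assms(1), of B] assms(2,3) \<open>B \<in> \<B>\<close> by auto
    then show ?thesis by simp
  qed
  note * = this
  show ?thesis
  proof
    assume n: "cell_counts \<B> \<mu> = n"
    have "nat \<lfloor>enn2real (emeasure \<mu> B)\<rfloor> = n B" if "B \<in> \<B>" for B
      using that by (simp add: n[symmetric] cell_counts_def)
    then show "\<forall>B\<in>\<B>. emeasure \<mu> B = of_nat (n B)"
      using * by metis
  next
    assume "\<forall>B\<in>\<B>. emeasure \<mu> B = of_nat (n B)"
    then show "cell_counts \<B> \<mu> = n"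
      using assms(4) by (auto simp: cell_counts_def fun_eq_iff)
  qed
qed

lemma determined_byD:
  assumes "determined_by M \<C> h" "\<mu> \<in> point_measures M" "\<nu> \<in> point_measures M"
    "\<forall>C\<in>\<C>. emeasure \<mu> C = emeasure \<nu> C"
  shows "h \<mu> = h \<nu>"
  using assms unfolding determined_by_def by blast

lemma determined_byI:
  assumes "\<And>\<mu> \<nu>. \<mu> \<in> point_measures M \<Longrightarrow> \<nu> \<in> point_measures M \<Longrightarrow> (\<And>C. C \<in> \<C> \<Longrightarrow> emeasure \<mu> C = emeasure \<nu> C) \<Longrightarrow> h \<mu> = h \<nu>"
  shows "determined_by M \<C> h"
  using assms unfolding determined_by_def by blast

lemma determined_by_compose2:
  assumes g: "determined_by M \<C> g" and h: "determined_by M \<D> h"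
  shows "determined_by M (\<C> \<union> \<D>) (\<lambda>\<mu>. f (g \<mu>) (h \<mu>))"
proof (rule determined_byI)
  fix \<mu> \<nu> assume m: "\<mu> \<in> point_measures M" "\<nu> \<in> point_measures M"
    and eq: "\<And>C. C \<in> \<C> \<union> \<D> \<Longrightarrow> emeasure \<mu> C = emeasure \<nu> C"
  have "g \<mu> = g \<nu>" by (rule determined_byD[OF g m]) (use eq in simp)
  moreover have "h \<mu> = h \<nu>" by (rule determined_byD[OF h m]) (use eq in simp)
  ultimately show "f (g \<mu>) (h \<mu>) = f (g \<nu>) (h \<nu>)" by simp
qed

lemma determined_by_cell_counts:
  assumes "determined_by M \<B> h" "\<mu> \<in> point_measures M" "\<nu> \<in> point_measures M" "\<B> \<subseteq> sets M"
    and "\<And>B. B \<in> \<B> \<Longrightarrow> emeasure \<mu> B \<noteq> \<infinity>" "\<And>B. B \<in> \<B> \<Longrightarrow> emeasure \<nu> B \<noteq> \<infinity>"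
    and "cell_counts \<B> \<mu> = cell_counts \<B> \<nu>"
  shows "h \<mu> = h \<nu>"
proof -
  have z: "B \<notin> \<B> \<Longrightarrow> cell_counts \<B> \<nu> B = 0" for B by (simp add: cell_counts_def)
  have "\<forall>B\<in>\<B>. emeasure \<mu> B = of_nat (cell_counts \<B> \<nu> B)"
    using cell_counts_eq_iff[OF assms(2,4,5), of "cell_counts \<B> \<nu>"] assms(7) z by blast
  moreover have "\<forall>B\<in>\<B>. emeasure \<nu> B = of_nat (cell_counts \<B> \<nu> B)"
    using cell_counts_eq_iff[OF assms(3,4,6), of "cell_counts \<B> \<nu>"] z by blast
  ultimately have "\<forall>B\<in>\<B>. emeasure \<mu> B = emeasure \<nu> B" by metis
  then show ?thesis
    by (rule determined_byD[OF assms(1-3)])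
qed

text \<open>The factor evaluates \<open>h\<close> at an arbitrarily chosen point measure with the
  prescribed finite counts; the choice is immaterial because such measures agree on all
  cells.\<close>

lemma determined_by_factor:
  assumes "determined_by M \<B> h" "\<B> \<subseteq> sets M"
  shows "\<exists>h'. \<forall>\<mu>\<in>point_measures M. (\<forall>B\<in>\<B>. emeasure \<mu> B \<noteq> \<infinity>) \<longrightarrow> h \<mu> = h' (cell_counts \<B> \<mu>)"
proof -
  define Q where "Q n \<nu> \<longleftrightarrow> \<nu> \<in> point_measures M \<and> (\<forall>B\<in>\<B>. emeasure \<nu> B \<noteq> \<infinity>) \<and> cell_counts \<B> \<nu> = n" for n \<nu>
  show ?thesis
  proof (intro exI[of _ "\<lambda>n. h (SOME \<nu>. Q n \<nu>)"] ballI impI)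
    fix \<mu> assume m: "\<mu> \<in> point_measures M" "\<forall>B\<in>\<B>. emeasure \<mu> B \<noteq> \<infinity>"
    let ?\<nu> = "SOME \<nu>. Q (cell_counts \<B> \<mu>) \<nu>"
    have "Q (cell_counts \<B> \<mu>) \<mu>" using m by (simp add: Q_def)
    then have "Q (cell_counts \<B> \<mu>) ?\<nu>" by (rule someI)
    then have n: "?\<nu> \<in> point_measures M" "\<forall>B\<in>\<B>. emeasure ?\<nu> B \<noteq> \<infinity>" "cell_counts \<B> \<mu> = cell_counts \<B> ?\<nu>"
      by (auto simp: Q_def)
    show "h \<mu> = h ?\<nu>"
      by (rule determined_by_cell_counts[OF assms(1) m(1) n(1) assms(2) _ _ n(3)]) (use m(2) n(2) in auto)
  qed
qed

text \<open>Uniqueness is tested on cylinder sets. All sets that decide such an event are unions of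
  finitely many cells, so up to null sets the event is a condition on a count vector, whose law is
  discrete. The family \<open>\<C>\<^sub>0\<close> lets a user insist that certain sets are unions
  of the cells under consideration.\<close>

lemma point_measure_law_eqI:
  fixes P1 P2 :: "'a measure measure"
  assumes sets: "sets P1 = sets (point_measure_algebra M)" "sets P2 = sets (point_measure_algebra M)"
    and fin: "finite_measure P1"
    and L: "sigma_finite_measure L" "sets L = sets M"
    and C0: "finite \<C>\<^sub>0" "\<C>\<^sub>0 \<subseteq> finite_sets L"
    and AE1: "\<And>C. C \<in> finite_sets L \<Longrightarrow> AE \<mu> in P1. emeasure \<mu> C \<noteq> \<infinity>"
    and AE2: "\<And>C. C \<in> finite_sets L \<Longrightarrow> AE \<mu> in P2. emeasure \<mu> C \<noteq> \<infinity>"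
    and eq: "\<And>\<B> n. cells L \<B> \<Longrightarrow> refines \<B> \<C>\<^sub>0 \<Longrightarrow>
      emeasure P1 {\<mu> \<in> point_measures M. \<forall>B\<in>\<B>. emeasure \<mu> B = of_nat (n B)}
      = emeasure P2 {\<mu> \<in> point_measures M. \<forall>B\<in>\<B>. emeasure \<mu> B = of_nat (n B)}"
  shows "P1 = P2"
proof (rule measure_eqI_generator_eq[OF Int_stable_cylinder_sets cylinder_sets_Pow])
  show "sets P1 = sigma_sets (point_measures M) (cylinder_sets M L)" "sets P2 = sigma_sets (point_measures M) (cylinder_sets M L)"
    using sets sigma_cylinder_sets[OF L] by auto
  show "range (\<lambda>_::nat. point_measures M) \<subseteq> cylinder_sets M L"
    using point_measures_in_cylinder_sets by auto
  show "emeasure P1 (point_measures M) \<noteq> \<infinity>" for i :: nat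
    using fin by (simp add: finite_measure.emeasure_finite)
  fix A assume "A \<in> cylinder_sets M L"
  then obtain \<C> where A: "A \<in> sets (point_measure_algebra M)" and C: "finite \<C>" "\<C> \<subseteq> finite_sets L"
    and det: "determined_by M \<C> (\<lambda>\<mu>. \<mu> \<in> A)"
    unfolding cylinder_sets_def by blast
  have sp: "space P1 = point_measures M" "space P2 = point_measures M"
    using sets[THEN sets_eq_imp_space_eq] by simp_all
  obtain \<B> where cB: "cells L \<B>" and r: "refines \<B> (\<C> \<union> \<C>\<^sub>0)"
    using cells_refinement[of "\<C> \<union> \<C>\<^sub>0" L] C C0 by auto
  have "determined_by M \<B> (\<lambda>\<mu>. \<mu> \<in> A)"
    using determined_by_refines[OF det _ cB L(2)] r by (auto simp: refines_def)
  note det = determined_by_cell_counts[OF this]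
  have r0: "refines \<B> \<C>\<^sub>0" using r by (auto simp: refines_def)
  have B: "finite \<B>" "\<B> \<subseteq> finite_sets L" using cB by (auto simp: cells_def)
  then have Bs: "\<B> \<subseteq> sets M" using L by (auto simp: finite_sets_def)
  define fin_on where "fin_on \<mu> \<longleftrightarrow> (\<forall>B\<in>\<B>. emeasure \<mu> B \<noteq> \<infinity>)" for \<mu> :: "'a measure"
  have f1: "AE \<mu> in P1. \<mu> \<in> point_measures M \<and> fin_on \<mu>"
    unfolding fin_on_def using AE1 B sp by (auto intro!: AE_finite_allI AE_conjI simp: sp[symmetric])
  have f2: "AE \<mu> in P2. \<mu> \<in> point_measures M \<and> fin_on \<mu>"
    unfolding fin_on_def using AE2 B sp by (auto intro!: AE_finite_allI AE_conjI simp: sp[symmetric])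
  have m0: "cell_counts \<B> \<in> point_measure_algebra M \<rightarrow>\<^sub>M count_space UNIV"
    using measurable_cell_counts[OF measurable_ident B(1) Bs] by simp
  then have m: "cell_counts \<B> \<in> P1 \<rightarrow>\<^sub>M count_space UNIV" "cell_counts \<B> \<in> P2 \<rightarrow>\<^sub>M count_space UNIV"
    using sets by (auto simp: measurable_cong_sets)
  let ?S = "{f :: 'a set \<Rightarrow> nat. \<forall>x. x \<notin> \<B> \<longrightarrow> f x = 0}"
  have cyl: "{\<mu> \<in> point_measures M. \<forall>B\<in>\<B>. emeasure \<mu> B = of_nat (n B)} \<in> sets (point_measure_algebra M)" for n :: "'a set \<Rightarrow> nat"
  proof -
    have "{\<mu> \<in> space (point_measure_algebra M). \<forall>B\<in>\<B>. emeasure \<mu> B = of_nat (n B)} \<in> sets (point_measure_algebra M)"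
      using B(1) Bs by (intro sets.sets_Collect_finite_All) (auto simp: sets_point_measure_algebra)
    then show ?thesis by simp
  qed
  have e1: "emeasure (distr P1 (count_space UNIV) (cell_counts \<B>)) S = emeasure P1 A'"
    and e2: "emeasure (distr P2 (count_space UNIV) (cell_counts \<B>)) S = emeasure P2 A'"
    if A': "A' \<in> sets (point_measure_algebra M)"
      "\<And>\<mu>. \<mu> \<in> point_measures M \<Longrightarrow> fin_on \<mu> \<Longrightarrow> cell_counts \<B> \<mu> \<in> S \<longleftrightarrow> \<mu> \<in> A'" for S A'
  proof -
    have "emeasure (distr P1 (count_space UNIV) (cell_counts \<B>)) S = emeasure P1 (cell_counts \<B> -` S \<inter> space P1)"
      by (rule emeasure_distr[OF m(1)]) simp
    also have "\<dots> = emeasure P1 A'"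
    proof (rule emeasure_eq_AE)
      show "AE \<mu> in P1. \<mu> \<in> cell_counts \<B> -` S \<inter> space P1 \<longleftrightarrow> \<mu> \<in> A'"
        using f1 by eventually_elim (simp add: A'(2) sp)
      show "cell_counts \<B> -` S \<inter> space P1 \<in> sets P1" by (rule measurable_sets[OF m(1)]) simp
    qed (use A'(1) sets in auto)
    finally show "emeasure (distr P1 (count_space UNIV) (cell_counts \<B>)) S = emeasure P1 A'" .
    have "emeasure (distr P2 (count_space UNIV) (cell_counts \<B>)) S = emeasure P2 (cell_counts \<B> -` S \<inter> space P2)"
      by (rule emeasure_distr[OF m(2)]) simp
    also have "\<dots> = emeasure P2 A'"
    proof (rule emeasure_eq_AE)
      show "AE \<mu> in P2. \<mu> \<in> cell_counts \<B> -` S \<inter> space P2 \<longleftrightarrow> \<mu> \<in> A'"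
        using f2 by eventually_elim (simp add: A'(2) sp)
      show "cell_counts \<B> -` S \<inter> space P2 \<in> sets P2" by (rule measurable_sets[OF m(2)]) simp
    qed (use A'(1) sets in auto)
    finally show "emeasure (distr P2 (count_space UNIV) (cell_counts \<B>)) S = emeasure P2 A'" .
  qed
  have "distr P1 (count_space UNIV) (cell_counts \<B>) = distr P2 (count_space UNIV) (cell_counts \<B>)"
  proof (rule measure_eqI_countable_AE[where \<Omega> = ?S])
    show "countable ?S" by (rule countable_finite_support[OF B(1)])
    show "AE x in distr P1 (count_space UNIV) (cell_counts \<B>). x \<in> ?S" "AE x in distr P2 (count_space UNIV) (cell_counts \<B>). x \<in> ?S"
      using m by (auto simp: AE_distr_iff cell_counts_def)
    fix n assume n: "n \<in> ?S"
    have *: "cell_counts \<B> \<mu> = n \<longleftrightarrow> (\<forall>B\<in>\<B>. emeasure \<mu> B = of_nat (n B))" if "\<mu> \<in> point_measures M" "fin_on \<mu>" for \<mu>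
      using n by (intro cell_counts_eq_iff[OF that(1) Bs]) (use that(2) in \<open>auto simp: fin_on_def\<close>)
    have "emeasure (distr P1 (count_space UNIV) (cell_counts \<B>)) {n}
        = emeasure P1 {\<mu> \<in> point_measures M. \<forall>B\<in>\<B>. emeasure \<mu> B = of_nat (n B)}"
      by (rule e1[OF cyl]) (simp add: *)
    also have "\<dots> = emeasure P2 {\<mu> \<in> point_measures M. \<forall>B\<in>\<B>. emeasure \<mu> B = of_nat (n B)}"
      by (rule eq[OF cB r0])
    also have "\<dots> = emeasure (distr P2 (count_space UNIV) (cell_counts \<B>)) {n}"
      by (rule e2[OF cyl, symmetric]) (simp add: *)
    finally show "emeasure (distr P1 (count_space UNIV) (cell_counts \<B>)) {n} = emeasure (distr P2 (count_space UNIV) (cell_counts \<B>)) {n}" .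
  qed auto
  note distr_eq = this
  \<comment> \<open>The counts of those members of \<open>A\<close> whose cell masses are finite.
    Where masses are finite, membership in \<open>A\<close> and counts in \<open>T\<close> are
    equivalent, since two such measures with equal counts agree on the cells that decide
    \<open>A\<close>.\<close>
  define T where "T = cell_counts \<B> ` {\<mu> \<in> A. fin_on \<mu>}"
  have AP: "A \<subseteq> point_measures M" using sets.sets_into_space[OF A] by simp
  have *: "\<mu> \<in> A \<longleftrightarrow> cell_counts \<B> \<mu> \<in> T" if m: "\<mu> \<in> point_measures M" "fin_on \<mu>" for \<mu>
  proof
    assume "cell_counts \<B> \<mu> \<in> T"
    then obtain \<nu> where \<nu>: "\<nu> \<in> A" "fin_on \<nu>" "cell_counts \<B> \<mu> = cell_counts \<B> \<nu>"
      unfolding T_def by blast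
    from det[OF m(1) _ Bs _ _ \<nu>(3)] \<nu> AP m(2) show "\<mu> \<in> A"
      unfolding fin_on_def by blast
  qed (use m in \<open>auto simp: T_def\<close>)
  have "emeasure P1 A = emeasure (distr P1 (count_space UNIV) (cell_counts \<B>)) T"
    by (rule e1[OF A, symmetric]) (simp add: *)
  also have "\<dots> = emeasure P2 A"
    unfolding distr_eq by (rule e2[OF A]) (simp add: *)
  finally show "emeasure P1 A = emeasure P2 A" .
qed auto

text \<open>Almost sure finiteness is not part of the definition for finite means; it follows
  because the prescribed weights of the natural values already add up to 1.\<close>

lemma poisson_distributed_finite:
  assumes "prob_space \<Omega>" "poisson_distributed \<Omega> Y c" "c \<noteq> \<infinity>" and Y: "Y \<in> borel_measurable \<Omega>"
  shows "measure \<Omega> {\<omega> \<in> space \<Omega>. Y \<omega> = of_nat k} = pmf (poi (enn2real c)) k"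
    and "AE \<omega> in \<Omega>. Y \<omega> \<noteq> \<infinity>"
proof -
  interpret prob_space \<Omega> by fact
  have [measurable]: "Y \<in> borel_measurable \<Omega>" by fact
  have p: "prob {\<omega> \<in> space \<Omega>. Y \<omega> = of_nat k} = pmf (poi (enn2real c)) k" for k
    using assms(2,3) by (simp add: poisson_distributed_def pmf_poi)
  then show "prob {\<omega> \<in> space \<Omega>. Y \<omega> = of_nat k} = pmf (poi (enn2real c)) k" .
  have "(\<Sum>k. emeasure \<Omega> {\<omega> \<in> space \<Omega>. Y \<omega> = of_nat k}) = emeasure \<Omega> (\<Union>k. {\<omega> \<in> space \<Omega>. Y \<omega> = of_nat k})"
    by (intro suminf_emeasure) (auto simp: disjoint_family_on_def)
  moreover have "(\<Sum>k. emeasure \<Omega> {\<omega> \<in> space \<Omega>. Y \<omega> = of_nat k}) = (\<integral>\<^sup>+k. ennreal (pmf (poi (enn2real c)) k) \<partial>count_space UNIV)"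
    by (simp add: emeasure_eq_measure p nn_integral_count_space_nat)
  ultimately have "emeasure \<Omega> (\<Union>k. {\<omega> \<in> space \<Omega>. Y \<omega> = of_nat k}) = 1"
    by (simp add: nn_integral_pmf)
  then have "AE \<omega> in \<Omega>. \<omega> \<in> (\<Union>k. {\<omega> \<in> space \<Omega>. Y \<omega> = of_nat k})"
    by (intro AE_prob_1) (simp add: measure_def)
  then show "AE \<omega> in \<Omega>. Y \<omega> \<noteq> \<infinity>" by eventually_elim auto
qed

lemma poisson_process_AE_finite:
  assumes "prob_space \<Omega>" "poisson_process \<Omega> M L \<eta>" "sets L = sets M" "C \<in> finite_sets L"
  shows "AE \<omega> in \<Omega>. emeasure (\<eta> \<omega>) C \<noteq> \<infinity>"
  using assms by (intro poisson_distributed_finite(2)[of _ _ "emeasure L C"] measurable_emeasure_point_measure[of _ _ M])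
    (auto simp: poisson_process_def finite_sets_def)

text \<open>Independence is available for families indexed by an initial segment of the naturals, so
  the cells are enumerated by a bijection and the product is reindexed at the end. The empty family
  is separate because the product rule for independent events asks for a nonempty index set.\<close>

lemma poisson_process_counts:
  assumes P: "prob_space \<Omega>" and pp: "poisson_process \<Omega> M L \<eta>" and L: "sets L = sets M" and cB: "cells L \<B>"
  shows "measure \<Omega> {\<omega> \<in> space \<Omega>. \<forall>B\<in>\<B>. emeasure (\<eta> \<omega>) B = of_nat (n B)} = (\<Prod>B\<in>\<B>. pmf (poi (measure L B)) (n B))"
proof (cases "\<B> = {}")
  case True
  then show ?thesis using prob_space.prob_space[OF P] by simp
next
  case False
  interpret prob_space \<Omega> by fact
  have B: "finite \<B>" "disjoint \<B>" "\<B> \<subseteq> sets M" "\<And>B. B \<in> \<B> \<Longrightarrow> emeasure L B \<noteq> \<infinity>"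
    using cB L by (auto simp: cells_def finite_sets_def)
  obtain b where b: "bij_betw b {0..<card \<B>} \<B>" using ex_bij_betw_nat_finite[OF B(1)] by blast
  define m where "m = card \<B>"
  have bi: "b ` {..<m} = \<B>" "inj_on b {..<m}" using b by (auto simp: bij_betw_def lessThan_atLeast0 m_def)
  have m0: "{..<m} \<noteq> {}" using bi(1) False by auto
  have [measurable]: "\<eta> \<in> \<Omega> \<rightarrow>\<^sub>M point_measure_algebra M" using pp by (simp add: poisson_process_def)
  have iv: "indep_vars (\<lambda>_. borel) (\<lambda>i \<omega>. emeasure (\<eta> \<omega>) (b i)) {..<m}"
  proof -
    have "disjoint_family_on b {..<m}"
      unfolding disjoint_family_on_def
    proof (intro ballI impI)
      fix i j assume "i \<in> {..<m}" "j \<in> {..<m}" "i \<noteq> j"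
      then show "b i \<inter> b j = {}"
        using bi inj_onD[OF bi(2)] by (intro disjointD[OF B(2)]) auto
    qed
    moreover have "\<forall>i<m. b i \<in> sets M" using bi B(3) by auto
    ultimately show ?thesis using pp by (simp add: poisson_process_def)
  qed
  have "{\<omega> \<in> space \<Omega>. \<forall>B\<in>\<B>. emeasure (\<eta> \<omega>) B = of_nat (n B)}
      = (\<Inter>i\<in>{..<m}. (\<lambda>\<omega>. emeasure (\<eta> \<omega>) (b i)) -` {of_nat (n (b i))} \<inter> space \<Omega>)"
    unfolding bi(1)[symmetric] using m0 by auto
  also have "prob \<dots> = (\<Prod>i<m. prob ((\<lambda>\<omega>. emeasure (\<eta> \<omega>) (b i)) -` {of_nat (n (b i))} \<inter> space \<Omega>))"
    by (rule indep_varsD_finite[OF iv]) (use m0 in auto)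
  also have "\<dots> = (\<Prod>i<m. pmf (poi (measure L (b i))) (n (b i)))"
  proof (rule prod.cong[OF refl])
    fix i assume "i \<in> {..<m}"
    then have bB: "b i \<in> \<B>" using bi by auto
    have "prob {\<omega> \<in> space \<Omega>. emeasure (\<eta> \<omega>) (b i) = of_nat (n (b i))} = pmf (poi (enn2real (emeasure L (b i)))) (n (b i))"
      using bB B pp P by (intro poisson_distributed_finite measurable_emeasure_point_measure[of _ _ M]) (auto simp: poisson_process_def)
    moreover have "(\<lambda>\<omega>. emeasure (\<eta> \<omega>) (b i)) -` {of_nat (n (b i))} \<inter> space \<Omega> = {\<omega> \<in> space \<Omega>. emeasure (\<eta> \<omega>) (b i) = of_nat (n (b i))}"
      by auto
    ultimately show "prob ((\<lambda>\<omega>. emeasure (\<eta> \<omega>) (b i)) -` {of_nat (n (b i))} \<inter> space \<Omega>) = pmf (poi (measure L (b i))) (n (b i))"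
      by (simp add: measure_def)
  qed
  also have "\<dots> = (\<Prod>B\<in>\<B>. pmf (poi (measure L B)) (n B))"
    unfolding bi(1)[symmetric] by (simp add: prod.reindex[OF bi(2)])
  finally show ?thesis .
qed

section \<open>The Mecke formula\<close>

lemma pmf_poi_Suc: "0 \<le> c \<Longrightarrow> real (Suc k) * pmf (poi c) (Suc k) = c * pmf (poi c) k"
  by (simp add: pmf_poi del: of_nat_Suc)

text \<open>The Mecke formula for events prescribing all cell counts. The summand
  \<open>of_bool (B = D)\<close> is the effect of a new point in \<open>D\<close>, and the identity
  is the recursion (k + 1) P(k + 1) = c P(k) in the coordinate \<open>D\<close>, all other
  coordinates being equal.\<close>

lemma mecke_cells:
  assumes P: "prob_space \<Omega>" and pp: "poisson_process \<Omega> M L \<eta>" and L: "sets L = sets M" and cB: "cells L \<B>"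
    and D: "D \<in> \<B>"
  shows "emeasure L D * emeasure \<Omega> {\<omega> \<in> space \<Omega>. \<forall>B\<in>\<B>. emeasure (\<eta> \<omega>) B + of_bool (B = D) = of_nat (n B)}
    = of_nat (n D) * emeasure \<Omega> {\<omega> \<in> space \<Omega>. \<forall>B\<in>\<B>. emeasure (\<eta> \<omega>) B = of_nat (n B)}"
\<comment> \<open>With \<open>n D = 0\<close> no configuration with an added point in
  \<open>D\<close> has these counts, so both sides are 0; otherwise the added point lowers the
  required count by one.\<close>
proof (cases "n D")
  case 0
  then have eq: "{\<omega> \<in> space \<Omega>. \<forall>B\<in>\<B>. emeasure (\<eta> \<omega>) B + of_bool (B = D) = of_nat (n B)} = {}"
    using D by (auto intro!: bexI[of _ D])
  show ?thesis unfolding eq using 0 by simp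
next
  case (Suc k)
  interpret prob_space \<Omega> by fact
  have B: "finite \<B>" "D \<in> sets M" "emeasure L D \<noteq> \<infinity>" using cB L D by (auto simp: cells_def finite_sets_def)
  have "{\<omega> \<in> space \<Omega>. \<forall>B\<in>\<B>. emeasure (\<eta> \<omega>) B + of_bool (B = D) = of_nat (n B)}
      = {\<omega> \<in> space \<Omega>. \<forall>B\<in>\<B>. emeasure (\<eta> \<omega>) B = of_nat ((n(D := k)) B)}"
  proof -
    have "emeasure (\<eta> \<omega>) B + of_bool (B = D) = of_nat (n B) \<longleftrightarrow> emeasure (\<eta> \<omega>) B = of_nat ((n(D := k)) B)" for \<omega> B
    proof (cases "B = D")
      case True
      have "emeasure (\<eta> \<omega>) D + 1 = of_nat (Suc k) \<longleftrightarrow> emeasure (\<eta> \<omega>) D = of_nat k"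
        by (simp add: add.commute ennreal_add_left_cancel)
      then show ?thesis using True Suc by simp
    qed simp
    then show ?thesis by simp
  qed
  then have 1: "emeasure \<Omega> {\<omega> \<in> space \<Omega>. \<forall>B\<in>\<B>. emeasure (\<eta> \<omega>) B + of_bool (B = D) = of_nat (n B)}
      = ennreal (\<Prod>B\<in>\<B>. pmf (poi (measure L B)) ((n(D := k)) B))"
    by (simp add: emeasure_eq_measure poisson_process_counts[OF P pp L cB])
  have 2: "emeasure \<Omega> {\<omega> \<in> space \<Omega>. \<forall>B\<in>\<B>. emeasure (\<eta> \<omega>) B = of_nat (n B)}
      = ennreal (\<Prod>B\<in>\<B>. pmf (poi (measure L B)) (n B))"
    by (simp add: emeasure_eq_measure poisson_process_counts[OF P pp L cB])
  have "(\<Prod>B\<in>\<B> - {D}. pmf (poi (measure L B)) ((n(D := k)) B)) = (\<Prod>B\<in>\<B> - {D}. pmf (poi (measure L B)) (n B))"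
    by (intro prod.cong) auto
  then have "measure L D * (\<Prod>B\<in>\<B>. pmf (poi (measure L B)) ((n(D := k)) B))
      = real (n D) * (\<Prod>B\<in>\<B>. pmf (poi (measure L B)) (n B))"
    using pmf_poi_Suc[of "measure L D" k] Suc
    by (simp add: prod.remove[OF B(1) D] mult.assoc[symmetric] del: of_nat_Suc)
  then have "ennreal (measure L D) * ennreal (\<Prod>B\<in>\<B>. pmf (poi (measure L B)) ((n(D := k)) B))
      = ennreal (real (n D)) * ennreal (\<Prod>B\<in>\<B>. pmf (poi (measure L B)) (n B))"
    by (simp add: ennreal_mult'[symmetric])
  moreover have "emeasure L D = ennreal (measure L D)" using B(3) by (simp add: emeasure_eq_ennreal_measure)
  ultimately show ?thesis
    unfolding 1 2 by (simp only: ennreal_of_nat_eq_real_of_nat)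
qed

text \<open>Both sides are integrals of \<open>G\<close> against finite measures on point measures:
  \<open>Q1\<close> is the law of \<eta> with a point added that is drawn from the intensity
  restricted to \<open>C\<close>, and \<open>Q2\<close> is the law of \<eta> weighted by its mass in
  \<open>C\<close>. They coincide because they give the same mass to all events prescribing counts
  in cells.\<close>

lemma mecke:
  fixes M L :: "'a measure"
  assumes P: "prob_space \<Omega>" and pp: "poisson_process \<Omega> M L \<eta>" and sf: "sigma_finite_measure L" and L: "sets L = sets M"
    and C: "C \<in> finite_sets L" and G: "G \<in> borel_measurable (point_measure_algebra M)"
  shows "(\<integral>\<^sup>+\<omega>. emeasure (\<eta> \<omega>) C * G (\<eta> \<omega>) \<partial>\<Omega>)
     = (\<integral>\<^sup>+x. indicator C x * (\<integral>\<^sup>+\<omega>. G (measure_add M (\<eta> \<omega>) (return M x)) \<partial>\<Omega>) \<partial>L)"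
proof -
  interpret prob_space \<Omega> by fact
  interpret L: sigma_finite_measure L by fact
  let ?N = "point_measure_algebra M"
  have eta[measurable]: "\<eta> \<in> \<Omega> \<rightarrow>\<^sub>M ?N" using pp by (simp add: poisson_process_def)
  have CM[measurable]: "C \<in> sets M" using C L by (simp add: finite_sets_def)
  have [measurable_cong]: "sets L = sets M" by fact
  note G[measurable]
  define P' where "P' = distr \<Omega> ?N \<eta>"
  have [measurable_cong]: "sets P' = sets ?N" by (simp add: P'_def)
  have spP: "space P' = point_measures M" by (simp add: P'_def)
  have spL: "space L = space M" using L by (rule sets_eq_imp_space_eq)
  interpret P': prob_space P' unfolding P'_def by (rule prob_space_distr[OF eta])
  define LC where "LC = density L (indicator C)"
  have [measurable_cong]: "sets LC = sets M" by (simp add: LC_def L)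
  have spLC: "space LC = space M" by (simp add: LC_def spL)
  have CL: "C \<in> sets L" "emeasure L C \<noteq> \<infinity>" using C by (auto simp: finite_sets_def)
  have "emeasure LC (space M) = (\<integral>\<^sup>+x. indicator C x * indicator (space M) x \<partial>L)"
    unfolding LC_def using CL spL by (intro emeasure_density) auto
  also have "\<dots> = (\<integral>\<^sup>+x. indicator C x \<partial>L)"
    by (intro nn_integral_cong) (simp add: spL)
  also have "\<dots> = emeasure L C" using CL by simp
  finally have LC_fin: "emeasure LC (space LC) \<noteq> \<infinity>" using CL by (simp add: spLC)
  interpret LC: finite_measure LC by (rule finite_measureI[OF LC_fin])
  interpret LP: pair_sigma_finite LC P' ..
  have add[measurable]: "(\<lambda>(x, \<mu>). measure_add M \<mu> (return M x)) \<in> M \<Otimes>\<^sub>M ?N \<rightarrow>\<^sub>M ?N"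
    by measurable
  define Q1 where "Q1 = distr (LC \<Otimes>\<^sub>M P') ?N (\<lambda>(x, \<mu>). measure_add M \<mu> (return M x))"
  define Q2 where "Q2 = density P' (\<lambda>\<mu>. emeasure \<mu> C)"
  have evC[measurable]: "(\<lambda>\<mu>. emeasure \<mu> C) \<in> borel_measurable ?N" by measurable
  have Q1: "(\<integral>\<^sup>+\<mu>. H \<mu> \<partial>Q1) = (\<integral>\<^sup>+x. indicator C x * (\<integral>\<^sup>+\<omega>. H (measure_add M (\<eta> \<omega>) (return M x)) \<partial>\<Omega>) \<partial>L)"
    if [measurable]: "H \<in> borel_measurable ?N" for H
  proof -
    have "(\<integral>\<^sup>+\<mu>. H \<mu> \<partial>Q1) = (\<integral>\<^sup>+x. \<integral>\<^sup>+\<mu>. H (measure_add M \<mu> (return M x)) \<partial>P' \<partial>LC)"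
      unfolding Q1_def by (simp add: nn_integral_distr case_prod_beta' P'.nn_integral_fst[symmetric])
    also have "\<dots> = (\<integral>\<^sup>+x. indicator C x * (\<integral>\<^sup>+\<mu>. H (measure_add M \<mu> (return M x)) \<partial>P') \<partial>L)"
      unfolding LC_def by (rule nn_integral_density) measurable
    also have "\<dots> = (\<integral>\<^sup>+x. indicator C x * (\<integral>\<^sup>+\<omega>. H (measure_add M (\<eta> \<omega>) (return M x)) \<partial>\<Omega>) \<partial>L)"
      by (intro nn_integral_cong) (simp add: P'_def nn_integral_distr spL)
    finally show ?thesis .
  qed
  have Q2: "(\<integral>\<^sup>+\<mu>. H \<mu> \<partial>Q2) = (\<integral>\<^sup>+\<omega>. emeasure (\<eta> \<omega>) C * H (\<eta> \<omega>) \<partial>\<Omega>)"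
    if [measurable]: "H \<in> borel_measurable ?N" for H
    unfolding Q2_def P'_def by (simp add: nn_integral_density nn_integral_distr)
  have fin_eta: "AE \<omega> in \<Omega>. emeasure (\<eta> \<omega>) D \<noteq> \<infinity>" if "D \<in> finite_sets L" for D
    by (rule poisson_process_AE_finite[OF P pp L that])
  have finP: "AE \<mu> in P'. emeasure \<mu> D \<noteq> \<infinity>" if D: "D \<in> finite_sets L" for D
  proof -
    have [measurable]: "D \<in> sets M" using D L by (simp add: finite_sets_def)
    show ?thesis unfolding P'_def
    proof (subst AE_distr_iff)
      show "{\<mu> \<in> space ?N. emeasure \<mu> D \<noteq> \<infinity>} \<in> sets ?N" by measurable
      show "AE \<omega> in \<Omega>. emeasure (\<eta> \<omega>) D \<noteq> \<infinity>" by (rule fin_eta[OF D])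
    qed measurable
  qed
  have "Q1 = Q2"
  proof (rule point_measure_law_eqI[OF _ _ _ sf L])
    show "sets Q1 = sets ?N" "sets Q2 = sets ?N" by (simp_all add: Q1_def Q2_def P'_def)
    \<comment> \<open>Requiring refinement of \<open>C\<close> makes \<open>C\<close> a union of
      cells, so that both sides split into sums over the cells inside \<open>C\<close>.\<close>
    show "finite {C}" "{C} \<subseteq> finite_sets L" using C by auto
    show "finite_measure Q1"
      unfolding Q1_def by (intro finite_measure.finite_measure_distr finite_measure_pair_measure) (unfold_locales, measurable)
    fix D assume D: "D \<in> finite_sets L"
    then have [measurable]: "D \<in> sets M" using L by (simp add: finite_sets_def)
    show "AE \<mu> in Q2. emeasure \<mu> D \<noteq> \<infinity>"
      unfolding Q2_def using finP[OF D] by (subst AE_density) auto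
    have "AE z in LC \<Otimes>\<^sub>M P'. emeasure (measure_add M (snd z) (return M (fst z))) D \<noteq> \<infinity>"
    proof (rule LP.AE_pair_measure)
      have "AE \<mu> in P'. emeasure (measure_add M \<mu> (return M x)) D \<noteq> \<infinity>" if x: "x \<in> space M" for x
      proof -
        note finP[OF D]
        moreover have "AE \<mu> in P'. \<mu> \<in> point_measures M" using AE_space[of P'] by (simp add: spP)
        ultimately show ?thesis
          by eventually_elim (use x in \<open>auto simp: emeasure_measure_add_point_measures return_point_measures indicator_def\<close>)
      qed
      then show "AE x in LC. AE y in P'. emeasure (measure_add M (snd (x, y)) (return M (fst (x, y)))) D \<noteq> \<infinity>"
        by (auto simp: spLC[symmetric])
    qed measurable
    moreover have "{\<mu> \<in> space ?N. emeasure \<mu> D \<noteq> \<infinity>} \<in> sets ?N" by measurable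
    ultimately show "AE \<mu> in Q1. emeasure \<mu> D \<noteq> \<infinity>"
      unfolding Q1_def by (subst AE_distr_iff) (auto simp: case_prod_beta')
  next
    fix \<B> n assume cB: "cells L \<B>" and r: "refines \<B> {C}"
    obtain \<D> where D: "\<D> \<subseteq> \<B>" "C = \<Union>\<D>" by (rule refinesD[OF r]) simp_all
    have cD: "finite \<D>" "disjoint \<D>" "\<D> \<subseteq> sets M" "finite \<B>" "disjoint \<B>" "\<B> \<subseteq> sets M"
      using cells_subset[OF cB D(1)] cB L by (auto simp: cells_def finite_sets_def)
    let ?E = "{\<mu> \<in> point_measures M. \<forall>B\<in>\<B>. emeasure \<mu> B = of_nat (n B)}"
    have E[measurable]: "?E \<in> sets ?N"
    proof -
      have "{\<mu> \<in> space ?N. \<forall>B\<in>\<B>. emeasure \<mu> B = of_nat (n B)} \<in> sets ?N"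
        using cD by (intro sets.sets_Collect_finite_All) (auto simp: sets_point_measure_algebra)
      then show ?thesis by simp
    qed
    have PM: "\<eta> \<omega> \<in> point_measures M" if "\<omega> \<in> space \<Omega>" for \<omega> using measurable_space[OF eta that] by simp
    have sum_ind: "(\<integral>\<^sup>+x. (\<Sum>D\<in>\<D>. indicator D x * c D) \<partial>L) = (\<Sum>D\<in>\<D>. emeasure L D * c D)" for c :: "'a set \<Rightarrow> ennreal"
    proof -
      have DL: "D' \<in> sets L" if "D' \<in> \<D>" for D' using that cD(3) L by auto
      then have "(\<integral>\<^sup>+x. (\<Sum>D\<in>\<D>. indicator D x * c D) \<partial>L) = (\<Sum>D\<in>\<D>. \<integral>\<^sup>+x. indicator D x * c D \<partial>L)"
        by (intro nn_integral_sum) auto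
      also have "\<dots> = (\<Sum>D\<in>\<D>. emeasure L D * c D)"
        using DL by (intro sum.cong refl) (simp add: nn_integral_multc)
      finally show ?thesis .
    qed
    have "emeasure Q1 ?E = (\<integral>\<^sup>+\<mu>. indicator ?E \<mu> \<partial>Q1)"
      using E by (simp add: Q1_def)
    also have "\<dots> = (\<integral>\<^sup>+x. indicator C x * (\<integral>\<^sup>+\<omega>. indicator ?E (measure_add M (\<eta> \<omega>) (return M x)) \<partial>\<Omega>) \<partial>L)"
      by (rule Q1) measurable
    also have "\<dots> = (\<integral>\<^sup>+x. (\<Sum>D\<in>\<D>. indicator D x * emeasure \<Omega> {\<omega> \<in> space \<Omega>. \<forall>B\<in>\<B>. emeasure (\<eta> \<omega>) B + of_bool (B = D) = of_nat (n B)}) \<partial>L)"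
    proof (rule nn_integral_cong)
      fix x assume "x \<in> space L"
      then have x: "x \<in> space M" by (simp add: spL)
      let ?S = "\<lambda>D. {\<omega> \<in> space \<Omega>. \<forall>B\<in>\<B>. emeasure (\<eta> \<omega>) B + of_bool (B = D) = of_nat (n B)}"
      show "indicator C x * (\<integral>\<^sup>+\<omega>. indicator ?E (measure_add M (\<eta> \<omega>) (return M x)) \<partial>\<Omega>)
          = (\<Sum>D\<in>\<D>. indicator D x * emeasure \<Omega> (?S D))"
      proof (cases "x \<in> C")
        case False
        then have "indicator D' x = (0::ennreal)" if "D' \<in> \<D>" for D' using that D(2) by (auto simp: indicator_def)
        then show ?thesis using False by simp
      next
        case True
        then obtain D\<^sub>0 where D0: "D\<^sub>0 \<in> \<D>" "x \<in> D\<^sub>0" using D(2) by blast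
        \<comment> \<open>By disjointness a point of \<open>C\<close> lies in exactly one cell, so
          adding it changes exactly one count.\<close>
        have xB: "x \<in> B \<longleftrightarrow> B = D\<^sub>0" if "B \<in> \<B>" for B
          using disjointD[OF cD(5) that, of D\<^sub>0] D0 D(1) by auto
        have "(\<Sum>D\<in>\<D>. indicator D x * emeasure \<Omega> (?S D)) = (\<Sum>D\<in>\<D>. if D = D\<^sub>0 then emeasure \<Omega> (?S D) else 0)"
        proof (rule sum.cong[OF refl])
          fix D' assume "D' \<in> \<D>"
          then have "x \<in> D' \<longleftrightarrow> D' = D\<^sub>0" using xB D(1) by auto
          then show "indicator D' x * emeasure \<Omega> (?S D') = (if D' = D\<^sub>0 then emeasure \<Omega> (?S D') else 0)"
            by (simp add: indicator_def)
        qed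
        also have "\<dots> = emeasure \<Omega> (?S D\<^sub>0)"
          using D0 cD(1) by simp
        also have "\<dots> = (\<integral>\<^sup>+\<omega>. indicator (?S D\<^sub>0) \<omega> \<partial>\<Omega>)"
        proof (rule nn_integral_indicator[symmetric])
          show "?S D\<^sub>0 \<in> events"
          proof (rule sets.sets_Collect_finite_All)
            fix B assume "B \<in> \<B>"
            then have [measurable]: "B \<in> sets M" using cD by auto
            show "{\<omega> \<in> space \<Omega>. emeasure (\<eta> \<omega>) B + of_bool (B = D\<^sub>0) = of_nat (n B)} \<in> events" by measurable
          qed (rule cD)
        qed
        also have "\<dots> = (\<integral>\<^sup>+\<omega>. indicator ?E (measure_add M (\<eta> \<omega>) (return M x)) \<partial>\<Omega>)"
        proof (rule nn_integral_cong)
          fix \<omega> assume w: "\<omega> \<in> space \<Omega>"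
          have "emeasure (measure_add M (\<eta> \<omega>) (return M x)) B = emeasure (\<eta> \<omega>) B + of_bool (B = D\<^sub>0)" if "B \<in> \<B>" for B
            using PM[OF w] x that cD(6) xB[OF that]
            by (subst emeasure_measure_add_point_measures) (auto simp: return_point_measures indicator_def)
          then have "measure_add M (\<eta> \<omega>) (return M x) \<in> ?E \<longleftrightarrow> \<omega> \<in> ?S D\<^sub>0"
            using w PM[OF w] x by (simp add: measure_add_point_measures return_point_measures)
          then show "indicator (?S D\<^sub>0) \<omega> = (indicator ?E (measure_add M (\<eta> \<omega>) (return M x)) :: ennreal)"
            by (simp add: indicator_def)
        qed
        finally show ?thesis using True by simp
      qed
    qed
    also have "\<dots> = (\<Sum>D\<in>\<D>. emeasure L D * emeasure \<Omega> {\<omega> \<in> space \<Omega>. \<forall>B\<in>\<B>. emeasure (\<eta> \<omega>) B + of_bool (B = D) = of_nat (n B)})"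
      by (rule sum_ind)
    also have "\<dots> = (\<Sum>D\<in>\<D>. of_nat (n D) * emeasure \<Omega> {\<omega> \<in> space \<Omega>. \<forall>B\<in>\<B>. emeasure (\<eta> \<omega>) B = of_nat (n B)})"
      using D(1) by (intro sum.cong refl mecke_cells[OF P pp L cB]) auto
    also have "\<dots> = (\<Sum>D\<in>\<D>. of_nat (n D)) * emeasure \<Omega> {\<omega> \<in> space \<Omega>. \<forall>B\<in>\<B>. emeasure (\<eta> \<omega>) B = of_nat (n B)}"
      by (simp add: sum_distrib_right)
    also have "\<dots> = (\<integral>\<^sup>+\<omega>. (\<Sum>D\<in>\<D>. of_nat (n D)) * indicator {\<omega> \<in> space \<Omega>. \<forall>B\<in>\<B>. emeasure (\<eta> \<omega>) B = of_nat (n B)} \<omega> \<partial>\<Omega>)"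
    proof (rule nn_integral_cmult_indicator[symmetric])
      show "{\<omega> \<in> space \<Omega>. \<forall>B\<in>\<B>. emeasure (\<eta> \<omega>) B = of_nat (n B)} \<in> events"
      proof (rule sets.sets_Collect_finite_All)
        fix B assume "B \<in> \<B>"
        then have [measurable]: "B \<in> sets M" using cD by auto
        show "{\<omega> \<in> space \<Omega>. emeasure (\<eta> \<omega>) B = of_nat (n B)} \<in> events" by measurable
      qed (rule cD)
    qed
    also have "\<dots> = (\<integral>\<^sup>+\<omega>. emeasure (\<eta> \<omega>) C * indicator ?E (\<eta> \<omega>) \<partial>\<Omega>)"
    proof (rule nn_integral_cong)
      fix \<omega> assume w: "\<omega> \<in> space \<Omega>"
      have "emeasure (\<eta> \<omega>) C = (\<Sum>D\<in>\<D>. emeasure (\<eta> \<omega>) D)"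
        unfolding D(2) using cD PM[OF w] by (intro emeasure_Union_cells) (simp_all add: sets_point_measure)
      moreover have "(\<Sum>D\<in>\<D>. emeasure (\<eta> \<omega>) D) = (\<Sum>D\<in>\<D>. of_nat (n D))" if "\<forall>B\<in>\<B>. emeasure (\<eta> \<omega>) B = of_nat (n B)"
        using that D(1) by (intro sum.cong) auto
      ultimately show "(\<Sum>D\<in>\<D>. of_nat (n D)) * indicator {\<omega> \<in> space \<Omega>. \<forall>B\<in>\<B>. emeasure (\<eta> \<omega>) B = of_nat (n B)} \<omega>
          = emeasure (\<eta> \<omega>) C * indicator ?E (\<eta> \<omega>)"
        using w PM[OF w] by (auto simp: indicator_def)
    qed
    also have "\<dots> = (\<integral>\<^sup>+\<mu>. indicator ?E \<mu> \<partial>Q2)"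
      by (rule Q2[symmetric]) measurable
    also have "\<dots> = emeasure Q2 ?E"
      using E by (simp add: Q2_def P'_def)
    finally show "emeasure Q1 ?E = emeasure Q2 ?E" .
  qed
  then show ?thesis using Q1[OF G] Q2[OF G] by simp
qed

section \<open>Thinning\<close>

text \<open>The event is the disjoint union, over the subsets of size \<open>a\<close>, of the event
  that precisely this subset of marks lies below the threshold; each has probability u^a (1 -
  u)^(|F| - a).\<close>

lemma (in prob_space) prob_le_count_binomial:
  fixes U :: "nat \<Rightarrow> 'a \<Rightarrow> real"
  assumes iv: "indep_vars (\<lambda>_. borel) U UNIV" and U: "\<And>j. prob {\<omega> \<in> space M. U j \<omega> \<le> u} = u"
    and u: "0 \<le> u" "u \<le> 1" and F: "finite F"
  shows "prob {\<omega> \<in> space M. card {j \<in> F. U j \<omega> \<le> u} = a} = pmf (binomial_pmf (card F) u) a"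
proof -
  have [measurable]: "U j \<in> borel_measurable M" for j using iv by (auto simp: indep_vars_def)
  define E where "E S = {\<omega> \<in> space M. \<forall>j\<in>F. U j \<omega> \<le> u \<longleftrightarrow> j \<in> S}" for S
  let ?S = "{S. S \<subseteq> F \<and> card S = a}"
  have E: "prob (E S) = u ^ a * (1 - u) ^ (card F - a)" if S: "S \<in> ?S" for S
  proof (cases "F = {}")
    case True
    then show ?thesis using S by (auto simp: E_def prob_space)
  next
    case False
    let ?A = "\<lambda>j. if j \<in> S then {..u} else {u<..}"
    have "E S = (\<Inter>j\<in>F. U j -` ?A j \<inter> space M)"
      using False by (auto simp: E_def split: if_splits)
    also have "prob \<dots> = (\<Prod>j\<in>F. prob (U j -` ?A j \<inter> space M))"
      by (rule indep_varsD[OF iv False F]) auto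
    also have "\<dots> = (\<Prod>j\<in>F. if j \<in> S then u else 1 - u)"
    proof (rule prod.cong[OF refl])
      fix j
      have 1: "U j -` {..u} \<inter> space M = {\<omega> \<in> space M. U j \<omega> \<le> u}"
        and 2: "U j -` {u<..} \<inter> space M = space M - {\<omega> \<in> space M. U j \<omega> \<le> u}" by auto
      show "prob (U j -` ?A j \<inter> space M) = (if j \<in> S then u else 1 - u)"
        using prob_compl[of "{\<omega> \<in> space M. U j \<omega> \<le> u}"] by (simp add: 1 2 U)
    qed
    also have "\<dots> = u ^ card S * (1 - u) ^ card (F - S)"
      using S F by (simp add: prod.If_cases inf.absorb2 Diff_eq)
    finally have "prob (E S) = u ^ card S * (1 - u) ^ card (F - S)" .
    moreover have "card (F - S) = card F - a" using S F card_Diff_subset[of S F] finite_subset[of S F] by simp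
    ultimately show ?thesis using S by simp
  qed
  have "{\<omega> \<in> space M. card {j \<in> F. U j \<omega> \<le> u} = a} = (\<Union>S\<in>?S. E S)"
  proof (intro set_eqI iffI)
    fix \<omega> assume "\<omega> \<in> {\<omega> \<in> space M. card {j \<in> F. U j \<omega> \<le> u} = a}"
    then show "\<omega> \<in> (\<Union>S\<in>?S. E S)"
      by (intro UN_I[of "{j \<in> F. U j \<omega> \<le> u}"]) (auto simp: E_def)
  next
    fix \<omega> assume "\<omega> \<in> (\<Union>S\<in>?S. E S)"
    then obtain S where S: "S \<subseteq> F" "card S = a" "\<omega> \<in> E S" by blast
    then have "{j \<in> F. U j \<omega> \<le> u} = S" by (auto simp: E_def)
    then show "\<omega> \<in> {\<omega> \<in> space M. card {j \<in> F. U j \<omega> \<le> u} = a}" using S by (simp add: E_def)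
  qed
  also have "prob \<dots> = (\<Sum>S\<in>?S. prob (E S))"
  proof (rule finite_measure_finite_Union)
    show "finite ?S" using F by simp
    show "E ` ?S \<subseteq> events"
    proof (intro image_subsetI)
      show "E S \<in> events" for S unfolding E_def using F by (intro sets.sets_Collect_finite_All) auto
    qed
    show "disjoint_family_on E ?S"
      unfolding disjoint_family_on_def
    proof (intro ballI impI)
      fix S T assume "S \<in> ?S" "T \<in> ?S" "S \<noteq> T"
      then obtain j where "j \<in> F" "j \<in> S \<longleftrightarrow> j \<notin> T" by blast
      then show "E S \<inter> E T = {}" by (auto simp: E_def)
    qed
  qed
  also have "\<dots> = real (card ?S) * (u ^ a * (1 - u) ^ (card F - a))"
    by (simp add: E)
  also have "\<dots> = pmf (binomial_pmf (card F) u) a"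
    using u F by (simp add: n_subsets)
  finally show ?thesis .
qed

text \<open>Functions of disjoint blocks of independent marks are independent. The counts are
  written as sums of indicators so that they are measurable functions of the restricted mark
  vectors.\<close>

lemma (in prob_space) prob_le_counts_binomial:
  fixes U :: "nat \<Rightarrow> 'a \<Rightarrow> real" and F :: "'i \<Rightarrow> nat set"
  assumes iv: "indep_vars (\<lambda>_. borel) U UNIV" and U: "\<And>j. prob {\<omega> \<in> space M. U j \<omega> \<le> u} = u"
    and u: "0 \<le> u" "u \<le> 1" and I: "finite I" and F: "\<And>i. i \<in> I \<Longrightarrow> finite (F i)" "disjoint_family_on F I"
  shows "prob {\<omega> \<in> space M. \<forall>i\<in>I. card {j \<in> F i. U j \<omega> \<le> u} = a i} = (\<Prod>i\<in>I. pmf (binomial_pmf (card (F i)) u) (a i))"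
proof (cases "I = {}")
  case False
  define Y where "Y i v = (\<Sum>j\<in>F i. indicator {..u} (v j) :: real)" for i and v :: "nat \<Rightarrow> real"
  have Y: "Y i (restrict (\<lambda>j. U j \<omega>) (F i)) = real (card {j \<in> F i. U j \<omega> \<le> u})" if "i \<in> I" for i \<omega>
  proof -
    have "Y i (restrict (\<lambda>j. U j \<omega>) (F i)) = (\<Sum>j\<in>F i. if U j \<omega> \<le> u then 1 else 0)"
      by (auto simp: Y_def indicator_def intro!: sum.cong)
    also have "\<dots> = real (card {j \<in> F i. U j \<omega> \<le> u})"
      using F(1)[OF that] by (simp add: sum.If_cases Int_def)
    finally show ?thesis .
  qed
  have "indep_vars (\<lambda>i. PiM (F i) (\<lambda>_. borel)) (\<lambda>i \<omega>. restrict (\<lambda>j. U j \<omega>) (F i)) I"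
    by (rule indep_vars_restrict[OF iv _ F(2)]) auto
  then have ivY: "indep_vars (\<lambda>_. borel) (\<lambda>i \<omega>. Y i (restrict (\<lambda>j. U j \<omega>) (F i))) I"
  proof (rule indep_vars_compose2)
    fix i
    show "Y i \<in> PiM (F i) (\<lambda>_. borel) \<rightarrow>\<^sub>M borel" unfolding Y_def
    proof (rule borel_measurable_sum)
      fix j assume "j \<in> F i"
      then have [measurable]: "(\<lambda>v. v j) \<in> PiM (F i) (\<lambda>_. borel) \<rightarrow>\<^sub>M (borel :: real measure)"
        by (rule measurable_component_singleton)
      show "(\<lambda>v. indicator {..u} (v j) :: real) \<in> borel_measurable (PiM (F i) (\<lambda>_. borel))" by measurable
    qed
  qed
  let ?Y = "\<lambda>i \<omega>. Y i (restrict (\<lambda>j. U j \<omega>) (F i))"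
  have eq: "?Y i -` {real (a i)} \<inter> space M = {\<omega> \<in> space M. card {j \<in> F i. U j \<omega> \<le> u} = a i}" if "i \<in> I" for i
    using Y[OF that] by auto
  have "{\<omega> \<in> space M. \<forall>i\<in>I. card {j \<in> F i. U j \<omega> \<le> u} = a i} = (\<Inter>i\<in>I. ?Y i -` {real (a i)} \<inter> space M)"
    using False eq by auto
  also have "prob \<dots> = (\<Prod>i\<in>I. prob (?Y i -` {real (a i)} \<inter> space M))"
    by (rule indep_varsD_finite[OF ivY False I]) auto
  also have "\<dots> = (\<Prod>i\<in>I. pmf (binomial_pmf (card (F i)) u) (a i))"
    using eq F(1) by (intro prod.cong refl) (simp add: prob_le_count_binomial[OF iv U u])
  finally show ?thesis .
qed (simp add: prob_space)

text \<open>Masses become cardinalities of index sets, so coinciding points are counted with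
  multiplicity and all later combinatorics concerns indices.\<close>

lemma emeasure_thinned_sum_of_points:
  assumes x: "\<And>n. x n \<in> space M" and B: "B \<in> sets M"
  shows "emeasure (thinned_sum_of_points M k x v u) B = emeasure (count_space UNIV) {n. enat n < k \<and> v n \<le> u \<and> x n \<in> B}"
proof -
  have "emeasure (thinned_sum_of_points M k x v u) B
      = (\<Sum>n. emeasure (if enat n < k \<and> v n \<le> u then return M (x n) else null_measure M) B)"
    unfolding thinned_sum_of_points_def using B by (intro emeasure_measure_sum) auto
  also have "\<dots> = (\<Sum>n. indicator {n. enat n < k \<and> v n \<le> u \<and> x n \<in> B} n)"
    using B by (intro suminf_cong) (auto simp: indicator_def)
  also have "\<dots> = emeasure (count_space UNIV) {n. enat n < k \<and> v n \<le> u \<and> x n \<in> B}"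
    by (simp add: nn_integral_count_space_nat[symmetric])
  finally show ?thesis .
qed

lemma emeasure_sum_of_points:
  assumes x: "\<And>n. x n \<in> space M" and B: "B \<in> sets M"
  shows "emeasure (sum_of_points M k x) B = emeasure (count_space UNIV) {n. enat n < k \<and> x n \<in> B}"
proof -
  \<comment> \<open>Constant marks 0 pass the threshold 0, so nothing is deleted.\<close>
  have "sum_of_points M k x = thinned_sum_of_points M k x (\<lambda>_. 0) 0"
    by (simp add: sum_of_points_def thinned_sum_of_points_def)
  then show ?thesis using emeasure_thinned_sum_of_points[OF assms, where k=k and v="\<lambda>_. 0" and u=0] by simp
qed

lemma emeasure_count_space_eq_of_nat_iff:
  "emeasure (count_space UNIV) A = of_nat n \<longleftrightarrow> finite A \<and> card A = n"
  by (cases "finite A") (auto simp: emeasure_count_space)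

lemma prob_uniform_mark_le:
  assumes "uniform_marks \<Omega> M \<kappa> X U" "0 \<le> u" "u \<le> 1"
  shows "measure \<Omega> {\<omega> \<in> space \<Omega>. U j \<omega> \<le> u} = u"
proof -
  have U: "U j \<in> borel_measurable \<Omega>" "distr \<Omega> borel (U j) = uniform_measure lborel {0..1}"
    using assms by (auto simp: uniform_marks_def)
  have "measure \<Omega> {\<omega> \<in> space \<Omega>. U j \<omega> \<le> u} = measure (distr \<Omega> borel (U j)) {..u}"
    using U(1) by (subst measure_distr) (auto simp: vimage_def Int_def conj_commute)
  also have "\<dots> = u"
    unfolding U(2) using assms by (simp add: Int_atLeastAtMostL2 atLeastAtMost_def[symmetric])
  finally show ?thesis .
qed

text \<open>Given the finite sets of indices of the points lying in each cell, the marks act as independent coin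
  tosses. There are countably many such families of index sets, coded by \<open>set_encode\<close>, so the law of total
  probability replaces conditioning on \<open>(\<kappa>, X)\<close>.\<close>

lemma thinning_counts:
  assumes P: "prob_space \<Omega>" and L: "sets L = sets M" and cB: "cells L \<B>"
    and pr: "proper_representation \<Omega> M \<eta> \<kappa> X" and um: "uniform_marks \<Omega> M \<kappa> X U" and u: "0 \<le> u" "u \<le> 1"
  shows "measure \<Omega> {\<omega> \<in> space \<Omega>. \<forall>B\<in>\<B>. emeasure (\<eta> \<omega>) B = of_nat (n B) \<and> emeasure (thinning M \<kappa> X U u \<omega>) B = of_nat (a B)}
    = measure \<Omega> {\<omega> \<in> space \<Omega>. \<forall>B\<in>\<B>. emeasure (\<eta> \<omega>) B = of_nat (n B)} * (\<Prod>B\<in>\<B>. pmf (binomial_pmf (n B) u) (a B))"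
proof -
  interpret prob_space \<Omega> by fact
  have X: "X j \<omega> \<in> space M" if "\<omega> \<in> space \<Omega>" for j \<omega>
    using pr measurable_space[OF _ that] by (auto simp: proper_representation_def)
  have iv: "indep_vars (\<lambda>_. borel) U UNIV" using um by (simp add: uniform_marks_def)
  have [measurable]: "U j \<in> borel_measurable \<Omega>" for j using um by (simp add: uniform_marks_def)
  have B: "finite \<B>" "disjoint \<B>" "\<And>B. B \<in> \<B> \<Longrightarrow> B \<in> sets M"
    using cB L by (auto simp: cells_def finite_sets_def)
  define I where "I B \<omega> = {j. enat j < \<kappa> \<omega> \<and> X j \<omega> \<in> B}" for B \<omega>
  \<comment> \<open>\<open>set_decode\<close> turns a natural number into a finite set of indices.
    Codes are fixed to 0 off the cells, so distinct members of \<open>K\<close> describe distinct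
    families of index sets and the events \<open>E k\<close> are disjoint.\<close>
  define K where "K = {k :: 'b set \<Rightarrow> nat. (\<forall>B. B \<notin> \<B> \<longrightarrow> k B = 0) \<and> (\<forall>B\<in>\<B>. card (set_decode (k B)) = n B)}"
  have K: "countable K"
    by (rule countable_subset[OF _ countable_finite_support[OF B(1)]]) (auto simp: K_def)
  define E where "E k = {\<omega> \<in> space \<Omega>. \<forall>B\<in>\<B>. I B \<omega> = set_decode (k B)}" for k
  define V where "V k = {\<omega> \<in> space \<Omega>. \<forall>B\<in>\<B>. card {j \<in> set_decode (k B). U j \<omega> \<le> u} = a B}" for k
  define W where "W = (\<Prod>B\<in>\<B>. pmf (binomial_pmf (n B) u) (a B))"
  let ?Z = "\<lambda>\<omega>. (\<kappa> \<omega>, \<lambda>j. X j \<omega>)" and ?U = "\<lambda>\<omega> j. U j \<omega>"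
  let ?MZ = "count_space UNIV \<Otimes>\<^sub>M PiM UNIV (\<lambda>_::nat. M)" and ?MU = "PiM UNIV (\<lambda>_::nat. borel) :: (nat \<Rightarrow> real) measure"
  have ind: "indep_set (sets (vimage_algebra (space \<Omega>) ?Z ?MZ)) (sets (vimage_algebra (space \<Omega>) ?U ?MU))"
    and mZ: "?Z \<in> \<Omega> \<rightarrow>\<^sub>M ?MZ"
    using um by (auto simp: uniform_marks_def independent_rvs_def)
  have Es: "E k \<in> sets (vimage_algebra (space \<Omega>) ?Z ?MZ)" for k
  proof -
    have "{z \<in> space ?MZ. \<forall>B\<in>\<B>. \<forall>j. (enat j < fst z \<and> snd z j \<in> B) \<longleftrightarrow> j \<in> set_decode (k B)} \<in> sets ?MZ"
    proof (intro sets.sets_Collect_finite_All sets.sets_Collect_countable_All B)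
      fix B and j :: nat assume "B \<in> \<B>"
      then have [measurable]: "B \<in> sets M" by (rule B)
      have [measurable]: "(\<lambda>z. snd z j) \<in> ?MZ \<rightarrow>\<^sub>M M" by measurable
      show "{z \<in> space ?MZ. (enat j < fst z \<and> snd z j \<in> B) = (j \<in> set_decode (k B))} \<in> sets ?MZ"
        by measurable
    qed
    from in_vimage_algebra[OF this, of ?Z "space \<Omega>"]
    have "?Z -` {z \<in> space ?MZ. \<forall>B\<in>\<B>. \<forall>j. (enat j < fst z \<and> snd z j \<in> B) \<longleftrightarrow> j \<in> set_decode (k B)} \<inter> space \<Omega>
        \<in> sets (vimage_algebra (space \<Omega>) ?Z ?MZ)" .
    also have "?Z -` {z \<in> space ?MZ. \<forall>B\<in>\<B>. \<forall>j. (enat j < fst z \<and> snd z j \<in> B) \<longleftrightarrow> j \<in> set_decode (k B)} \<inter> space \<Omega> = E k"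
      using measurable_space[OF mZ] by (auto simp: E_def I_def set_eq_iff)
    finally show ?thesis .
  qed
  have Vs: "V k \<in> sets (vimage_algebra (space \<Omega>) ?U ?MU)" for k
  proof -
    have "{v \<in> space ?MU. \<forall>B\<in>\<B>. card {j \<in> set_decode (k B). v j \<le> u} = a B} \<in> sets ?MU"
    proof (intro sets.sets_Collect_finite_All B)
      fix B assume "B \<in> \<B>"
      have "{v \<in> space ?MU. (\<Sum>j\<in>set_decode (k B). indicator {..u} (v j)) = real (a B)} \<in> sets ?MU" by measurable
      moreover have "(\<Sum>j\<in>set_decode (k B). indicator {..u} (v j)) = real (card {j \<in> set_decode (k B). v j \<le> u})" for v :: "nat \<Rightarrow> real"
      proof -
        have "(\<Sum>j\<in>set_decode (k B). indicator {..u} (v j)) = (\<Sum>j\<in>set_decode (k B). if v j \<le> u then 1 else 0 :: real)"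
          by (intro sum.cong) (auto simp: indicator_def)
        then show ?thesis by (simp add: sum.If_cases Int_def)
      qed
      ultimately show "{v \<in> space ?MU. card {j \<in> set_decode (k B). v j \<le> u} = a B} \<in> sets ?MU" by simp
    qed
    from in_vimage_algebra[OF this, of ?U "space \<Omega>"]
    have "?U -` {v \<in> space ?MU. \<forall>B\<in>\<B>. card {j \<in> set_decode (k B). v j \<le> u} = a B} \<inter> space \<Omega>
      \<in> sets (vimage_algebra (space \<Omega>) ?U ?MU)" .
    also have "?U -` {v \<in> space ?MU. \<forall>B\<in>\<B>. card {j \<in> set_decode (k B). v j \<le> u} = a B} \<inter> space \<Omega> = V k"
      by (auto simp: V_def space_PiM)
    finally show ?thesis .
  qed
  have EV: "prob (E k \<inter> V k) = prob (E k) * W" if k: "k \<in> K" for k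
  \<comment> \<open>Disjointness of the coded index sets is inherited from the cells through an
    outcome in \<open>E k\<close>; without such an outcome both sides are 0.\<close>
  proof (cases "E k = {}")
    case False
    then obtain \<omega> where w: "\<omega> \<in> E k" by blast
    have "disjoint_family_on (\<lambda>B. set_decode (k B)) \<B>"
      unfolding disjoint_family_on_def
    proof (intro ballI impI)
      fix B C assume BC: "B \<in> \<B>" "C \<in> \<B>" "B \<noteq> C"
      then have "B \<inter> C = {}" using disjointD[OF B(2)] by blast
      then have "I B \<omega> \<inter> I C \<omega> = {}" by (auto simp: I_def)
      then show "set_decode (k B) \<inter> set_decode (k C) = {}" using w BC by (simp add: E_def)
    qed
    then have "prob (V k) = (\<Prod>B\<in>\<B>. pmf (binomial_pmf (card (set_decode (k B))) u) (a B))"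
      unfolding V_def using prob_uniform_mark_le[OF um u] B(1) by (intro prob_le_counts_binomial[OF iv _ u]) auto
    also have "\<dots> = W" using k by (auto simp: W_def K_def intro!: prod.cong)
    finally show ?thesis using indep_setD[OF ind Es Vs, of k k] by simp
  qed simp
  have ev: "E k \<in> events" "V k \<in> events" for k
    using Es[of k] Vs[of k] indep_setD_ev1[OF ind] indep_setD_ev2[OF ind] by auto
  have disj: "disjoint_family_on E K"
    unfolding disjoint_family_on_def
  proof (intro ballI impI)
    fix k l assume kl: "k \<in> K" "l \<in> K" "k \<noteq> l"
    then obtain B where "k B \<noteq> l B" by blast
    then have "B \<in> \<B>" "set_decode (k B) \<noteq> set_decode (l B)" using kl by (auto simp: K_def, metis set_decode_inverse)
    then show "E k \<inter> E l = {}" by (auto simp: E_def)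
  qed
  then have disj': "disjoint_family_on (\<lambda>k. E k \<inter> V k) K"
    unfolding disjoint_family_on_def by blast
  have mem: "emeasure (\<eta> \<omega>) B = of_nat (n B) \<longleftrightarrow> finite (I B \<omega>) \<and> card (I B \<omega>) = n B" if "\<omega> \<in> space \<Omega>" "B \<in> \<B>" for \<omega> B
  proof -
    have "\<eta> \<omega> = sum_of_points M (\<kappa> \<omega>) (\<lambda>n. X n \<omega>)" using pr that by (simp add: proper_representation_def)
    then show ?thesis
      using X[OF that(1)] B(3)[OF that(2)]
      by (simp add: emeasure_sum_of_points emeasure_count_space_eq_of_nat_iff I_def)
  qed
  have mem': "emeasure (thinning M \<kappa> X U u \<omega>) B = of_nat (a B) \<longleftrightarrow> card {j \<in> set_decode (k B). U j \<omega> \<le> u} = a B"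
    if "\<omega> \<in> E k" "B \<in> \<B>" for \<omega> B k
  proof -
    have "{j \<in> set_decode (k B). U j \<omega> \<le> u} = {j. enat j < \<kappa> \<omega> \<and> U j \<omega> \<le> u \<and> X j \<omega> \<in> B}"
      using that by (auto simp: E_def I_def set_eq_iff)
    moreover have "finite {j \<in> set_decode (k B). U j \<omega> \<le> u}" by simp
    moreover have "\<omega> \<in> space \<Omega>" using that by (simp add: E_def)
    ultimately show ?thesis
      using X B(3)[OF that(2)]
      by (simp add: thinning_def emeasure_thinned_sum_of_points emeasure_count_space_eq_of_nat_iff)
  qed
  have U1: "{\<omega> \<in> space \<Omega>. \<forall>B\<in>\<B>. emeasure (\<eta> \<omega>) B = of_nat (n B)} = (\<Union>k\<in>K. E k)"
  proof (intro set_eqI iffI)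
    fix \<omega> assume w: "\<omega> \<in> {\<omega> \<in> space \<Omega>. \<forall>B\<in>\<B>. emeasure (\<eta> \<omega>) B = of_nat (n B)}"
    then have f: "finite (I B \<omega>)" "card (I B \<omega>) = n B" if "B \<in> \<B>" for B using mem that by auto
    define k where "k B = (if B \<in> \<B> then set_encode (I B \<omega>) else 0)" for B
    have "k \<in> K" using f by (simp add: K_def k_def)
    moreover have "\<omega> \<in> E k" using f w by (simp add: E_def k_def)
    ultimately show "\<omega> \<in> (\<Union>k\<in>K. E k)" by blast
  next
    fix \<omega> assume "\<omega> \<in> (\<Union>k\<in>K. E k)"
    then obtain k where k: "k \<in> K" "\<omega> \<in> E k" by blast
    then have w: "\<omega> \<in> space \<Omega>" by (simp add: E_def)
    have "emeasure (\<eta> \<omega>) B = of_nat (n B)" if "B \<in> \<B>" for B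
      using k that by (simp add: mem[OF w that] E_def K_def)
    then show "\<omega> \<in> {\<omega> \<in> space \<Omega>. \<forall>B\<in>\<B>. emeasure (\<eta> \<omega>) B = of_nat (n B)}" using w by simp
  qed
  have memV: "\<omega> \<in> V k \<longleftrightarrow> (\<forall>B\<in>\<B>. emeasure (thinning M \<kappa> X U u \<omega>) B = of_nat (a B))" if "\<omega> \<in> E k" for \<omega> k
  proof -
    have "\<omega> \<in> space \<Omega>" using that by (simp add: E_def)
    then show ?thesis unfolding V_def using mem'[OF that] by simp
  qed
  have "\<omega> \<in> (\<Union>k\<in>K. E k \<inter> V k) \<longleftrightarrow> \<omega> \<in> (\<Union>k\<in>K. E k) \<and> (\<forall>B\<in>\<B>. emeasure (thinning M \<kappa> X U u \<omega>) B = of_nat (a B))" for \<omega>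
    using memV by blast
  then have U2: "{\<omega> \<in> space \<Omega>. \<forall>B\<in>\<B>. emeasure (\<eta> \<omega>) B = of_nat (n B) \<and> emeasure (thinning M \<kappa> X U u \<omega>) B = of_nat (a B)}
      = (\<Union>k\<in>K. E k \<inter> V k)"
    unfolding U1[symmetric] by blast
  have "W \<ge> 0" by (simp add: W_def prod_nonneg)
  \<comment> \<open>Law of total probability: the conditional weight \<open>W\<close> is the same
    for every code, so it factors out of the series.\<close>
  have "emeasure \<Omega> (\<Union>k\<in>K. E k \<inter> V k) = (\<integral>\<^sup>+k. emeasure \<Omega> (E k \<inter> V k) \<partial>count_space K)"
    using ev K disj' by (intro emeasure_UN_countable) auto
  also have "\<dots> = (\<integral>\<^sup>+k. emeasure \<Omega> (E k) * ennreal W \<partial>count_space K)"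
    using EV \<open>W \<ge> 0\<close> by (intro nn_integral_cong) (simp add: emeasure_eq_measure ennreal_mult)
  also have "\<dots> = emeasure \<Omega> (\<Union>k\<in>K. E k) * ennreal W"
    using ev K disj by (simp add: nn_integral_multc emeasure_UN_countable)
  finally show ?thesis
    unfolding U1 U2 W_def[symmetric] using \<open>W \<ge> 0\<close> by (simp add: emeasure_eq_measure ennreal_mult'[symmetric])
qed

section \<open>The joint law of the counts of \<eta> and \<zeta>\<close>

lemma poisson_coupling_marginals:
  assumes "0 \<le> u" "u \<le> 1" "0 \<le> c"
  shows "map_pmf fst (poisson_coupling u c) = poi c" "map_pmf snd (poisson_coupling u c) = poi c"
proof -
  let ?a = "poi (u * c)" and ?b = "poi ((1 - u) * c)"
  have add: "map_pmf (\<lambda>(x, y). x + y) (pair_pmf ?a ?b) = poi c"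
    using assms poi_add[of "u * c" "(1 - u) * c"] by (simp add: distrib_right[symmetric])
  have "map_pmf fst (poisson_coupling u c) = map_pmf (\<lambda>(x, y). x + y) (pair_pmf ?a (map_pmf fst (pair_pmf ?b ?b)))"
    unfolding poisson_coupling_def pair_map_pmf2 pmf.map_comp by (simp add: o_def case_prod_unfold)
  then show "map_pmf fst (poisson_coupling u c) = poi c" using add by (simp add: map_fst_pair_pmf)
  have "map_pmf snd (poisson_coupling u c) = map_pmf (\<lambda>(x, y). x + y) (pair_pmf ?a (map_pmf snd (pair_pmf ?b ?b)))"
    unfolding poisson_coupling_def pair_map_pmf2 pmf.map_comp by (simp add: o_def case_prod_unfold)
  then show "map_pmf snd (poisson_coupling u c) = poi c" using add by (simp add: map_snd_pair_pmf)
qed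

text \<open>A binomial selection from a Poisson number of points leaves independent Poisson numbers
  of selected and rejected points.\<close>

lemma pmf_poi_thinning:
  assumes "0 \<le> u" "u \<le> 1" "0 \<le> c"
  shows "pmf (poi c) (a + b) * pmf (binomial_pmf (a + b) u) a = pmf (poi (u * c)) a * pmf (poi ((1 - u) * c)) b"
proof -
  have "exp (- c) = exp (- (u * c)) * exp (- ((1 - u) * c))"
    by (simp add: exp_add[symmetric] algebra_simps)
  moreover have "real ((a + b) choose a) = fact (a + b) / (fact a * fact b)"
    by (simp add: binomial_fact)
  ultimately show ?thesis
    using assms by (simp add: pmf_poi power_mult_distrib power_add)
qed

lemma finite_sets_scale_measure: "finite_sets L \<subseteq> finite_sets (scale_measure (ennreal r) L)"
  by (auto simp: finite_sets_def ennreal_mult_eq_top_iff)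

lemma cells_scale_measure: "cells L \<B> \<Longrightarrow> cells (scale_measure (ennreal r) L) \<B>"
  using finite_sets_scale_measure unfolding cells_def by blast

text \<open>The processes of the theorem at one fixed time, with \<open>u\<close> for
  \<open>exp (- t)\<close>. The functional and the exponent stay outside, since truncated and
  auxiliary functionals are studied in the same setting.\<close>

locale poisson_thinning =
  fixes \<Omega> :: "'w measure" and M L :: "'a measure"
    and \<eta> \<eta>' :: "'w \<Rightarrow> 'a measure" and \<kappa> :: "'w \<Rightarrow> enat"
    and X :: "nat \<Rightarrow> 'w \<Rightarrow> 'a" and U :: "nat \<Rightarrow> 'w \<Rightarrow> real" and u :: real
  assumes P: "prob_space \<Omega>"
    and L: "sets L = sets M" and sf: "sigma_finite_measure L"
    and pp: "poisson_process \<Omega> M L \<eta>"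
    and pr: "proper_representation \<Omega> M \<eta> \<kappa> X"
    and um: "uniform_marks \<Omega> M \<kappa> X U"
    and u: "0 < u" "u \<le> 1"
    and pp': "poisson_process \<Omega> M (scale_measure (ennreal (1 - u)) L) \<eta>'"
    and ind: "independent_rvs \<Omega>
           (point_measure_algebra M \<Otimes>\<^sub>M point_measure_algebra M)
           (\<lambda>\<omega>. (\<eta> \<omega>, thinning M \<kappa> X U u \<omega>))
           (point_measure_algebra M) \<eta>'"
begin

sublocale prob_space \<Omega> by (rule P)

text \<open>From here on \<theta> is the process of retained points and no longer a small Poisson
  mean.\<close>

definition "\<theta> = thinning M \<kappa> X U u"

definition "\<zeta> = (\<lambda>\<omega>. measure_add M (\<theta> \<omega>) (\<eta>' \<omega>))"

lemma measurable_\<eta> [measurable]: "\<eta> \<in> \<Omega> \<rightarrow>\<^sub>M point_measure_algebra M"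
  and measurable_\<eta>' [measurable]: "\<eta>' \<in> \<Omega> \<rightarrow>\<^sub>M point_measure_algebra M"
  using pp pp' by (auto simp: poisson_process_def)

lemma measurable_\<theta> [measurable]: "\<theta> \<in> \<Omega> \<rightarrow>\<^sub>M point_measure_algebra M"
proof -
  have "(\<lambda>\<omega>. (\<eta> \<omega>, \<theta> \<omega>)) \<in> \<Omega> \<rightarrow>\<^sub>M point_measure_algebra M \<Otimes>\<^sub>M point_measure_algebra M"
    using ind by (simp add: independent_rvs_def \<theta>_def)
  from measurable_compose[OF this measurable_snd] show ?thesis by simp
qed

lemma measurable_\<zeta> [measurable]: "\<zeta> \<in> \<Omega> \<rightarrow>\<^sub>M point_measure_algebra M"
  unfolding \<zeta>_def by measurable

lemma point_measures_processes:
  assumes "\<omega> \<in> space \<Omega>"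
  shows "\<eta> \<omega> \<in> point_measures M" "\<eta>' \<omega> \<in> point_measures M" "\<theta> \<omega> \<in> point_measures M" "\<zeta> \<omega> \<in> point_measures M"
  using measurable_space[OF measurable_\<eta> assms] measurable_space[OF measurable_\<eta>' assms]
    measurable_space[OF measurable_\<theta> assms] measurable_space[OF measurable_\<zeta> assms] by auto

text \<open>Transfers almost sure finiteness from \<eta> to \<theta>, and makes the natural-number
  difference of their counts a true difference.\<close>

lemma thinning_le:
  assumes "\<omega> \<in> space \<Omega>" "B \<in> sets M"
  shows "emeasure (\<theta> \<omega>) B \<le> emeasure (\<eta> \<omega>) B"
proof -
  have X: "X j \<omega> \<in> space M" for j
    using pr measurable_space[OF _ assms(1)] by (auto simp: proper_representation_def)
  have "\<eta> \<omega> = sum_of_points M (\<kappa> \<omega>) (\<lambda>n. X n \<omega>)" using pr assms by (simp add: proper_representation_def)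
  then show ?thesis
    unfolding \<theta>_def thinning_def using X assms(2)
    by (auto simp: emeasure_thinned_sum_of_points emeasure_sum_of_points intro!: emeasure_mono)
qed

lemma AE_finite:
  assumes "C \<in> finite_sets L"
  shows "AE \<omega> in \<Omega>. emeasure (\<eta> \<omega>) C \<noteq> \<infinity> \<and> emeasure (\<eta>' \<omega>) C \<noteq> \<infinity> \<and> emeasure (\<theta> \<omega>) C \<noteq> \<infinity>"
proof -
  have C: "C \<in> sets M" using assms L by (simp add: finite_sets_def)
  have "AE \<omega> in \<Omega>. emeasure (\<eta> \<omega>) C \<noteq> \<infinity>" by (rule poisson_process_AE_finite[OF P pp L assms])
  moreover have "AE \<omega> in \<Omega>. emeasure (\<eta>' \<omega>) C \<noteq> \<infinity>"
    using finite_sets_scale_measure[of L "1 - u"] assms L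
    by (intro poisson_process_AE_finite[OF P pp']) auto
  ultimately show ?thesis using AE_space
  proof eventually_elim
    case (elim \<omega>)
    then show ?case using thinning_le[OF elim(3) C] by (auto simp: top_unique)
  qed
qed

abbreviation "triple c \<equiv> pair_pmf (poi (u * c)) (pair_pmf (poi ((1 - u) * c)) (poi ((1 - u) * c)))"

text \<open>This carries the problem from the probability space to an explicit discrete law. In
  every cell the numbers of retained, deleted and new points are independent Poisson variables, and
  different cells are independent; both counts are sums of these numbers.\<close>

lemma nn_integral_cell_counts:
  fixes H :: "('a set \<Rightarrow> nat) \<times> ('a set \<Rightarrow> nat) \<Rightarrow> ennreal"
  assumes cB: "cells L \<B>"
  shows "(\<integral>\<^sup>+\<omega>. H (cell_counts \<B> (\<eta> \<omega>), cell_counts \<B> (\<zeta> \<omega>)) \<partial>\<Omega>)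
    = (\<integral>\<^sup>+z. H z \<partial>map_pmf (\<lambda>h. (\<lambda>B. fst (h B), \<lambda>B. snd (h B))) (Pi_pmf \<B> (0, 0) (\<lambda>B. poisson_coupling u (measure L B))))"
proof -
  have B: "finite \<B>" "\<B> \<subseteq> finite_sets L" "\<B> \<subseteq> sets M"
    using cB L by (auto simp: cells_def finite_sets_def)
  \<comment> \<open>Retained, deleted and new points per cell. The triple is used instead of the
    pair of counts because its law is a product, so it can be compared point by point with
    \<open>Pi_pmf\<close>.\<close>
  define T where "T \<omega> = (\<lambda>B. if B \<in> \<B> then (cell_counts \<B> (\<theta> \<omega>) B, cell_counts \<B> (\<eta> \<omega>) B - cell_counts \<B> (\<theta> \<omega>) B,
      cell_counts \<B> (\<eta>' \<omega>) B) else (0, 0, 0))" for \<omega>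
  define Q where "Q = Pi_pmf \<B> (0, 0, 0) (\<lambda>B. triple (measure L B))"
  let ?S = "{h :: 'a set \<Rightarrow> nat \<times> nat \<times> nat. \<forall>B. B \<notin> \<B> \<longrightarrow> h B = (0, 0, 0)}"
  have S: "countable ?S" by (rule countable_finite_support[OF B(1)])
  have fin: "AE \<omega> in \<Omega>. \<omega> \<in> space \<Omega> \<and> (\<forall>B\<in>\<B>. emeasure (\<eta> \<omega>) B \<noteq> \<infinity> \<and> emeasure (\<eta>' \<omega>) B \<noteq> \<infinity> \<and> emeasure (\<theta> \<omega>) B \<noteq> \<infinity>)"
    using AE_finite B by (auto intro!: AE_finite_allI AE_conjI)
  have cnt: "emeasure \<mu> B = of_nat (cell_counts \<B> \<mu> B)" if mu: "\<mu> \<in> point_measures M" "B \<in> \<B>" "emeasure \<mu> B \<noteq> \<infinity>" for \<mu> B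
  proof -
    have "B \<in> sets M" using mu B(3) by auto
    then obtain k :: nat where "emeasure \<mu> B = of_nat k"
      using emeasure_point_measure_cases[OF mu(1), of B] mu(3) by auto
    then show ?thesis using mu(2) by (simp add: cell_counts_def)
  qed
  have [measurable]: "(\<lambda>\<omega>. cell_counts \<B> (f \<omega>)) \<in> \<Omega> \<rightarrow>\<^sub>M count_space UNIV"
    if "f \<in> \<Omega> \<rightarrow>\<^sub>M point_measure_algebra M" for f
    using measurable_cell_counts[OF that B(1,3)] .
  have T_eq: "T \<omega> = h \<longleftrightarrow> (\<forall>B\<in>\<B>. cell_counts \<B> (\<theta> \<omega>) B = fst (h B)
       \<and> cell_counts \<B> (\<eta> \<omega>) B - cell_counts \<B> (\<theta> \<omega>) B = fst (snd (h B)) \<and> cell_counts \<B> (\<eta>' \<omega>) B = snd (snd (h B)))"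
    if h: "h \<in> ?S" for \<omega> h
  proof -
    have "T \<omega> B = h B" if "B \<notin> \<B>" for B using that h by (simp add: T_def)
    then have "T \<omega> = h \<longleftrightarrow> (\<forall>B\<in>\<B>. T \<omega> B = h B)" unfolding fun_eq_iff by blast
    also have "\<dots> \<longleftrightarrow> (\<forall>B\<in>\<B>. cell_counts \<B> (\<theta> \<omega>) B = fst (h B)
       \<and> cell_counts \<B> (\<eta> \<omega>) B - cell_counts \<B> (\<theta> \<omega>) B = fst (snd (h B)) \<and> cell_counts \<B> (\<eta>' \<omega>) B = snd (snd (h B)))"
      by (intro ball_cong refl) (simp add: T_def prod_eq_iff)
    finally show ?thesis .
  qed
  have mT: "T \<in> \<Omega> \<rightarrow>\<^sub>M count_space UNIV"
  proof (rule measurable_count_space_UNIV_countable[OF S])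
    fix h assume h: "h \<in> ?S"
    have "T -` {h} \<inter> space \<Omega> = {\<omega> \<in> space \<Omega>. \<forall>B\<in>\<B>. cell_counts \<B> (\<theta> \<omega>) B = fst (h B)
       \<and> cell_counts \<B> (\<eta> \<omega>) B - cell_counts \<B> (\<theta> \<omega>) B = fst (snd (h B)) \<and> cell_counts \<B> (\<eta>' \<omega>) B = snd (snd (h B))}"
      using T_eq[OF h] by blast
    also have "\<dots> \<in> events"
    proof (rule sets.sets_Collect_finite_All)
      fix B
      have [measurable]: "(\<lambda>\<omega>. cell_counts \<B> (f \<omega>) B) \<in> \<Omega> \<rightarrow>\<^sub>M count_space UNIV"
        if [measurable]: "f \<in> \<Omega> \<rightarrow>\<^sub>M point_measure_algebra M" for f
        by (rule measurable_compose[of "\<lambda>\<omega>. cell_counts \<B> (f \<omega>)" _ "count_space UNIV" "\<lambda>n. n B"]) measurable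
      show "{\<omega> \<in> space \<Omega>. cell_counts \<B> (\<theta> \<omega>) B = fst (h B)
       \<and> cell_counts \<B> (\<eta> \<omega>) B - cell_counts \<B> (\<theta> \<omega>) B = fst (snd (h B)) \<and> cell_counts \<B> (\<eta>' \<omega>) B = snd (snd (h B))} \<in> events"
        by measurable
    qed (rule B)
    finally show "T -` {h} \<inter> space \<Omega> \<in> events" .
  qed (auto simp: T_def)
  have law: "distr \<Omega> (count_space UNIV) T = measure_pmf Q"
  proof (rule measure_eqI_countable_AE[where \<Omega> = ?S])
    show "AE h in distr \<Omega> (count_space UNIV) T. h \<in> ?S" using mT by (auto simp: AE_distr_iff T_def)
    show "AE h in Q. h \<in> ?S" unfolding Q_def using set_Pi_pmf_subset[OF B(1), of "(0, 0, 0)"] by (auto simp: AE_measure_pmf_iff)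
    fix h assume h: "h \<in> ?S"
    define a b d where "a B = fst (h B)" and "b B = fst (snd (h B))" and "d B = snd (snd (h B))" for B
    let ?E1 = "{\<omega> \<in> space \<Omega>. \<forall>B\<in>\<B>. emeasure (\<eta> \<omega>) B = of_nat (a B + b B) \<and> emeasure (\<theta> \<omega>) B = of_nat (a B)}"
    let ?E2 = "{\<omega> \<in> space \<Omega>. \<forall>B\<in>\<B>. emeasure (\<eta>' \<omega>) B = of_nat (d B)}"
    let ?N = "point_measure_algebra M"
    have meas: "{\<mu> \<in> space ?N. emeasure \<mu> B = of_nat k} \<in> sets ?N" if "B \<in> \<B>" for B and k :: nat
    proof -
      have [measurable]: "B \<in> sets M" using that B by auto
      show ?thesis by measurable
    qed
    have "{\<mu> \<in> space ?N. \<forall>B\<in>\<B>. emeasure \<mu> B = of_nat (d B)} \<in> sets ?N"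
      using meas B by (intro sets.sets_Collect_finite_All) auto
    from in_vimage_algebra[OF this, of \<eta>' "space \<Omega>"]
    have E2: "?E2 \<in> sets (vimage_algebra (space \<Omega>) \<eta>' ?N)"
      by (rule back_subst[where P="\<lambda>A. A \<in> _"]) (use point_measures_processes in auto)
    have "{z \<in> space (?N \<Otimes>\<^sub>M ?N). \<forall>B\<in>\<B>. emeasure (fst z) B = of_nat (a B + b B) \<and> emeasure (snd z) B = of_nat (a B)} \<in> sets (?N \<Otimes>\<^sub>M ?N)"
    proof (rule sets.sets_Collect_finite_All)
      fix B assume "B \<in> \<B>"
      then have [measurable]: "B \<in> sets M" using B by auto
      show "{z \<in> space (?N \<Otimes>\<^sub>M ?N). emeasure (fst z) B = of_nat (a B + b B) \<and> emeasure (snd z) B = of_nat (a B)} \<in> sets (?N \<Otimes>\<^sub>M ?N)"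
        by measurable
    qed (rule B)
    from in_vimage_algebra[OF this, of "\<lambda>\<omega>. (\<eta> \<omega>, \<theta> \<omega>)" "space \<Omega>"]
    have E1: "?E1 \<in> sets (vimage_algebra (space \<Omega>) (\<lambda>\<omega>. (\<eta> \<omega>, \<theta> \<omega>)) (?N \<Otimes>\<^sub>M ?N))"
      by (rule back_subst[where P="\<lambda>A. A \<in> _"]) (use point_measures_processes in \<open>auto simp: space_pair_measure\<close>)
    have ids: "indep_set (sets (vimage_algebra (space \<Omega>) (\<lambda>\<omega>. (\<eta> \<omega>, \<theta> \<omega>)) (?N \<Otimes>\<^sub>M ?N))) (sets (vimage_algebra (space \<Omega>) \<eta>' ?N))"
      using ind by (simp add: independent_rvs_def \<theta>_def)
    have ev: "?E1 \<in> events" "?E2 \<in> events" using E1 E2 indep_setD_ev1[OF ids] indep_setD_ev2[OF ids] by auto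
    have "emeasure (distr \<Omega> (count_space UNIV) T) {h} = emeasure \<Omega> (T -` {h} \<inter> space \<Omega>)"
      by (rule emeasure_distr[OF mT]) simp
    also have "\<dots> = emeasure \<Omega> (?E1 \<inter> ?E2)"
    proof (rule emeasure_eq_AE)
      show "AE \<omega> in \<Omega>. \<omega> \<in> T -` {h} \<inter> space \<Omega> \<longleftrightarrow> \<omega> \<in> ?E1 \<inter> ?E2"
        using fin
      proof eventually_elim
        case (elim \<omega>)
        then have w: "\<omega> \<in> space \<Omega>" by simp
        note pm = point_measures_processes[OF w]
        have c: "emeasure (\<eta> \<omega>) B = of_nat (cell_counts \<B> (\<eta> \<omega>) B)" "emeasure (\<eta>' \<omega>) B = of_nat (cell_counts \<B> (\<eta>' \<omega>) B)"
          "emeasure (\<theta> \<omega>) B = of_nat (cell_counts \<B> (\<theta> \<omega>) B)" if "B \<in> \<B>" for B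
          using cnt pm that elim by auto
        have le: "cell_counts \<B> (\<theta> \<omega>) B \<le> cell_counts \<B> (\<eta> \<omega>) B" if "B \<in> \<B>" for B
          using thinning_le[OF w, of B] c[OF that] that B by auto
        have "T \<omega> = h \<longleftrightarrow> (\<forall>B\<in>\<B>. cell_counts \<B> (\<theta> \<omega>) B = a B \<and> cell_counts \<B> (\<eta> \<omega>) B - cell_counts \<B> (\<theta> \<omega>) B = b B \<and> cell_counts \<B> (\<eta>' \<omega>) B = d B)"
          using T_eq[OF h] by (simp add: a_def b_def d_def)
        \<comment> \<open>Subtraction on the naturals is inverted here, which is legitimate because
          the retained points are at most as many as all points.\<close>
        also have "\<dots> \<longleftrightarrow> (\<forall>B\<in>\<B>. (cell_counts \<B> (\<eta> \<omega>) B = a B + b B \<and> cell_counts \<B> (\<theta> \<omega>) B = a B) \<and> cell_counts \<B> (\<eta>' \<omega>) B = d B)"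
          using le by (intro ball_cong refl) force
        also have "\<dots> \<longleftrightarrow> \<omega> \<in> ?E1 \<inter> ?E2"
          using w c by (auto simp del: of_nat_add)
        finally show ?case using w by simp
      qed
    qed (use mT ev in \<open>auto intro: measurable_sets\<close>)
    also have "\<dots> = ennreal (prob ?E1 * prob ?E2)"
      using indep_setD[OF ids E1 E2] by (simp add: emeasure_eq_measure)
    also have "prob ?E1 = (\<Prod>B\<in>\<B>. pmf (poi (measure L B)) (a B + b B)) * (\<Prod>B\<in>\<B>. pmf (binomial_pmf (a B + b B) u) (a B))"
      unfolding \<theta>_def using thinning_counts[OF P L cB pr um, of u "\<lambda>B. a B + b B" a] u
        poisson_process_counts[OF P pp L cB, of "\<lambda>B. a B + b B"] by simp
    also have "prob ?E2 = (\<Prod>B\<in>\<B>. pmf (poi ((1 - u) * measure L B)) (d B))"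
      using poisson_process_counts[OF P pp' _ cells_scale_measure[OF cB], of d] L u by (simp add: measure_scale_measure)
    also have "(\<Prod>B\<in>\<B>. pmf (poi (measure L B)) (a B + b B)) * (\<Prod>B\<in>\<B>. pmf (binomial_pmf (a B + b B) u) (a B))
        * (\<Prod>B\<in>\<B>. pmf (poi ((1 - u) * measure L B)) (d B)) = (\<Prod>B\<in>\<B>. pmf (triple (measure L B)) (h B))"
      unfolding prod.distrib[symmetric]
    proof (intro prod.cong refl)
      fix B
      have "h B = (a B, b B, d B)" by (simp add: a_def b_def d_def)
      then show "pmf (poi (measure L B)) (a B + b B) * pmf (binomial_pmf (a B + b B) u) (a B) * pmf (poi ((1 - u) * measure L B)) (d B)
          = pmf (triple (measure L B)) (h B)"
        using u by (simp add: pmf_pair pmf_poi_thinning del: pmf_binomial)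
    qed
    also have "\<dots> = pmf Q h" unfolding Q_def using h by (intro pmf_Pi'[symmetric] B) auto
    finally show "emeasure (distr \<Omega> (count_space UNIV) T) {h} = emeasure (measure_pmf Q) {h}"
      by (simp add: emeasure_pmf_single)
  qed (use S in auto)
  define G where "G h = ((\<lambda>B. fst (h B) + fst (snd (h B))), (\<lambda>B. fst (h B) + snd (snd (h B))))" for h :: "'a set \<Rightarrow> nat \<times> nat \<times> nat"
  have "(\<integral>\<^sup>+\<omega>. H (cell_counts \<B> (\<eta> \<omega>), cell_counts \<B> (\<zeta> \<omega>)) \<partial>\<Omega>) = (\<integral>\<^sup>+\<omega>. H (G (T \<omega>)) \<partial>\<Omega>)"
  proof (rule nn_integral_cong_AE)
    show "AE \<omega> in \<Omega>. H (cell_counts \<B> (\<eta> \<omega>), cell_counts \<B> (\<zeta> \<omega>)) = H (G (T \<omega>))"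
      using fin
    proof eventually_elim
      case (elim \<omega>)
      then have w: "\<omega> \<in> space \<Omega>" by simp
      note pm = point_measures_processes[OF w]
      have "cell_counts \<B> (\<eta> \<omega>) B = cell_counts \<B> (\<theta> \<omega>) B + (cell_counts \<B> (\<eta> \<omega>) B - cell_counts \<B> (\<theta> \<omega>) B)
          \<and> cell_counts \<B> (\<zeta> \<omega>) B = cell_counts \<B> (\<theta> \<omega>) B + cell_counts \<B> (\<eta>' \<omega>) B" if BB: "B \<in> \<B>" for B
      proof -
        have c: "emeasure (\<eta> \<omega>) B = of_nat (cell_counts \<B> (\<eta> \<omega>) B)" "emeasure (\<eta>' \<omega>) B = of_nat (cell_counts \<B> (\<eta>' \<omega>) B)"
          "emeasure (\<theta> \<omega>) B = of_nat (cell_counts \<B> (\<theta> \<omega>) B)"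
          using cnt pm that elim by auto
        have "emeasure (\<zeta> \<omega>) B = of_nat (cell_counts \<B> (\<theta> \<omega>) B + cell_counts \<B> (\<eta>' \<omega>) B)"
          unfolding \<zeta>_def using pm BB B by (simp add: emeasure_measure_add_point_measures subset_iff c)
        then have "cell_counts \<B> (\<zeta> \<omega>) B = cell_counts \<B> (\<theta> \<omega>) B + cell_counts \<B> (\<eta>' \<omega>) B"
          using BB unfolding cell_counts_def[of \<B> "\<zeta> \<omega>"] by (simp del: of_nat_add)
        moreover have "cell_counts \<B> (\<theta> \<omega>) B \<le> cell_counts \<B> (\<eta> \<omega>) B"
          using thinning_le[OF w, of B] c BB B by auto
        ultimately show ?thesis by simp
      qed
      then have "G (T \<omega>) = (cell_counts \<B> (\<eta> \<omega>), cell_counts \<B> (\<zeta> \<omega>))"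
        by (auto simp: G_def T_def fun_eq_iff) (auto simp: cell_counts_def)
      then show ?case by simp
    qed
  qed
  also have "\<dots> = (\<integral>\<^sup>+h. H (G h) \<partial>distr \<Omega> (count_space UNIV) T)"
    using mT by (simp add: nn_integral_distr)
  also have "\<dots> = (\<integral>\<^sup>+z. H z \<partial>map_pmf G Q)" unfolding law by simp
  also have "map_pmf G Q = map_pmf (\<lambda>h. (\<lambda>B. fst (h B), \<lambda>B. snd (h B))) (Pi_pmf \<B> (0, 0) (\<lambda>B. poisson_coupling u (measure L B)))"
    unfolding poisson_coupling_def Q_def
    by (subst Pi_pmf_map[where dflt="(0, 0, 0)"]) (use B(1) in \<open>auto simp: pmf.map_comp o_def G_def[abs_def] case_prod_unfold\<close>)
  finally show ?thesis .
qed

lemma nn_integral_cell_counts_marginal: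
  assumes cB: "cells L \<B>"
  shows "(\<integral>\<^sup>+\<omega>. H (cell_counts \<B> (\<eta> \<omega>)) \<partial>\<Omega>) = (\<integral>\<^sup>+n. H n \<partial>Pi_pmf \<B> 0 (\<lambda>B. poi (measure L B)))"
    and "(\<integral>\<^sup>+\<omega>. H (cell_counts \<B> (\<zeta> \<omega>)) \<partial>\<Omega>) = (\<integral>\<^sup>+n. H n \<partial>Pi_pmf \<B> 0 (\<lambda>B. poi (measure L B)))"
proof -
  have B: "finite \<B>" using cB by (simp add: cells_def)
  have *: "Pi_pmf \<B> 0 (\<lambda>B. poi (measure L B)) = map_pmf (\<lambda>h B. fst (h B)) (Pi_pmf \<B> (0, 0) (\<lambda>B. poisson_coupling u (measure L B)))"
    "Pi_pmf \<B> 0 (\<lambda>B. poi (measure L B)) = map_pmf (\<lambda>h B. snd (h B)) (Pi_pmf \<B> (0, 0) (\<lambda>B. poisson_coupling u (measure L B)))"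
    using Pi_pmf_map[OF B, of fst "(0, 0)" "0::nat" "\<lambda>B. poisson_coupling u (measure L B)"]
      Pi_pmf_map[OF B, of snd "(0, 0)" "0::nat" "\<lambda>B. poisson_coupling u (measure L B)"] u
    by (simp_all add: poisson_coupling_marginals o_def)
  show "(\<integral>\<^sup>+\<omega>. H (cell_counts \<B> (\<eta> \<omega>)) \<partial>\<Omega>) = (\<integral>\<^sup>+n. H n \<partial>Pi_pmf \<B> 0 (\<lambda>B. poi (measure L B)))"
    using nn_integral_cell_counts[OF cB, of "\<lambda>z. H (fst z)"] unfolding *(1) by simp
  show "(\<integral>\<^sup>+\<omega>. H (cell_counts \<B> (\<zeta> \<omega>)) \<partial>\<Omega>) = (\<integral>\<^sup>+n. H n \<partial>Pi_pmf \<B> 0 (\<lambda>B. poi (measure L B)))"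
    using nn_integral_cell_counts[OF cB, of "\<lambda>z. H (snd z)"] unfolding *(2) by simp
qed

lemma AE_finite_\<zeta>:
  assumes "C \<in> finite_sets L"
  shows "AE \<omega> in \<Omega>. emeasure (\<zeta> \<omega>) C \<noteq> \<infinity>"
proof -
  have C: "C \<in> sets M" using assms L by (simp add: finite_sets_def)
  show ?thesis
    using AE_finite[OF assms] AE_space
    by eventually_elim (use C in \<open>auto simp: \<zeta>_def emeasure_measure_add_point_measures point_measures_processes\<close>)
qed

text \<open>The stationarity of the semigroup: both marginals of the coupling are the same Poisson
  product law for every family of cells, and these families determine the law. It lets estimates for
  \<open>F (\<eta> \<omega>)\<close> be used for \<open>F (\<zeta> \<omega>)\<close>.\<close>

lemma distr_\<zeta>: "distr \<Omega> (point_measure_algebra M) \<zeta> = distr \<Omega> (point_measure_algebra M) \<eta>"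
proof (rule point_measure_law_eqI[OF _ _ _ sf L])
  let ?N = "point_measure_algebra M"
  show "finite {}" "{} \<subseteq> finite_sets L" by auto
  show "finite_measure (distr \<Omega> ?N \<zeta>)" by (rule finite_measure_distr) measurable
  have m: "{\<mu> \<in> space ?N. emeasure \<mu> C \<noteq> \<infinity>} \<in> sets ?N" if "C \<in> finite_sets L" for C
  proof -
    have [measurable]: "C \<in> sets M" using that L by (simp add: finite_sets_def)
    show ?thesis by measurable
  qed
  fix C assume C: "C \<in> finite_sets L"
  show "AE \<mu> in distr \<Omega> ?N \<zeta>. emeasure \<mu> C \<noteq> \<infinity>"
    by (subst AE_distr_iff[OF measurable_\<zeta> m[OF C]]) (rule AE_finite_\<zeta>[OF C])
  show "AE \<mu> in distr \<Omega> ?N \<eta>. emeasure \<mu> C \<noteq> \<infinity>"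
    by (subst AE_distr_iff[OF measurable_\<eta> m[OF C]]) (use AE_finite[OF C] in auto)
next
  fix \<B> and n :: "'a set \<Rightarrow> nat" assume cB: "cells L \<B>"
  let ?N = "point_measure_algebra M"
  have B: "finite \<B>" "\<B> \<subseteq> finite_sets L" "\<B> \<subseteq> sets M"
    using cB L by (auto simp: cells_def finite_sets_def)
  define n' where "n' B = (if B \<in> \<B> then n B else 0)" for B
  have *: "emeasure (distr \<Omega> ?N f) {\<mu> \<in> point_measures M. \<forall>B\<in>\<B>. emeasure \<mu> B = of_nat (n B)}
      = (\<integral>\<^sup>+\<omega>. indicator {n'} (cell_counts \<B> (f \<omega>)) \<partial>\<Omega>)"
    if f: "f \<in> \<Omega> \<rightarrow>\<^sub>M ?N" and fin: "\<And>C. C \<in> finite_sets L \<Longrightarrow> AE \<omega> in \<Omega>. emeasure (f \<omega>) C \<noteq> \<infinity>" for f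
  proof -
    have "{\<mu> \<in> space ?N. \<forall>B\<in>\<B>. emeasure \<mu> B = of_nat (n B)} \<in> sets ?N"
      using B by (intro sets.sets_Collect_finite_All) (auto simp: sets_point_measure_algebra)
    then have E: "{\<mu> \<in> point_measures M. \<forall>B\<in>\<B>. emeasure \<mu> B = of_nat (n B)} \<in> sets ?N" by simp
    have "emeasure (distr \<Omega> ?N f) {\<mu> \<in> point_measures M. \<forall>B\<in>\<B>. emeasure \<mu> B = of_nat (n B)}
        = (\<integral>\<^sup>+\<omega>. indicator {\<mu> \<in> point_measures M. \<forall>B\<in>\<B>. emeasure \<mu> B = of_nat (n B)} (f \<omega>) \<partial>\<Omega>)"
      using E f by (simp add: nn_integral_indicator[symmetric] nn_integral_distr del: nn_integral_indicator)
    also have "\<dots> = (\<integral>\<^sup>+\<omega>. indicator {n'} (cell_counts \<B> (f \<omega>)) \<partial>\<Omega>)"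
    proof (rule nn_integral_cong_AE)
      have "AE \<omega> in \<Omega>. \<forall>B\<in>\<B>. emeasure (f \<omega>) B \<noteq> \<infinity>" using fin B by (auto intro!: AE_finite_allI)
      then show "AE \<omega> in \<Omega>. indicator {\<mu> \<in> point_measures M. \<forall>B\<in>\<B>. emeasure \<mu> B = of_nat (n B)} (f \<omega>)
          = (indicator {n'} (cell_counts \<B> (f \<omega>)) :: ennreal)"
        using AE_space
      proof eventually_elim
        case (elim \<omega>)
        have fM: "f \<omega> \<in> point_measures M" using measurable_space[OF f elim(2)] by simp
        have "cell_counts \<B> (f \<omega>) = n' \<longleftrightarrow> (\<forall>B\<in>\<B>. emeasure (f \<omega>) B = of_nat (n' B))"
          using elim by (intro cell_counts_eq_iff[OF fM B(3)]) (auto simp: n'_def)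
        also have "\<dots> \<longleftrightarrow> (\<forall>B\<in>\<B>. emeasure (f \<omega>) B = of_nat (n B))" by (simp add: n'_def)
        finally show ?case using fM by (simp add: indicator_def)
      qed
    qed
    finally show ?thesis .
  qed
  have "emeasure (distr \<Omega> ?N \<zeta>) {\<mu> \<in> point_measures M. \<forall>B\<in>\<B>. emeasure \<mu> B = of_nat (n B)}
     = (\<integral>\<^sup>+\<omega>. indicator {n'} (cell_counts \<B> (\<zeta> \<omega>)) \<partial>\<Omega>)"
    by (intro * measurable_\<zeta> AE_finite_\<zeta>)
  also have "\<dots> = (\<integral>\<^sup>+\<omega>. indicator {n'} (cell_counts \<B> (\<eta> \<omega>)) \<partial>\<Omega>)"
    by (simp only: nn_integral_cell_counts_marginal[OF cB])
  also have "\<dots> = emeasure (distr \<Omega> ?N \<eta>) {\<mu> \<in> point_measures M. \<forall>B\<in>\<B>. emeasure \<mu> B = of_nat (n B)}"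
  proof (rule *[symmetric, OF measurable_\<eta>])
    show "AE \<omega> in \<Omega>. emeasure (\<eta> \<omega>) C \<noteq> \<infinity>" if "C \<in> finite_sets L" for C using AE_finite[OF that] by auto
  qed
  finally show "emeasure (distr \<Omega> ?N \<zeta>) {\<mu> \<in> point_measures M. \<forall>B\<in>\<B>. emeasure \<mu> B = of_nat (n B)}
    = emeasure (distr \<Omega> ?N \<eta>) {\<mu> \<in> point_measures M. \<forall>B\<in>\<B>. emeasure \<mu> B = of_nat (n B)}" .
qed auto

end

section \<open>Conditional means given a discrete variable\<close>

context prob_space
begin

lemma nn_integral_countable_partition:
  assumes X: "X \<in> M \<rightarrow>\<^sub>M count_space UNIV" and S: "countable S" "\<And>\<omega>. \<omega> \<in> space M \<Longrightarrow> X \<omega> \<in> S"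
    and g[measurable]: "g \<in> borel_measurable M"
  shows "(\<integral>\<^sup>+\<omega>. g \<omega> \<partial>M) = (\<integral>\<^sup>+n. (\<integral>\<^sup>+\<omega>. g \<omega> * indicator {n} (X \<omega>) \<partial>M) \<partial>count_space S)"
proof -
  have "(\<lambda>\<omega>. indicator {n} (X \<omega>) :: ennreal) \<in> borel_measurable M" for n
    by (rule measurable_compose[OF X]) simp
  then have [measurable]: "(\<lambda>\<omega>. g \<omega> * indicator {n} (X \<omega>)) \<in> borel_measurable M" for n by measurable
  have "g \<omega> = (\<integral>\<^sup>+n. g \<omega> * indicator {n} (X \<omega>) \<partial>count_space S)" if "\<omega> \<in> space M" for \<omega>
  proof -
    have "(\<integral>\<^sup>+n. g \<omega> * indicator {n} (X \<omega>) \<partial>count_space S) = (\<integral>\<^sup>+n. g \<omega> * indicator {X \<omega>} n \<partial>count_space S)"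
      by (intro nn_integral_cong) (auto simp: indicator_def)
    also have "\<dots> = g \<omega>" using S(2)[OF that] by (simp add: nn_integral_cmult_indicator)
    finally show ?thesis by simp
  qed
  then have "(\<integral>\<^sup>+\<omega>. g \<omega> \<partial>M) = (\<integral>\<^sup>+\<omega>. (\<integral>\<^sup>+n. g \<omega> * indicator {n} (X \<omega>) \<partial>count_space S) \<partial>M)"
    by (intro nn_integral_cong) simp
  also have "\<dots> = (\<integral>\<^sup>+n. (\<integral>\<^sup>+\<omega>. g \<omega> * indicator {n} (X \<omega>) \<partial>M) \<partial>count_space S)"
    by (intro nn_integral_count_space_nn_integral S) measurable
  finally show ?thesis .
qed

text \<open>The value is 0 on atoms of probability 0.\<close>

definition cond_mean :: "('a \<Rightarrow> 'b) \<Rightarrow> ('a \<Rightarrow> real) \<Rightarrow> 'b \<Rightarrow> real" where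
  "cond_mean X Y n = expectation (\<lambda>\<omega>. Y \<omega> * indicator {n} (X \<omega>)) / prob {\<omega> \<in> space M. X \<omega> = n}"

context
  fixes X :: "'a \<Rightarrow> 'b" and Y :: "'a \<Rightarrow> real" and K :: real
  assumes X: "X \<in> M \<rightarrow>\<^sub>M count_space UNIV"
    and Y[measurable]: "Y \<in> borel_measurable M" and YK: "\<And>\<omega>. 0 \<le> Y \<omega>" "\<And>\<omega>. Y \<omega> \<le> K"
begin

lemma measurable_indicator_value: "(\<lambda>\<omega>. indicator {n} (X \<omega>) :: 'c::{zero_neq_one,topological_space}) \<in> borel_measurable M"
  by (rule measurable_compose[OF X]) simp

lemma event_value: "{\<omega> \<in> space M. X \<omega> = n} \<in> events"
  using measurable_sets[OF X, of "{n}"] by (simp add: vimage_def Int_def conj_commute)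

lemma expectation_indicator_value: "expectation (\<lambda>\<omega>. indicator {n} (X \<omega>)) = prob {\<omega> \<in> space M. X \<omega> = n}"
proof -
  have "expectation (\<lambda>\<omega>. indicator {n} (X \<omega>)) = expectation (indicator {\<omega> \<in> space M. X \<omega> = n})"
    by (intro Bochner_Integration.integral_cong) (auto simp: indicator_def)
  also have "\<dots> = prob {\<omega> \<in> space M. X \<omega> = n}"
    unfolding Bochner_Integration.integral_indicator by (rule arg_cong[where f=prob]) auto
  finally show ?thesis .
qed

lemma integrable_indicator_value: "integrable M (\<lambda>\<omega>. indicator {n} (X \<omega>) :: real)"
  by (rule integrable_const_bound[where B=1, OF _ measurable_indicator_value]) (simp add: indicator_def)

lemma integrable_restricted:
  assumes [measurable]: "Z \<in> borel_measurable M" and "\<And>\<omega>. \<bar>Z \<omega>\<bar> \<le> (C::real)"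
  shows "integrable M (\<lambda>\<omega>. Z \<omega> * indicator {n} (X \<omega>))" "integrable M Z"
proof -
  note [measurable] = measurable_indicator_value
  have "0 \<le> C" using assms(2)[of undefined] by linarith
  then have "AE \<omega> in M. norm (Z \<omega> * indicator {n} (X \<omega>)) \<le> C"
    using assms(2) by (intro AE_I2) (simp add: abs_mult indicator_def)
  then show "integrable M (\<lambda>\<omega>. Z \<omega> * indicator {n} (X \<omega>))"
    by (rule integrable_const_bound) measurable
  show "integrable M Z" using assms(2) by (intro integrable_const_bound[where B=C]) auto
qed

lemma cond_mean_nonneg: "0 \<le> cond_mean X Y n"
  using YK by (simp add: cond_mean_def integral_nonneg_AE)

text \<open>Valid on null atoms too, where both sides are 0, so sums over all atoms proceed without
  case distinctions.\<close>

lemma cond_mean_mult: "cond_mean X Y n * prob {\<omega> \<in> space M. X \<omega> = n} = expectation (\<lambda>\<omega>. Y \<omega> * indicator {n} (X \<omega>))"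
proof (cases "prob {\<omega> \<in> space M. X \<omega> = n} = 0")
  case True
  have "AE \<omega> in M. indicator {n} (X \<omega>) = (0::real)"
    by (rule integral_nonneg_eq_0_iff_AE[THEN iffD1, OF integrable_indicator_value])
      (use True in \<open>simp_all add: expectation_indicator_value\<close>)
  then have "expectation (\<lambda>\<omega>. Y \<omega> * indicator {n} (X \<omega>)) = 0" by (intro integral_eq_zero_AE) auto
  then show ?thesis using True by simp
qed (simp add: cond_mean_def)

lemma cond_mean_le: "cond_mean X Y n \<le> K"
proof (cases "prob {\<omega> \<in> space M. X \<omega> = n} = 0")
  case True
  have "0 \<le> K" using YK[of undefined] by linarith
  then show ?thesis using True by (simp add: cond_mean_def)
next
  case False
  have "expectation (\<lambda>\<omega>. Y \<omega> * indicator {n} (X \<omega>)) \<le> expectation (\<lambda>\<omega>. K * indicator {n} (X \<omega>))"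
    using integrable_restricted(1)[of Y K] integrable_indicator_value YK
    by (intro integral_mono) (simp_all add: mult_right_mono)
  also have "\<dots> = K * prob {\<omega> \<in> space M. X \<omega> = n}" by (simp add: expectation_indicator_value)
  finally show ?thesis using False by (simp add: cond_mean_def divide_le_eq measure_nonneg less_le)
qed

text \<open>Jensen on one atom, multiplied by its probability and derived from Hoelder with the
  indicator of the atom as second function.\<close>

lemma cond_mean_powr_le:
  assumes p: "1 < p"
  shows "cond_mean X Y n powr p * prob {\<omega> \<in> space M. X \<omega> = n} \<le> expectation (\<lambda>\<omega>. Y \<omega> powr p * indicator {n} (X \<omega>))"
proof (cases "prob {\<omega> \<in> space M. X \<omega> = n} = 0")
  case True
  then show ?thesis using YK by (simp add: integral_nonneg_AE)
next
  case False
  define P where "P = prob {\<omega> \<in> space M. X \<omega> = n}"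
  have P: "0 < P" using False by (simp add: P_def less_le)
  define E where "E = expectation (\<lambda>\<omega>. Y \<omega> powr p * indicator {n} (X \<omega>))"
  define m where "m = cond_mean X Y n"
  have m: "0 \<le> m" unfolding m_def by (rule cond_mean_nonneg)
  have "Y \<omega> powr p \<le> K powr p" for \<omega> using YK p by (intro powr_mono2) auto
  then have i: "integrable M (\<lambda>\<omega>. Y \<omega> powr p * indicator {n} (X \<omega>))" "integrable M (\<lambda>\<omega>. indicator {n} (X \<omega>) :: real)"
    using integrable_restricted(1)[of "\<lambda>\<omega>. Y \<omega> powr p" "K powr p"] integrable_indicator_value by simp_all
  have "m * P = expectation (\<lambda>\<omega>. (Y \<omega> powr p * indicator {n} (X \<omega>)) powr (1 / p) * indicator {n} (X \<omega>) powr (1 - 1 / p))"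
    unfolding m_def P_def cond_mean_mult
    using p YK by (intro Bochner_Integration.integral_cong) (auto simp: indicator_def powr_powr)
  also have "\<dots> \<le> E powr (1 / p) * P powr (1 - 1 / p)"
    unfolding E_def P_def expectation_indicator_value[symmetric]
    by (rule Holder_powr(2)[OF _ _ i]) (use p in auto)
  finally have "(m * P) powr p \<le> (E powr (1 / p) * P powr (1 - 1 / p)) powr p"
    using m P p by (intro powr_mono2) auto
  also have "\<dots> = E * P powr (p - 1)"
    using p P by (simp add: powr_mult powr_powr E_def integral_nonneg_AE left_diff_distrib)
  finally have "m powr p * P powr p \<le> E * P powr (p - 1)" using m P by (simp add: powr_mult)
  also have "P powr p = P * P powr (p - 1)" using P by (simp add: powr_diff)
  finally have "(m powr p * P) * P powr (p - 1) \<le> E * P powr (p - 1)" by (simp add: mult_ac)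
  then show ?thesis using P by (simp add: m_def P_def E_def)
qed

context
  fixes S :: "'b set"
  assumes S: "countable S" "\<And>\<omega>. \<omega> \<in> space M \<Longrightarrow> X \<omega> \<in> S"
begin

lemma measurable_function_value: "(\<lambda>\<omega>. f (X \<omega>)) \<in> M \<rightarrow>\<^sub>M (borel :: 'c::topological_space measure)"
  by (rule measurable_compose[OF X]) simp

lemma nn_integral_restricted_value:
  fixes f :: "'b \<Rightarrow> real"
  assumes "0 \<le> f n"
  shows "(\<integral>\<^sup>+\<omega>. ennreal (f (X \<omega>)) * indicator {n} (X \<omega>) \<partial>M) = ennreal (f n * prob {\<omega> \<in> space M. X \<omega> = n})"
proof -
  note [measurable] = event_value
  have "(\<integral>\<^sup>+\<omega>. ennreal (f (X \<omega>)) * indicator {n} (X \<omega>) \<partial>M) = (\<integral>\<^sup>+\<omega>. ennreal (f n) * indicator {\<omega> \<in> space M. X \<omega> = n} \<omega> \<partial>M)"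
    by (intro nn_integral_cong) (auto simp: indicator_def)
  also have "\<dots> = ennreal (f n) * emeasure M {\<omega> \<in> space M. X \<omega> = n}"
    by (rule nn_integral_cmult_indicator) measurable
  finally show ?thesis using assms by (simp add: emeasure_eq_measure ennreal_mult)
qed

lemma nn_integral_restricted_real:
  assumes [measurable]: "Z \<in> borel_measurable M" and "\<And>\<omega>. 0 \<le> Z \<omega>" "\<And>\<omega>. Z \<omega> \<le> (C::real)"
  shows "(\<integral>\<^sup>+\<omega>. ennreal (Z \<omega>) * indicator {n} (X \<omega>) \<partial>M) = ennreal (expectation (\<lambda>\<omega>. Z \<omega> * indicator {n} (X \<omega>)))"
proof -
  note [measurable] = measurable_indicator_value
  have "(\<integral>\<^sup>+\<omega>. ennreal (Z \<omega>) * indicator {n} (X \<omega>) \<partial>M) = (\<integral>\<^sup>+\<omega>. ennreal (Z \<omega> * indicator {n} (X \<omega>)) \<partial>M)"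
    by (intro nn_integral_cong) (auto simp: indicator_def)
  also have "\<dots> = ennreal (expectation (\<lambda>\<omega>. Z \<omega> * indicator {n} (X \<omega>)))"
    using assms integrable_restricted(1)[of Z C] by (intro nn_integral_eq_integral) (auto simp: abs_le_iff intro: order_trans)
  finally show ?thesis .
qed

lemma nn_integral_cond_mean_powr_le:
  assumes p: "1 < p"
  shows "(\<integral>\<^sup>+\<omega>. ennreal (cond_mean X Y (X \<omega>) powr p) \<partial>M) \<le> (\<integral>\<^sup>+\<omega>. ennreal (Y \<omega> powr p) \<partial>M)"
proof -
  note [measurable] = measurable_indicator_value measurable_function_value
  have "Y \<omega> powr p \<le> K powr p" for \<omega> using YK p by (intro powr_mono2) auto
  note Z = nn_integral_restricted_real[of "\<lambda>\<omega>. Y \<omega> powr p" "K powr p", OF _ _ this, simplified]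
  have "(\<integral>\<^sup>+\<omega>. ennreal (cond_mean X Y (X \<omega>) powr p) \<partial>M)
      = (\<integral>\<^sup>+n. ennreal (cond_mean X Y n powr p * prob {\<omega> \<in> space M. X \<omega> = n}) \<partial>count_space S)"
    by (subst nn_integral_countable_partition[OF X S])
      (auto simp: nn_integral_restricted_value[where f="\<lambda>n. cond_mean X Y n powr p"])
  also have "\<dots> \<le> (\<integral>\<^sup>+n. (\<integral>\<^sup>+\<omega>. ennreal (Y \<omega> powr p) * indicator {n} (X \<omega>) \<partial>M) \<partial>count_space S)"
    unfolding Z by (intro nn_integral_mono ennreal_leI cond_mean_powr_le p)
  also have "\<dots> = (\<integral>\<^sup>+\<omega>. ennreal (Y \<omega> powr p) \<partial>M)"
    by (rule nn_integral_countable_partition[OF X S, symmetric]) measurable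
  finally show ?thesis .
qed

text \<open>The conditional mean is within a factor 2 of the best approximation by functions of
  \<open>X\<close>: by the triangle inequality through \<open>h (X \<omega>)\<close>, since on each
  atom the distance from \<open>h\<close> to the mean is at most the mean distance from
  \<open>h\<close> to \<open>Y\<close>.\<close>

lemma cond_mean_L1_approx:
  fixes h :: "'b \<Rightarrow> real"
  shows "(\<integral>\<^sup>+\<omega>. ennreal \<bar>Y \<omega> - cond_mean X Y (X \<omega>)\<bar> \<partial>M) \<le> 2 * (\<integral>\<^sup>+\<omega>. ennreal \<bar>Y \<omega> - h (X \<omega>)\<bar> \<partial>M)"
proof -
  note [measurable] = measurable_indicator_value measurable_function_value
  let ?m = "cond_mean X Y"
  have "(\<integral>\<^sup>+\<omega>. ennreal \<bar>h (X \<omega>) - ?m (X \<omega>)\<bar> \<partial>M)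
      = (\<integral>\<^sup>+n. ennreal (\<bar>h n - ?m n\<bar> * prob {\<omega> \<in> space M. X \<omega> = n}) \<partial>count_space S)"
    by (subst nn_integral_countable_partition[OF X S])
      (auto simp: nn_integral_restricted_value[where f="\<lambda>n. \<bar>h n - ?m n\<bar>"])
  also have "\<dots> \<le> (\<integral>\<^sup>+n. (\<integral>\<^sup>+\<omega>. ennreal \<bar>Y \<omega> - h (X \<omega>)\<bar> * indicator {n} (X \<omega>) \<partial>M) \<partial>count_space S)"
  proof (rule nn_integral_mono)
    fix n
    have b: "\<bar>Y \<omega> - h n\<bar> \<le> K + \<bar>h n\<bar>" for \<omega> using YK[of \<omega>] by linarith
    have i: "integrable M (\<lambda>\<omega>. Y \<omega> * indicator {n} (X \<omega>))" "integrable M (\<lambda>\<omega>. indicator {n} (X \<omega>) :: real)"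
      using integrable_restricted(1)[of Y K] integrable_indicator_value YK by simp_all
    have "\<bar>h n - ?m n\<bar> * prob {\<omega> \<in> space M. X \<omega> = n} = \<bar>h n * prob {\<omega> \<in> space M. X \<omega> = n} - ?m n * prob {\<omega> \<in> space M. X \<omega> = n}\<bar>"
      by (simp add: left_diff_distrib[symmetric] abs_mult)
    also have "\<dots> = \<bar>expectation (\<lambda>\<omega>. (Y \<omega> - h n) * indicator {n} (X \<omega>))\<bar>"
      unfolding cond_mean_mult using i by (simp add: left_diff_distrib expectation_indicator_value abs_minus_commute)
    also have "\<dots> \<le> expectation (\<lambda>\<omega>. \<bar>(Y \<omega> - h n) * indicator {n} (X \<omega>)\<bar>)" by (rule integral_abs_bound)
    also have "\<dots> = expectation (\<lambda>\<omega>. \<bar>Y \<omega> - h n\<bar> * indicator {n} (X \<omega>))" by (simp add: abs_mult)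
    finally have "ennreal (\<bar>h n - ?m n\<bar> * prob {\<omega> \<in> space M. X \<omega> = n}) \<le> (\<integral>\<^sup>+\<omega>. ennreal \<bar>Y \<omega> - h n\<bar> * indicator {n} (X \<omega>) \<partial>M)"
      using b by (subst nn_integral_restricted_real[where C="K + \<bar>h n\<bar>"]) (auto intro: ennreal_leI)
    also have "\<dots> = (\<integral>\<^sup>+\<omega>. ennreal \<bar>Y \<omega> - h (X \<omega>)\<bar> * indicator {n} (X \<omega>) \<partial>M)"
      by (intro nn_integral_cong) (auto simp: indicator_def)
    finally show "ennreal (\<bar>h n - ?m n\<bar> * prob {\<omega> \<in> space M. X \<omega> = n}) \<le> (\<integral>\<^sup>+\<omega>. ennreal \<bar>Y \<omega> - h (X \<omega>)\<bar> * indicator {n} (X \<omega>) \<partial>M)" .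
  qed
  also have "\<dots> = (\<integral>\<^sup>+\<omega>. ennreal \<bar>Y \<omega> - h (X \<omega>)\<bar> \<partial>M)"
    by (rule nn_integral_countable_partition[OF X S, symmetric]) measurable
  finally have *: "(\<integral>\<^sup>+\<omega>. ennreal \<bar>h (X \<omega>) - ?m (X \<omega>)\<bar> \<partial>M) \<le> (\<integral>\<^sup>+\<omega>. ennreal \<bar>Y \<omega> - h (X \<omega>)\<bar> \<partial>M)" .
  have "(\<integral>\<^sup>+\<omega>. ennreal \<bar>Y \<omega> - ?m (X \<omega>)\<bar> \<partial>M) \<le> (\<integral>\<^sup>+\<omega>. ennreal \<bar>Y \<omega> - h (X \<omega>)\<bar> + ennreal \<bar>h (X \<omega>) - ?m (X \<omega>)\<bar> \<partial>M)"
    by (intro nn_integral_mono) (simp add: ennreal_plus[symmetric] del: ennreal_plus)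
  also have "\<dots> = (\<integral>\<^sup>+\<omega>. ennreal \<bar>Y \<omega> - h (X \<omega>)\<bar> \<partial>M) + (\<integral>\<^sup>+\<omega>. ennreal \<bar>h (X \<omega>) - ?m (X \<omega>)\<bar> \<partial>M)"
    by (rule nn_integral_add) measurable
  also have "\<dots> \<le> 2 * (\<integral>\<^sup>+\<omega>. ennreal \<bar>Y \<omega> - h (X \<omega>)\<bar> \<partial>M)"
    using * by (simp add: mult_2 add_left_mono)
  finally show ?thesis .
qed

end

end

end

section \<open>Approximation by functions of finitely many counts\<close>

context poisson_thinning
begin

definition "\<Sigma> = vimage_algebra (space \<Omega>) \<eta> (point_measure_algebra M)"

lemma subalgebra_\<Sigma>: "subalgebra \<Omega> \<Sigma>"
  unfolding \<Sigma>_def subalgebra_def using sets_image_in_sets[OF refl measurable_\<eta>] by simp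

text \<open>The sets in \<open>\<C>\<close> may overlap and \<open>h\<close> may have either sign.
  This keeps the notion stable under sums and limits; passing to disjoint cells and to conditional
  means is postponed until both functions of the bilinear bound are approximated.\<close>

definition approximant :: "real \<Rightarrow> ('w \<Rightarrow> real) \<Rightarrow> 'a set set \<Rightarrow> ('a measure \<Rightarrow> real) \<Rightarrow> bool" where
  "approximant \<epsilon> Y \<C> h \<longleftrightarrow> finite \<C> \<and> \<C> \<subseteq> finite_sets L \<and> determined_by M \<C> h \<and> h \<in> borel_measurable (point_measure_algebra M)
     \<and> integrable \<Omega> (\<lambda>\<omega>. h (\<eta> \<omega>)) \<and> expectation (\<lambda>\<omega>. \<bar>Y \<omega> - h (\<eta> \<omega>)\<bar>) < \<epsilon>"

lemma approximantI:
  assumes "finite \<C>" "\<C> \<subseteq> finite_sets L" "determined_by M \<C> h" "h \<in> borel_measurable (point_measure_algebra M)"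
    "integrable \<Omega> (\<lambda>\<omega>. h (\<eta> \<omega>))" "expectation (\<lambda>\<omega>. \<bar>Y \<omega> - h (\<eta> \<omega>)\<bar>) < \<epsilon>"
  shows "approximant \<epsilon> Y \<C> h"
  unfolding approximant_def by (intro conjI assms)

lemma approximantD:
  assumes "approximant \<epsilon> Y \<C> h"
  shows "finite \<C>" "\<C> \<subseteq> finite_sets L" "determined_by M \<C> h" "h \<in> borel_measurable (point_measure_algebra M)"
    "integrable \<Omega> (\<lambda>\<omega>. h (\<eta> \<omega>))" "expectation (\<lambda>\<omega>. \<bar>Y \<omega> - h (\<eta> \<omega>)\<bar>) < \<epsilon>"
  using assms unfolding approximant_def by blast+

definition approximable :: "('w \<Rightarrow> real) \<Rightarrow> bool" where
  "approximable Y \<longleftrightarrow> integrable \<Omega> Y \<and> (\<forall>\<epsilon>>0. \<exists>\<C> h. approximant \<epsilon> Y \<C> h)"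

lemma approximableE:
  assumes "approximable Y" "0 < \<epsilon>"
  obtains \<C> h where "approximant \<epsilon> Y \<C> h"
  using assms unfolding approximable_def by blast

lemma approximableI:
  assumes "integrable \<Omega> Y" "\<And>\<epsilon>. 0 < \<epsilon> \<Longrightarrow> \<exists>\<C> h. approximant \<epsilon> Y \<C> h"
  shows "approximable Y"
  using assms unfolding approximable_def by blast

lemma approximable_integrable: "approximable Y \<Longrightarrow> integrable \<Omega> Y"
  unfolding approximable_def by (rule conjunct1)

lemma approximable_add:
  assumes "approximable Y" "approximable Z"
  shows "approximable (\<lambda>\<omega>. Y \<omega> + Z \<omega>)"
proof (rule approximableI)
  have i: "integrable \<Omega> Y" "integrable \<Omega> Z" using assms by (auto intro: approximable_integrable)
  then show "integrable \<Omega> (\<lambda>\<omega>. Y \<omega> + Z \<omega>)" by simp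
  fix \<epsilon> :: real assume "0 < \<epsilon>"
  then have e: "0 < \<epsilon> / 2" by simp
  obtain \<C> g where g0: "approximant (\<epsilon> / 2) Y \<C> g"
    by (rule approximableE[OF assms(1) e])
  obtain \<D> h where h0: "approximant (\<epsilon> / 2) Z \<D> h"
    by (rule approximableE[OF assms(2) e])
  note g = approximantD[OF g0] and h = approximantD[OF h0]
  have "expectation (\<lambda>\<omega>. \<bar>Y \<omega> + Z \<omega> - (g (\<eta> \<omega>) + h (\<eta> \<omega>))\<bar>) \<le> expectation (\<lambda>\<omega>. \<bar>Y \<omega> - g (\<eta> \<omega>)\<bar> + \<bar>Z \<omega> - h (\<eta> \<omega>)\<bar>)"
    using i g(5) h(5) by (intro integral_mono) auto
  also have "\<dots> < \<epsilon>" using i g(5,6) h(5,6) by simp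
  finally have "expectation (\<lambda>\<omega>. \<bar>Y \<omega> + Z \<omega> - (g (\<eta> \<omega>) + h (\<eta> \<omega>))\<bar>) < \<epsilon>" .
  moreover have "determined_by M (\<C> \<union> \<D>) (\<lambda>\<mu>. g \<mu> + h \<mu>)"
    by (rule determined_by_compose2[OF g(3) h(3)])
  ultimately have "approximant \<epsilon> (\<lambda>\<omega>. Y \<omega> + Z \<omega>) (\<C> \<union> \<D>) (\<lambda>\<mu>. g \<mu> + h \<mu>)"
    using g(1,2) h(1,2)
    by (intro approximantI borel_measurable_add Bochner_Integration.integrable_add g(4,5) h(4,5)) simp_all
  then show "\<exists>\<C> h. approximant \<epsilon> (\<lambda>\<omega>. Y \<omega> + Z \<omega>) \<C> h" by blast
qed

lemma approximable_scale:
  assumes "approximable Y"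
  shows "approximable (\<lambda>\<omega>. c * Y \<omega>)"
proof (rule approximableI)
  have i: "integrable \<Omega> Y" using assms by (rule approximable_integrable)
  then show "integrable \<Omega> (\<lambda>\<omega>. c * Y \<omega>)" by simp
  fix \<epsilon> :: real assume e: "0 < \<epsilon>"
  obtain \<C> g where g0: "approximant (\<epsilon> / (\<bar>c\<bar> + 1)) Y \<C> g"
    by (rule approximableE[OF assms, of "\<epsilon> / (\<bar>c\<bar> + 1)"]) (use e in auto)
  note g = approximantD[OF g0]
  have "expectation (\<lambda>\<omega>. \<bar>c * Y \<omega> - c * g (\<eta> \<omega>)\<bar>) = \<bar>c\<bar> * expectation (\<lambda>\<omega>. \<bar>Y \<omega> - g (\<eta> \<omega>)\<bar>)"
    by (simp add: right_diff_distrib[symmetric] abs_mult)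
  also have "\<dots> \<le> \<bar>c\<bar> * (\<epsilon> / (\<bar>c\<bar> + 1))" using g(6) by (intro mult_left_mono) auto
  also have "\<dots> < \<epsilon>" using e by (simp add: field_simps add_pos_nonneg)
  finally have "expectation (\<lambda>\<omega>. \<bar>c * Y \<omega> - c * g (\<eta> \<omega>)\<bar>) < \<epsilon>" .
  moreover have "determined_by M \<C> (\<lambda>\<mu>. c * g \<mu>)"
    using determined_by_compose2[OF g(3) g(3), of "\<lambda>x y. c * x"] by simp
  ultimately have "approximant \<epsilon> (\<lambda>\<omega>. c * Y \<omega>) \<C> (\<lambda>\<mu>. c * g \<mu>)"
    by (intro approximantI integrable_mult_right borel_measurable_times borel_measurable_const g(1,2,4,5))
  then show "\<exists>\<C> h. approximant \<epsilon> (\<lambda>\<omega>. c * Y \<omega>) \<C> h" by blast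
qed

text \<open>Dominated convergence puts some \<open>Y k\<close> within half the tolerance of
  \<open>Z\<close> in mean, and the approximant of that \<open>Y k\<close> spends the other
  half.\<close>

lemma approximable_lim:
  assumes Y: "\<And>i. approximable (Y i)" and lim: "AE \<omega> in \<Omega>. (\<lambda>i. Y i \<omega>) \<longlonglongrightarrow> Z \<omega>"
    and Zm[measurable]: "Z \<in> borel_measurable \<Omega>" and w: "integrable \<Omega> w"
    and b: "\<And>i. AE \<omega> in \<Omega>. \<bar>Y i \<omega>\<bar> \<le> w \<omega>" "AE \<omega> in \<Omega>. \<bar>Z \<omega>\<bar> \<le> w \<omega>"
  shows "approximable Z"
proof (rule approximableI)
  have "AE \<omega> in \<Omega>. norm (Z \<omega>) \<le> norm (w \<omega>)" using b(2) by eventually_elim simp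
  then show Z: "integrable \<Omega> Z" by (rule Bochner_Integration.integrable_bound[OF w Zm])
  have i: "integrable \<Omega> (Y i)" for i using Y by (rule approximable_integrable)
  then have Ym[measurable]: "Y i \<in> borel_measurable \<Omega>" for i by (rule borel_measurable_integrable)
  have "(\<lambda>i. expectation (\<lambda>\<omega>. \<bar>Z \<omega> - Y i \<omega>\<bar>)) \<longlonglongrightarrow> expectation (\<lambda>\<omega>. 0)"
  proof (rule integral_dominated_convergence[where w="\<lambda>\<omega>. 2 * w \<omega>"])
    show "AE \<omega> in \<Omega>. (\<lambda>i. \<bar>Z \<omega> - Y i \<omega>\<bar>) \<longlonglongrightarrow> 0"
      using lim
    proof eventually_elim
      case (elim \<omega>)
      have "(\<lambda>i. \<bar>Z \<omega> - Y i \<omega>\<bar>) \<longlonglongrightarrow> \<bar>Z \<omega> - Z \<omega>\<bar>" by (intro tendsto_intros elim)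
      then show ?case by simp
    qed
    show "AE \<omega> in \<Omega>. norm \<bar>Z \<omega> - Y i \<omega>\<bar> \<le> 2 * w \<omega>" for i
      using b(1)[of i] b(2)
    proof eventually_elim
      case (elim \<omega>)
      then show ?case unfolding real_norm_def by linarith
    qed
    show "(\<lambda>\<omega>. \<bar>Z \<omega> - Y i \<omega>\<bar>) \<in> borel_measurable \<Omega>" for i
      by (intro borel_measurable_abs borel_measurable_diff Zm Ym)
    show "integrable \<Omega> (\<lambda>\<omega>. 2 * w \<omega>)" by (intro integrable_mult_right w)
  qed (rule borel_measurable_const)
  then have L1: "(\<lambda>i. expectation (\<lambda>\<omega>. \<bar>Z \<omega> - Y i \<omega>\<bar>)) \<longlonglongrightarrow> 0" by simp
  fix \<epsilon> :: real assume "0 < \<epsilon>"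
  then have e: "0 < \<epsilon> / 2" by simp
  from order_tendstoD(2)[OF L1 e] obtain k where k: "expectation (\<lambda>\<omega>. \<bar>Z \<omega> - Y k \<omega>\<bar>) < \<epsilon> / 2"
    by (auto simp: eventually_sequentially)
  obtain \<C> g where g0: "approximant (\<epsilon> / 2) (Y k) \<C> g"
    by (rule approximableE[OF Y e])
  note g = approximantD[OF g0]
  have "expectation (\<lambda>\<omega>. \<bar>Z \<omega> - g (\<eta> \<omega>)\<bar>) \<le> expectation (\<lambda>\<omega>. \<bar>Z \<omega> - Y k \<omega>\<bar> + \<bar>Y k \<omega> - g (\<eta> \<omega>)\<bar>)"
    using i Z g(5) by (intro integral_mono) auto
  also have "\<dots> < \<epsilon>" using i Z g(5,6) k by simp
  finally have "expectation (\<lambda>\<omega>. \<bar>Z \<omega> - g (\<eta> \<omega>)\<bar>) < \<epsilon>" .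
  then have "approximant \<epsilon> Z \<C> g" by (intro approximantI g(1-5))
  then show "\<exists>\<C> h. approximant \<epsilon> Z \<C> h" by blast
qed

lemma approximable_cong:
  assumes Y: "approximable Y" and eq: "\<And>\<omega>. \<omega> \<in> space \<Omega> \<Longrightarrow> Y \<omega> = Z \<omega>"
  shows "approximable Z"
proof (rule approximableI)
  show "integrable \<Omega> Z"
    using approximable_integrable[OF Y] eq Bochner_Integration.integrable_cong[OF refl, of \<Omega> Y Z] by blast
  fix \<epsilon> :: real assume "0 < \<epsilon>"
  then obtain \<C> g where g0: "approximant \<epsilon> Y \<C> g" by (rule approximableE[OF Y])
  note g = approximantD[OF g0]
  have "expectation (\<lambda>\<omega>. \<bar>Z \<omega> - g (\<eta> \<omega>)\<bar>) = expectation (\<lambda>\<omega>. \<bar>Y \<omega> - g (\<eta> \<omega>)\<bar>)"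
    by (intro Bochner_Integration.integral_cong refl) (simp add: eq)
  then have "expectation (\<lambda>\<omega>. \<bar>Z \<omega> - g (\<eta> \<omega>)\<bar>) < \<epsilon>" using g(6) by linarith
  then have "approximant \<epsilon> Z \<C> g" by (intro approximantI g(1-5))
  then show "\<exists>\<C> h. approximant \<epsilon> Z \<C> h" by blast
qed

lemma approximable_const: "approximable (\<lambda>_. c)"
proof (rule approximableI)
  fix \<epsilon> :: real assume "0 < \<epsilon>"
  then have "approximant \<epsilon> (\<lambda>_. c) {} (\<lambda>_. c)"
    by (intro approximantI) (simp_all add: determined_by_def)
  then show "\<exists>\<C> h. approximant \<epsilon> (\<lambda>_. c) \<C> h" by blast
qed simp

lemma approximable_sum:
  "finite I \<Longrightarrow> (\<And>i. i \<in> I \<Longrightarrow> approximable (Y i)) \<Longrightarrow> approximable (\<lambda>\<omega>. \<Sum>i\<in>I. Y i \<omega>)"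
  by (induction I rule: finite_induct) (auto intro: approximable_const approximable_add)

text \<open>Induction over the \<sigma>-algebra from its intersection-stable generator: cylinder
  sets approximate themselves, complements use 1 minus the indicator, and disjoint unions are limits
  of partial sums bounded by 1.\<close>

lemma approximable_indicator:
  assumes "A \<in> sets (point_measure_algebra M)"
  shows "approximable (\<lambda>\<omega>. indicator A (\<eta> \<omega>))"
proof -
  have ss: "sets (point_measure_algebra M) = sigma_sets (point_measures M) (cylinder_sets M L)"
    by (rule sigma_cylinder_sets[OF sf L])
  have "A \<in> sigma_sets (point_measures M) (cylinder_sets M L)" using assms ss by simp
  with Int_stable_cylinder_sets cylinder_sets_Pow show ?thesis
  proof (induction rule: sigma_sets_induct_disjoint)
    case (basic A)
    then obtain \<C> where C: "A \<in> sets (point_measure_algebra M)" "finite \<C>" "\<C> \<subseteq> finite_sets L" "determined_by M \<C> (\<lambda>\<mu>. \<mu> \<in> A)"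
      unfolding cylinder_sets_def by blast
    note [measurable] = C(1)
    have "determined_by M \<C> (indicator A :: _ \<Rightarrow> real)"
      using determined_by_compose2[OF C(4) C(4), of "\<lambda>x y. of_bool x :: real"] by (simp add: indicator_def[abs_def])
    moreover have "integrable \<Omega> (\<lambda>\<omega>. indicator A (\<eta> \<omega>) :: real)"
      by (rule integrable_const_bound[where B=1]) auto
    moreover have "indicator A \<in> borel_measurable (point_measure_algebra M)" by (rule borel_measurable_indicator[OF C(1)])
    ultimately have "approximant \<epsilon> (\<lambda>\<omega>. indicator A (\<eta> \<omega>)) \<C> (indicator A)" if "0 < \<epsilon>" for \<epsilon>
      using that C(2,3) by (intro approximantI) simp_all
    then show ?case using \<open>integrable \<Omega> _\<close> by (intro approximableI) blast+
  next
    case empty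
    show ?case using approximable_const[of 0] by simp
  next
    case (compl A)
    have "approximable (\<lambda>\<omega>. 1 + (- 1) * indicator A (\<eta> \<omega>))"
      by (intro approximable_add approximable_const approximable_scale compl)
    then show ?case
    proof (rule approximable_cong)
      fix \<omega> assume "\<omega> \<in> space \<Omega>"
      then show "1 + - 1 * indicator A (\<eta> \<omega>) = (indicator (point_measures M - A) (\<eta> \<omega>) :: real)"
        using point_measures_processes(1) by (simp add: indicator_def)
    qed
  next
    case (union A)
    have As: "A i \<in> sets (point_measure_algebra M)" for i using union(2) ss by auto
    then have UA: "(\<Union>i. A i) \<in> sets (point_measure_algebra M)" by auto
    show ?case
    proof (rule approximable_lim[where w="\<lambda>_. 1" and Y="\<lambda>n \<omega>. \<Sum>i<n. indicator (A i) (\<eta> \<omega>)"])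
      show "approximable (\<lambda>\<omega>. \<Sum>i<n. indicator (A i) (\<eta> \<omega>))" for n
        using union(3) by (intro approximable_sum) auto
      have s: "(\<lambda>i. indicator (A i) \<mu>) sums (indicator (\<Union>i. A i) \<mu> :: real)" for \<mu>
        by (rule indicator_sums) (use union(1) in \<open>auto simp: disjoint_family_on_def\<close>)
      show "AE \<omega> in \<Omega>. (\<lambda>n. \<Sum>i<n. indicator (A i) (\<eta> \<omega>)) \<longlonglongrightarrow> (indicator (\<Union>i. A i) (\<eta> \<omega>) :: real)"
        by (intro AE_I2 s[unfolded sums_def])
      show "AE \<omega> in \<Omega>. \<bar>\<Sum>i<n. indicator (A i) (\<eta> \<omega>) :: real\<bar> \<le> 1" for n
      proof (rule AE_I2)
        fix \<omega>
        have "(\<Sum>i<n. indicator (A i) (\<eta> \<omega>) :: real) \<le> (\<Sum>i. indicator (A i) (\<eta> \<omega>))"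
          using sums_summable[OF s] by (intro sum_le_suminf) auto
        also have "\<dots> = indicator (\<Union>i. A i) (\<eta> \<omega>)" by (rule sums_unique[OF s, symmetric])
        also have "\<dots> \<le> 1" by (rule indicator_le_1)
        finally show "\<bar>\<Sum>i<n. indicator (A i) (\<eta> \<omega>) :: real\<bar> \<le> 1" by (simp add: sum_nonneg)
      qed
      show "(\<lambda>\<omega>. indicator (\<Union>i. A i) (\<eta> \<omega>) :: real) \<in> borel_measurable \<Omega>"
        using measurable_compose[OF measurable_\<eta> borel_measurable_indicator[OF UA]] .
      show "integrable \<Omega> (\<lambda>_. 1 :: real)" by simp
      show "AE \<omega> in \<Omega>. \<bar>indicator (\<Union>i. A i) (\<eta> \<omega>) :: real\<bar> \<le> 1"
        by (intro AE_I2) (simp add: indicator_le_1)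
    qed
  qed
qed

text \<open>Takes the place of a martingale convergence theorem: functions of finitely many masses
  are dense in L1, by induction over integrable functions starting from indicators.\<close>

lemma approximable_\<Sigma>:
  assumes Y: "Y \<in> borel_measurable \<Sigma>" "integrable \<Omega> Y"
  shows "approximable Y"
proof -
  have "integrable (restr_to_subalg \<Omega> \<Sigma>) Y" by (rule integrable_in_subalg[OF subalgebra_\<Sigma> Y])
  then show ?thesis
  proof (induction rule: integrable_induct)
    case (base A c)
    then have "A \<in> sets \<Sigma>" by (simp add: sets_restr_to_subalg[OF subalgebra_\<Sigma>])
    then obtain B where B: "B \<in> sets (point_measure_algebra M)" "A = \<eta> -` B \<inter> space \<Omega>"
      unfolding \<Sigma>_def using measurable_space[OF measurable_\<eta>] by (auto simp: sets_vimage_algebra2)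
    have [measurable]: "A \<in> events" using measurable_sets[OF measurable_\<eta> B(1)] B(2) by simp
    have "approximable (\<lambda>\<omega>. c * indicator B (\<eta> \<omega>))"
      by (intro approximable_scale approximable_indicator B)
    then show ?case
    proof (rule approximable_cong)
      show "c * indicator B (\<eta> \<omega>) = indicator A \<omega> *\<^sub>R c" if "\<omega> \<in> space \<Omega>" for \<omega>
        using that by (simp add: B(2) indicator_def)
    qed
  next
    case (add f g)
    then show ?case by (simp add: approximable_add)
  next
    case (lim f s)
    have f: "integrable \<Omega> f" using integrable_from_subalg[OF subalgebra_\<Sigma> lim.hyps(4)] .
    have sp: "space (restr_to_subalg \<Omega> \<Sigma>) = space \<Omega>" by (rule space_restr_to_subalg)
    show ?case
    proof (rule approximable_lim[where w="\<lambda>\<omega>. 2 * \<bar>f \<omega>\<bar>" and Y=s])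
      show "approximable (s i)" for i by (rule lim.IH)
      show "AE \<omega> in \<Omega>. (\<lambda>i. s i \<omega>) \<longlonglongrightarrow> f \<omega>" using lim.hyps(2) by (simp add: sp)
      show "AE \<omega> in \<Omega>. \<bar>s i \<omega>\<bar> \<le> 2 * \<bar>f \<omega>\<bar>" for i using lim.hyps(3) by (simp add: sp)
      show "f \<in> borel_measurable \<Omega>" by (rule borel_measurable_integrable[OF f])
      show "integrable \<Omega> (\<lambda>\<omega>. 2 * \<bar>f \<omega>\<bar>)" by (intro integrable_mult_right integrable_abs f)
    qed simp
  qed
qed

section \<open>Conditional means given the cell counts\<close>

lemma measurable_counts:
  assumes "cells L \<B>" "f \<in> \<Omega> \<rightarrow>\<^sub>M point_measure_algebra M"
  shows "(\<lambda>\<omega>. cell_counts \<B> (f \<omega>)) \<in> \<Omega> \<rightarrow>\<^sub>M count_space UNIV"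
  using assms L by (intro measurable_cell_counts) (auto simp: cells_def finite_sets_def)

lemma prob_counts:
  assumes cB: "cells L \<B>"
  shows "prob {\<omega> \<in> space \<Omega>. cell_counts \<B> (\<eta> \<omega>) = n} = pmf (Pi_pmf \<B> 0 (\<lambda>B. poi (measure L B))) n"
proof -
  have m: "{\<omega> \<in> space \<Omega>. cell_counts \<B> (\<eta> \<omega>) = n} \<in> events"
  proof -
    have "(\<lambda>\<omega>. cell_counts \<B> (\<eta> \<omega>)) -` {n} \<inter> space \<Omega> \<in> events"
      by (rule measurable_sets[OF measurable_counts[OF cB measurable_\<eta>]]) simp
    also have "(\<lambda>\<omega>. cell_counts \<B> (\<eta> \<omega>)) -` {n} \<inter> space \<Omega> = {\<omega> \<in> space \<Omega>. cell_counts \<B> (\<eta> \<omega>) = n}" by auto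
    finally show ?thesis .
  qed
  have "ennreal (prob {\<omega> \<in> space \<Omega>. cell_counts \<B> (\<eta> \<omega>) = n}) = (\<integral>\<^sup>+\<omega>. indicator {\<omega> \<in> space \<Omega>. cell_counts \<B> (\<eta> \<omega>) = n} \<omega> \<partial>\<Omega>)"
    using m by (simp add: emeasure_eq_measure)
  also have "\<dots> = (\<integral>\<^sup>+\<omega>. indicator {n} (cell_counts \<B> (\<eta> \<omega>)) \<partial>\<Omega>)"
    by (intro nn_integral_cong) (simp add: indicator_def)
  also have "\<dots> = (\<integral>\<^sup>+m. indicator {n} m \<partial>Pi_pmf \<B> 0 (\<lambda>B. poi (measure L B)))"
    by (rule nn_integral_cell_counts_marginal(1)[OF cB])
  also have "\<dots> = ennreal (pmf (Pi_pmf \<B> 0 (\<lambda>B. poi (measure L B))) n)"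
    by (simp add: emeasure_pmf_single)
  finally show ?thesis by simp
qed

text \<open>The Poisson recursion in the coordinate \<open>B\<close>. For count vectors that are
  nonzero somewhere off the cells both probabilities are 0.\<close>

lemma prob_counts_Suc:
  assumes cB: "cells L \<B>" and B: "B \<in> \<B>"
  shows "real (Suc (n B)) * prob {\<omega> \<in> space \<Omega>. cell_counts \<B> (\<eta> \<omega>) = n(B := Suc (n B))}
    = measure L B * prob {\<omega> \<in> space \<Omega>. cell_counts \<B> (\<eta> \<omega>) = n}"
proof -
  have fin: "finite \<B>" using cB by (simp add: cells_def)
  show ?thesis
  proof (cases "\<forall>C. C \<notin> \<B> \<longrightarrow> n C = 0")
    case True
    then have "\<forall>C. C \<notin> \<B> \<longrightarrow> (n(B := Suc (n B))) C = 0" using B by auto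
    then have 1: "prob {\<omega> \<in> space \<Omega>. cell_counts \<B> (\<eta> \<omega>) = n(B := Suc (n B))}
        = pmf (poi (measure L B)) (Suc (n B)) * (\<Prod>C\<in>\<B> - {B}. pmf (poi (measure L C)) ((n(B := Suc (n B))) C))"
      unfolding prob_counts[OF cB] by (subst pmf_Pi'[OF fin]) (simp_all add: prod.remove[OF fin B])
    have 2: "prob {\<omega> \<in> space \<Omega>. cell_counts \<B> (\<eta> \<omega>) = n}
        = pmf (poi (measure L B)) (n B) * (\<Prod>C\<in>\<B> - {B}. pmf (poi (measure L C)) (n C))"
      unfolding prob_counts[OF cB] using True by (subst pmf_Pi'[OF fin]) (simp_all add: prod.remove[OF fin B])
    have 3: "(\<Prod>C\<in>\<B> - {B}. pmf (poi (measure L C)) ((n(B := Suc (n B))) C)) = (\<Prod>C\<in>\<B> - {B}. pmf (poi (measure L C)) (n C))"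
      by (intro prod.cong) auto
    show ?thesis
      unfolding 1 2 3 mult.assoc[symmetric] by (subst pmf_poi_Suc) simp_all
  next
    case False
    then obtain C where C: "C \<notin> \<B>" "n C \<noteq> 0" by blast
    then have "C \<noteq> B" using B by auto
    then have "pmf (Pi_pmf \<B> 0 (\<lambda>B. poi (measure L B))) n = 0" "pmf (Pi_pmf \<B> 0 (\<lambda>B. poi (measure L B))) (n(B := Suc (n B))) = 0"
      using C by (auto intro!: pmf_Pi_outside[OF fin])
    then show ?thesis unfolding prob_counts[OF cB] by simp
  qed
qed

text \<open>Let m be the conditional mean and n' the vector raised by one at \<open>B\<close>. On
  the event with counts n' the mass of \<open>B\<close> is n(B) + 1, so (n(B) + 1) P(n') m(n') is an
  expectation weighted by that mass. Mecke turns it into an integral over \<open>B\<close> of means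
  of \<Phi> with a point added, on the event with counts n, and this is at most L(B) P(n) m(n).
  Since (n(B) + 1) P(n') = L(B) P(n), dividing gives the claim.\<close>

lemma cond_mean_decreasing:
  assumes cB: "cells L \<B>" and B: "B \<in> \<B>" "0 < measure L B"
    and \<Phi>[measurable]: "\<Phi> \<in> borel_measurable (point_measure_algebra M)" and \<Phi>K: "\<And>\<mu>. 0 \<le> \<Phi> \<mu>" "\<And>\<mu>. \<Phi> \<mu> \<le> K"
    and dec: "\<And>x. x \<in> space M \<Longrightarrow> AE \<omega> in \<Omega>. \<Phi> (measure_add M (\<eta> \<omega>) (return M x)) \<le> \<Phi> (\<eta> \<omega>)"
  shows "cond_mean (\<lambda>\<omega>. cell_counts \<B> (\<eta> \<omega>)) (\<lambda>\<omega>. \<Phi> (\<eta> \<omega>)) (n(B := Suc (n B)))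
    \<le> cond_mean (\<lambda>\<omega>. cell_counts \<B> (\<eta> \<omega>)) (\<lambda>\<omega>. \<Phi> (\<eta> \<omega>)) n"
proof -
  let ?N = "\<lambda>\<omega>. cell_counts \<B> (\<eta> \<omega>)" and ?Y = "\<lambda>\<omega>. \<Phi> (\<eta> \<omega>)" and ?n = "n(B := Suc (n B))"
  let ?P = "\<lambda>n. prob {\<omega> \<in> space \<Omega>. ?N \<omega> = n}"
  have Ym: "?Y \<in> borel_measurable \<Omega>" by measurable
  note N = measurable_counts[OF cB measurable_\<eta>]
  note cm = cond_mean_mult[OF N Ym \<Phi>K] and cm0 = cond_mean_nonneg[OF N Ym \<Phi>K]
  have Bs: "finite \<B>" "disjoint \<B>" "\<B> \<subseteq> sets M" "B \<in> finite_sets L" "\<B> \<subseteq> finite_sets L"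
    using cB B L by (auto simp: cells_def finite_sets_def)
  have BM[measurable]: "B \<in> sets M" using Bs B by auto
  show ?thesis
  \<comment> \<open>If \<open>n\<close> is a null atom then so is the raised vector, by the
    recursion, and both conditional means have the default value 0.\<close>
  proof (cases "?P n = 0")
    case True
    then have "?P ?n = 0" using prob_counts_Suc[OF cB B(1), of n] by simp
    then show ?thesis using True by (simp add: cond_mean_def)
  next
    case False
    then have Pn: "0 < ?P n" by (simp add: less_le)
    have supp: "n C = 0" if "C \<notin> \<B>" for C
    proof (rule ccontr)
      assume "n C \<noteq> 0"
      then have "{\<omega> \<in> space \<Omega>. ?N \<omega> = n} = {}" using that by (auto simp: cell_counts_def)
      then have "?P n = 0" by (simp only: measure_empty)
      then show False using False by contradiction
    qed
    then have supp': "?n C = 0" if "C \<notin> \<B>" for C using that B by auto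
    let ?E = "{\<mu> \<in> point_measures M. \<forall>C\<in>\<B>. emeasure \<mu> C = of_nat (?n C)}"
    have E: "?E \<in> sets (point_measure_algebra M)"
    proof -
      have "{\<mu> \<in> space (point_measure_algebra M). \<forall>C\<in>\<B>. emeasure \<mu> C = of_nat (?n C)} \<in> sets (point_measure_algebra M)"
      proof (rule sets.sets_Collect_finite_All)
        fix C assume "C \<in> \<B>"
        then have [measurable]: "C \<in> sets M" using Bs by auto
        show "{\<mu> \<in> space (point_measure_algebra M). emeasure \<mu> C = of_nat (?n C)} \<in> sets (point_measure_algebra M)" by measurable
      qed (rule Bs)
      then show ?thesis by simp
    qed
    \<comment> \<open>The indicator prescribes the raised counts. For the configuration with a point
      added in \<open>B\<close> it becomes, almost surely, the indicator of the original
      counts.\<close>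
    define G where "G \<mu> = ennreal (\<Phi> \<mu>) * indicator ?E \<mu>" for \<mu>
    have G: "G \<in> borel_measurable (point_measure_algebra M)"
      unfolding G_def using E by measurable
    have fin: "AE \<omega> in \<Omega>. \<omega> \<in> space \<Omega> \<and> (\<forall>C\<in>\<B>. emeasure (\<eta> \<omega>) C \<noteq> \<infinity>)"
    proof (intro AE_conjI AE_space AE_finite_allI Bs)
      show "AE \<omega> in \<Omega>. emeasure (\<eta> \<omega>) C \<noteq> \<infinity>" if "C \<in> \<B>" for C
        using AE_finite[of C] that Bs by auto
    qed
    have ex: "ennreal (expectation (\<lambda>\<omega>. ?Y \<omega> * indicator {k} (?N \<omega>))) = (\<integral>\<^sup>+\<omega>. ennreal (?Y \<omega>) * indicator {k} (?N \<omega>) \<partial>\<Omega>)" for k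
      by (rule nn_integral_restricted_real[OF N Ym \<Phi>K countable_finite_support[OF Bs(1), of 0] _ Ym \<Phi>K, symmetric])
        (simp add: cell_counts_def)
    have "ennreal (real (Suc (n B))) * ennreal (expectation (\<lambda>\<omega>. ?Y \<omega> * indicator {?n} (?N \<omega>)))
        = (\<integral>\<^sup>+\<omega>. ennreal (real (Suc (n B))) * (ennreal (?Y \<omega>) * indicator {?n} (?N \<omega>)) \<partial>\<Omega>)"
      unfolding ex
      by (intro nn_integral_cmult[symmetric] borel_measurable_times_ennreal measurable_compose[OF Ym measurable_ennreal]
          measurable_indicator_value[OF N Ym \<Phi>K])
    also have "\<dots> = (\<integral>\<^sup>+\<omega>. emeasure (\<eta> \<omega>) B * G (\<eta> \<omega>) \<partial>\<Omega>)"
    proof (rule nn_integral_cong_AE)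
      show "AE \<omega> in \<Omega>. ennreal (real (Suc (n B))) * (ennreal (?Y \<omega>) * indicator {?n} (?N \<omega>)) = emeasure (\<eta> \<omega>) B * G (\<eta> \<omega>)"
        using fin
      proof eventually_elim
        case (elim \<omega>)
        then have pm: "\<eta> \<omega> \<in> point_measures M" using point_measures_processes by blast
        have "?N \<omega> = ?n \<longleftrightarrow> (\<forall>C\<in>\<B>. emeasure (\<eta> \<omega>) C = of_nat (?n C))"
          using elim supp' by (intro cell_counts_eq_iff[OF pm Bs(3)]) auto
        then have *: "?N \<omega> = ?n \<longleftrightarrow> \<eta> \<omega> \<in> ?E" using pm by blast
        show ?case
        proof (cases "?N \<omega> = ?n")
          case True
          then have "\<eta> \<omega> \<in> ?E" using * by blast
          then have "emeasure (\<eta> \<omega>) B = of_nat (Suc (n B))" using B by auto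
          then show ?thesis using True \<open>\<eta> \<omega> \<in> ?E\<close> unfolding G_def
            by (simp add: ennreal_of_nat_eq_real_of_nat del: of_nat_Suc mem_Collect_eq)
        next
          case False
          then have "\<eta> \<omega> \<notin> ?E" using * by blast
          then show ?thesis using False unfolding G_def by (simp del: mem_Collect_eq)
        qed
      qed
    qed
    also have "\<dots> = (\<integral>\<^sup>+x. indicator B x * (\<integral>\<^sup>+\<omega>. G (measure_add M (\<eta> \<omega>) (return M x)) \<partial>\<Omega>) \<partial>L)"
      by (rule mecke[OF P pp sf L Bs(4) G])
    also have "\<dots> \<le> (\<integral>\<^sup>+x. indicator B x * (\<integral>\<^sup>+\<omega>. ennreal (?Y \<omega>) * indicator {n} (?N \<omega>) \<partial>\<Omega>) \<partial>L)"
    proof (intro nn_integral_mono)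
      fix x assume "x \<in> space L"
      then have x: "x \<in> space M" using sets_eq_imp_space_eq[OF L] by simp
      show "indicator B x * (\<integral>\<^sup>+\<omega>. G (measure_add M (\<eta> \<omega>) (return M x)) \<partial>\<Omega>)
          \<le> indicator B x * (\<integral>\<^sup>+\<omega>. ennreal (?Y \<omega>) * indicator {n} (?N \<omega>) \<partial>\<Omega>)"
      proof (cases "x \<in> B")
        case xB: True
        have "(\<integral>\<^sup>+\<omega>. G (measure_add M (\<eta> \<omega>) (return M x)) \<partial>\<Omega>) \<le> (\<integral>\<^sup>+\<omega>. ennreal (?Y \<omega>) * indicator {n} (?N \<omega>) \<partial>\<Omega>)"
        proof (rule nn_integral_mono_AE)
          show "AE \<omega> in \<Omega>. G (measure_add M (\<eta> \<omega>) (return M x)) \<le> ennreal (?Y \<omega>) * indicator {n} (?N \<omega>)"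
            using fin dec[OF x]
          proof eventually_elim
            case (elim \<omega>)
            then have pm: "\<eta> \<omega> \<in> point_measures M" using point_measures_processes by blast
            have add: "emeasure (measure_add M (\<eta> \<omega>) (return M x)) C = of_nat (?n C) \<longleftrightarrow> emeasure (\<eta> \<omega>) C = of_nat (n C)"
              if C: "C \<in> \<B>" for C
            proof -
              have CM: "C \<in> sets M" using C Bs by auto
              have xC: "x \<in> C \<longleftrightarrow> C = B" using disjointD[OF Bs(2) C B(1)] xB by auto
              have "emeasure (measure_add M (\<eta> \<omega>) (return M x)) C = emeasure (\<eta> \<omega>) C + of_bool (C = B)"
                using emeasure_measure_add_point_measures[OF pm return_point_measures[OF x] CM] CM xC by (simp add: indicator_def)
              moreover have "emeasure (\<eta> \<omega>) B + 1 = of_nat (Suc (n B)) \<longleftrightarrow> emeasure (\<eta> \<omega>) B = of_nat (n B)"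
                by (simp add: add.commute ennreal_add_left_cancel)
              ultimately show ?thesis by (cases "C = B") auto
            qed
            have "?N \<omega> = n \<longleftrightarrow> (\<forall>C\<in>\<B>. emeasure (\<eta> \<omega>) C = of_nat (n C))"
              using elim(1) supp by (intro cell_counts_eq_iff[OF pm Bs(3)]) auto
            also have "\<dots> \<longleftrightarrow> (\<forall>C\<in>\<B>. emeasure (measure_add M (\<eta> \<omega>) (return M x)) C = of_nat (?n C))"
              using add by (intro ball_cong refl) blast
            also have "\<dots> \<longleftrightarrow> measure_add M (\<eta> \<omega>) (return M x) \<in> ?E"
              using measure_add_point_measures[OF pm return_point_measures[OF x]] by blast
            finally have *: "measure_add M (\<eta> \<omega>) (return M x) \<in> ?E \<longleftrightarrow> ?N \<omega> = n" by blast
            show ?case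
            proof (cases "?N \<omega> = n")
              case True
              then show ?thesis using * elim(2) unfolding G_def
                by (simp add: ennreal_leI del: mem_Collect_eq)
            next
              case False
              then have "measure_add M (\<eta> \<omega>) (return M x) \<notin> ?E" using * by blast
              then show ?thesis unfolding G_def by (simp del: mem_Collect_eq)
            qed
          qed
        qed
        then show ?thesis by (rule mult_left_mono) simp
      qed simp
    qed
    also have "\<dots> = emeasure L B * (\<integral>\<^sup>+\<omega>. ennreal (?Y \<omega>) * indicator {n} (?N \<omega>) \<partial>\<Omega>)"
      using BM L by (simp add: nn_integral_multc)
    also have "\<dots> = ennreal (measure L B) * ennreal (expectation (\<lambda>\<omega>. ?Y \<omega> * indicator {n} (?N \<omega>)))"
      using Bs(4) unfolding ex by (simp add: emeasure_eq_ennreal_measure finite_sets_def)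
    finally have "ennreal (real (Suc (n B))) * ennreal (cond_mean ?N ?Y ?n * ?P ?n) \<le> ennreal (measure L B) * ennreal (cond_mean ?N ?Y n * ?P n)"
      unfolding cm .
    then have "ennreal (real (Suc (n B)) * (cond_mean ?N ?Y ?n * ?P ?n)) \<le> ennreal (measure L B * (cond_mean ?N ?Y n * ?P n))"
      by (simp add: ennreal_mult')
    then have "real (Suc (n B)) * (cond_mean ?N ?Y ?n * ?P ?n) \<le> measure L B * (cond_mean ?N ?Y n * ?P n)"
      using cm0 by (subst (asm) ennreal_le_iff) auto
    then have "cond_mean ?N ?Y ?n * (real (Suc (n B)) * ?P ?n) \<le> cond_mean ?N ?Y n * (measure L B * ?P n)"
      by (simp only: mult_ac)
    then have "cond_mean ?N ?Y ?n * (measure L B * ?P n) \<le> cond_mean ?N ?Y n * (measure L B * ?P n)"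
      unfolding prob_counts_Suc[OF cB B(1)] .
    then show ?thesis using B(2) Pn by simp
  qed
qed

section \<open>The hypercontractive inequality\<close>

lemma nn_integral_\<zeta>:
  assumes "g \<in> borel_measurable (point_measure_algebra M)"
  shows "(\<integral>\<^sup>+\<omega>. g (\<zeta> \<omega>) \<partial>\<Omega>) = (\<integral>\<^sup>+\<omega>. g (\<eta> \<omega>) \<partial>\<Omega>)"
proof -
  have "(\<integral>\<^sup>+\<omega>. g (\<zeta> \<omega>) \<partial>\<Omega>) = (\<integral>\<^sup>+\<mu>. g \<mu> \<partial>distr \<Omega> (point_measure_algebra M) \<zeta>)"
    using assms by (simp add: nn_integral_distr[OF measurable_\<zeta>])
  also have "\<dots> = (\<integral>\<^sup>+\<omega>. g (\<eta> \<omega>) \<partial>\<Omega>)"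
    unfolding distr_\<zeta> using assms by (simp add: nn_integral_distr[OF measurable_\<eta>])
  finally show ?thesis .
qed

lemma measurable_\<Sigma>_\<eta>: "f \<in> borel_measurable (point_measure_algebra M) \<Longrightarrow> (\<lambda>\<omega>. f (\<eta> \<omega>)) \<in> borel_measurable \<Sigma>"
  unfolding \<Sigma>_def
  by (rule measurable_compose[OF measurable_vimage_algebra1]) (use point_measures_processes in auto)

text \<open>On finite masses an approximant is a function of the counts in any cells that refine its
  sets, so the near-optimality of conditional means applies.\<close>

lemma cond_mean_approximant:
  assumes h: "approximant \<epsilon> Y \<C> h" and r: "refines \<B> \<C>" and cB: "cells L \<B>"
    and Y: "Y \<in> borel_measurable \<Omega>" "\<And>\<omega>. 0 \<le> Y \<omega>" "\<And>\<omega>. Y \<omega> \<le> K"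
  shows "(\<integral>\<^sup>+\<omega>. ennreal \<bar>Y \<omega> - cond_mean (\<lambda>\<omega>. cell_counts \<B> (\<eta> \<omega>)) Y (cell_counts \<B> (\<eta> \<omega>))\<bar> \<partial>\<Omega>) \<le> 2 * ennreal \<epsilon>"
proof -
  note h = approximantD[OF h] and N = measurable_counts[OF cB measurable_\<eta>]
  have B: "finite \<B>" "\<B> \<subseteq> sets M" "\<B> \<subseteq> finite_sets L" using cB L by (auto simp: cells_def finite_sets_def)
  obtain h' where h': "\<forall>\<mu>\<in>point_measures M. (\<forall>B\<in>\<B>. emeasure \<mu> B \<noteq> \<infinity>) \<longrightarrow> h \<mu> = h' (cell_counts \<B> \<mu>)"
    using determined_by_factor[OF determined_by_refines[OF h(3) r cB L] B(2)] by (elim exE)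
  have fin: "AE \<omega> in \<Omega>. \<omega> \<in> space \<Omega> \<and> (\<forall>C\<in>\<B>. emeasure (\<eta> \<omega>) C \<noteq> \<infinity>)"
  proof (intro AE_conjI AE_space AE_finite_allI B)
    show "AE \<omega> in \<Omega>. emeasure (\<eta> \<omega>) C \<noteq> \<infinity>" if "C \<in> \<B>" for C
      using AE_finite[of C] that B by auto
  qed
  have "(\<integral>\<^sup>+\<omega>. ennreal \<bar>Y \<omega> - cond_mean (\<lambda>\<omega>. cell_counts \<B> (\<eta> \<omega>)) Y (cell_counts \<B> (\<eta> \<omega>))\<bar> \<partial>\<Omega>)
      \<le> 2 * (\<integral>\<^sup>+\<omega>. ennreal \<bar>Y \<omega> - h' (cell_counts \<B> (\<eta> \<omega>))\<bar> \<partial>\<Omega>)"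
    by (rule cond_mean_L1_approx[OF N Y countable_finite_support[OF B(1), of 0]]) (simp add: cell_counts_def)
  also have "(\<integral>\<^sup>+\<omega>. ennreal \<bar>Y \<omega> - h' (cell_counts \<B> (\<eta> \<omega>))\<bar> \<partial>\<Omega>) = (\<integral>\<^sup>+\<omega>. ennreal \<bar>Y \<omega> - h (\<eta> \<omega>)\<bar> \<partial>\<Omega>)"
  proof (rule nn_integral_cong_AE)
    show "AE \<omega> in \<Omega>. ennreal \<bar>Y \<omega> - h' (cell_counts \<B> (\<eta> \<omega>))\<bar> = ennreal \<bar>Y \<omega> - h (\<eta> \<omega>)\<bar>"
      using fin
    proof eventually_elim
      case (elim \<omega>)
      then have "h (\<eta> \<omega>) = h' (cell_counts \<B> (\<eta> \<omega>))" using point_measures_processes(1) h' by blast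
      then show ?case by simp
    qed
  qed
  also have "\<dots> = ennreal (expectation (\<lambda>\<omega>. \<bar>Y \<omega> - h (\<eta> \<omega>)\<bar>))"
  proof (rule nn_integral_eq_integral)
    have "integrable \<Omega> Y" using Y by (intro integrable_const_bound[where B=K]) auto
    then show "integrable \<Omega> (\<lambda>\<omega>. \<bar>Y \<omega> - h (\<eta> \<omega>)\<bar>)" using h(5) by (intro integrable_abs Bochner_Integration.integrable_diff)
  qed simp
  also have "2 * \<dots> \<le> 2 * ennreal \<epsilon>" using h(6) by (intro mult_left_mono ennreal_leI) auto
  finally show ?thesis by (simp add: mult_left_mono)
qed

lemma expectation_cond_mean_powr_le:
  assumes cB: "cells L \<B>" and Y: "Y \<in> borel_measurable \<Omega>" "\<And>\<omega>. 0 \<le> Y \<omega>" "\<And>\<omega>. Y \<omega> \<le> K" and p: "1 < p"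
  shows "measure_pmf.expectation (Pi_pmf \<B> 0 (\<lambda>B. poi (measure L B))) (\<lambda>n. cond_mean (\<lambda>\<omega>. cell_counts \<B> (\<eta> \<omega>)) Y n powr p)
    \<le> expectation (\<lambda>\<omega>. Y \<omega> powr p)"
proof -
  let ?\<pi> = "Pi_pmf \<B> 0 (\<lambda>B. poi (measure L B))"
  let ?f = "\<lambda>n. cond_mean (\<lambda>\<omega>. cell_counts \<B> (\<eta> \<omega>)) Y n powr p"
  note N = measurable_counts[OF cB measurable_\<eta>]
  have B: "finite \<B>" using cB by (simp add: cells_def)
  have f: "0 \<le> ?f n" "?f n \<le> K powr p" for n
    using cond_mean_nonneg[OF N Y] cond_mean_le[OF N Y] p by (auto intro!: powr_mono2)
  have YK: "Y \<omega> powr p \<le> K powr p" for \<omega> using Y p by (intro powr_mono2) auto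
  have iY: "integrable \<Omega> (\<lambda>\<omega>. Y \<omega> powr p)"
    using Y(1) YK by (intro integrable_const_bound[where B="K powr p"]) auto
  have "ennreal (measure_pmf.expectation ?\<pi> ?f) = (\<integral>\<^sup>+n. ennreal (?f n) \<partial>?\<pi>)"
    using f by (intro nn_integral_eq_integral[symmetric] expectation_pmf_bounded(1)[where B="K powr p"]) auto
  also have "\<dots> = (\<integral>\<^sup>+\<omega>. ennreal (?f (cell_counts \<B> (\<eta> \<omega>))) \<partial>\<Omega>)"
    by (rule nn_integral_cell_counts_marginal(1)[OF cB, symmetric])
  also have "\<dots> \<le> (\<integral>\<^sup>+\<omega>. ennreal (Y \<omega> powr p) \<partial>\<Omega>)"
    by (rule nn_integral_cond_mean_powr_le[OF N Y countable_finite_support[OF B, of 0] _ p]) (simp add: cell_counts_def)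
  also have "\<dots> = ennreal (expectation (\<lambda>\<omega>. Y \<omega> powr p))"
    using iY by (intro nn_integral_eq_integral) auto
  finally show ?thesis by (simp add: integral_nonneg_AE ennreal_le_iff)
qed

text \<open>Both functions are replaced by their conditional means given the \<eta>-counts in common
  cells, the first one then being evaluated at the \<zeta>-counts. For the conditional means the
  claim is the bound for products of Poisson couplings, and Jensen returns to the norms of \<Phi>
  and \<open>G\<close>.\<close>

lemma bounded_inequality:
  assumes p: "1 < p" and q: "q = 1 + (p - 1) / u"
    and \<Phi>: "\<Phi> \<in> borel_measurable (point_measure_algebra M)" and \<Phi>K: "\<And>\<mu>. 0 \<le> \<Phi> \<mu>" "\<And>\<mu>. \<Phi> \<mu> \<le> K"
    and dec: "\<And>x. x \<in> space M \<Longrightarrow> AE \<omega> in \<Omega>. \<Phi> (measure_add M (\<eta> \<omega>) (return M x)) \<le> \<Phi> (\<eta> \<omega>)"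
    and G: "G \<in> borel_measurable \<Sigma>" and GK: "\<And>\<omega>. 0 \<le> G \<omega>" "\<And>\<omega>. G \<omega> \<le> K"
  shows "expectation (\<lambda>\<omega>. \<Phi> (\<zeta> \<omega>) * G \<omega>)
    \<le> expectation (\<lambda>\<omega>. \<Phi> (\<eta> \<omega>) powr p) powr (1 / p) * expectation (\<lambda>\<omega>. G \<omega> powr (q / (q - 1))) powr (1 - 1 / q)"
proof (rule field_le_epsilon)
  define r where "r = q / (q - 1)"
  define R where "R = expectation (\<lambda>\<omega>. \<Phi> (\<eta> \<omega>) powr p) powr (1 / p) * expectation (\<lambda>\<omega>. G \<omega> powr r) powr (1 - 1 / q)"
  have q1: "1 < q" using p u by (simp add: q)
  then have r1: "1 < r" and rq: "r * (1 - 1 / q) = 1" by (auto simp: r_def field_simps)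
  have K0: "0 \<le> K" using GK(1)[of undefined] GK(2)[of undefined] by linarith
  fix \<epsilon> :: real assume "0 < \<epsilon>"
  \<comment> \<open>Each replacement costs at most \<open>2 * e\<close> in mean and is multiplied by
    a function bounded by \<open>K\<close>, in total \<open>4 * K * e\<close>; the summand 1 keeps
    the denominator positive.\<close>
  define e where "e = \<epsilon> / (4 * (K + 1))"
  have e: "0 < e" using \<open>0 < \<epsilon>\<close> K0 by (simp add: e_def)
  have Gm: "G \<in> borel_measurable \<Omega>" by (rule measurable_from_subalg[OF subalgebra_\<Sigma> G])
  have Ym: "(\<lambda>\<omega>. \<Phi> (\<eta> \<omega>)) \<in> borel_measurable \<Omega>" by (rule measurable_compose[OF measurable_\<eta> \<Phi>])
  have Zm: "(\<lambda>\<omega>. \<Phi> (\<zeta> \<omega>)) \<in> borel_measurable \<Omega>" by (rule measurable_compose[OF measurable_\<zeta> \<Phi>])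
  have "approximable (\<lambda>\<omega>. \<Phi> (\<eta> \<omega>))"
  proof (rule approximable_\<Sigma>[OF measurable_\<Sigma>_\<eta>[OF \<Phi>]])
    show "integrable \<Omega> (\<lambda>\<omega>. \<Phi> (\<eta> \<omega>))"
      by (rule integrable_const_bound[where B=K, OF _ Ym]) (simp add: \<Phi>K)
  qed
  then obtain \<C>1 h1 where h1: "approximant e (\<lambda>\<omega>. \<Phi> (\<eta> \<omega>)) \<C>1 h1" by (rule approximableE[OF _ e])
  have "approximable G"
  proof (rule approximable_\<Sigma>[OF G])
    show "integrable \<Omega> G" by (rule integrable_const_bound[where B=K, OF _ Gm]) (simp add: GK)
  qed
  then obtain \<C>2 h2 where h2: "approximant e G \<C>2 h2" by (rule approximableE[OF _ e])
  have "finite (\<C>1 \<union> \<C>2)" "\<C>1 \<union> \<C>2 \<subseteq> finite_sets L"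
    using approximantD(1,2)[OF h1] approximantD(1,2)[OF h2] by simp_all
  then obtain \<B> where cB: "cells L \<B>" and "refines \<B> (\<C>1 \<union> \<C>2)"
    using cells_refinement by blast
  then have r1': "refines \<B> \<C>1" and r2': "refines \<B> \<C>2" by (simp_all add: refines_def ball_Un)
  have B: "finite \<B>" "\<B> \<subseteq> sets M" using cB L by (auto simp: cells_def finite_sets_def)
  let ?N = "\<lambda>\<omega>. cell_counts \<B> (\<eta> \<omega>)" and ?N' = "\<lambda>\<omega>. cell_counts \<B> (\<zeta> \<omega>)"
  let ?\<pi> = "Pi_pmf \<B> 0 (\<lambda>B. poi (measure L B))"
  note N = measurable_counts[OF cB measurable_\<eta>] and N' = measurable_counts[OF cB measurable_\<zeta>]
  define f1 f2 where "f1 = cond_mean ?N (\<lambda>\<omega>. \<Phi> (\<eta> \<omega>))" and "f2 = cond_mean ?N G"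
  have f1: "0 \<le> f1 n" "f1 n \<le> K" for n
    unfolding f1_def by (rule cond_mean_nonneg[OF N Ym \<Phi>K] cond_mean_le[OF N Ym \<Phi>K])+
  have f2: "0 \<le> f2 n" "f2 n \<le> K" for n
    unfolding f2_def by (rule cond_mean_nonneg[OF N Gm GK] cond_mean_le[OF N Gm GK])+
  have A1: "(\<integral>\<^sup>+\<omega>. ennreal \<bar>\<Phi> (\<eta> \<omega>) - f1 (?N \<omega>)\<bar> \<partial>\<Omega>) \<le> 2 * ennreal e"
    unfolding f1_def by (rule cond_mean_approximant[OF h1 r1' cB Ym \<Phi>K])
  have A2: "(\<integral>\<^sup>+\<omega>. ennreal \<bar>G \<omega> - f2 (?N \<omega>)\<bar> \<partial>\<Omega>) \<le> 2 * ennreal e"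
    unfolding f2_def by (rule cond_mean_approximant[OF h2 r2' cB Gm GK])
  \<comment> \<open>The error is a measurable function of the point measure, so by equality of the
    laws it has the same mean at \<zeta> as at \<eta>.\<close>
  have A3: "(\<integral>\<^sup>+\<omega>. ennreal \<bar>\<Phi> (\<zeta> \<omega>) - f1 (?N' \<omega>)\<bar> \<partial>\<Omega>) \<le> 2 * ennreal e"
  proof -
    have "(\<lambda>\<mu>. cell_counts \<B> \<mu>) \<in> point_measure_algebra M \<rightarrow>\<^sub>M count_space UNIV"
      using measurable_cell_counts[OF measurable_ident B] by simp
    then have "(\<lambda>\<mu>. f1 (cell_counts \<B> \<mu>)) \<in> borel_measurable (point_measure_algebra M)"
      by (rule measurable_compose) simp
    then have "(\<lambda>\<mu>. ennreal \<bar>\<Phi> \<mu> - f1 (cell_counts \<B> \<mu>)\<bar>) \<in> borel_measurable (point_measure_algebra M)"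
      using \<Phi> by (intro measurable_compose[OF _ measurable_ennreal] borel_measurable_abs borel_measurable_diff)
    from nn_integral_\<zeta>[OF this] A1 show ?thesis by simp
  qed
  have main: "(\<integral>\<^sup>+\<omega>. ennreal (f1 (?N' \<omega>) * f2 (?N \<omega>)) \<partial>\<Omega>) \<le> ennreal R"
  proof -
    define \<phi> \<gamma> where "\<phi> n = f1 n powr p" and "\<gamma> n = f2 n powr r" for n
    define B0 where "B0 = max (K powr p) (K powr r)"
    have \<phi>: "0 \<le> \<phi> n" "\<phi> n \<le> B0" for n
    proof -
      have "\<phi> n \<le> K powr p" unfolding \<phi>_def using f1 p by (intro powr_mono2) auto
      then show "\<phi> n \<le> B0" by (simp add: B0_def)
    qed (simp add: \<phi>_def)
    have \<gamma>: "0 \<le> \<gamma> n" "\<gamma> n \<le> B0" for n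
    proof -
      have "\<gamma> n \<le> K powr r" unfolding \<gamma>_def using f2 r1 by (intro powr_mono2) auto
      then show "\<gamma> n \<le> B0" by (simp add: B0_def)
    qed (simp add: \<gamma>_def)
    have roots: "\<phi> n powr (1 / p) = f1 n" "\<gamma> n powr (1 - 1 / q) = f2 n" for n
      using f1[of n] f2[of n] p rq by (simp_all add: \<phi>_def \<gamma>_def powr_powr)
    let ?D = "{\<phi>. \<forall>i\<in>\<B>. 0 < measure L i \<longrightarrow> (\<forall>n. \<phi> (n(i := Suc (n i))) \<le> \<phi> n)} :: (('a set \<Rightarrow> nat) \<Rightarrow> real) set"
    have "\<phi> \<in> ?D"
    proof (intro CollectI ballI impI allI)
      fix C n assume C: "C \<in> \<B>" "0 < measure L C"
      have "f1 (n(C := Suc (n C))) \<le> f1 n"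
        unfolding f1_def by (rule cond_mean_decreasing[OF cB C \<Phi> \<Phi>K dec])
      then show "\<phi> (n(C := Suc (n C))) \<le> \<phi> n" unfolding \<phi>_def using f1 p by (intro powr_mono2) auto
    qed
    from coupling_boundD[OF coupling_bound_Pi_poisson[OF p u q B(1), of "\<lambda>B. measure L B"] this \<phi> \<gamma>]
    have "(\<integral>\<^sup>+(x, x'). ennreal (\<phi> x' powr (1 / p) * \<gamma> x powr (1 - 1 / q))
        \<partial>map_pmf (\<lambda>h. (\<lambda>i. fst (h i), \<lambda>i. snd (h i))) (Pi_pmf \<B> (0, 0) (\<lambda>i. poisson_coupling u (measure L i))))
      \<le> ennreal (1 * measure_pmf.expectation ?\<pi> \<phi> powr (1 / p) * measure_pmf.expectation ?\<pi> \<gamma> powr (1 - 1 / q))"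
      by simp
    moreover have "(\<integral>\<^sup>+\<omega>. ennreal (f1 (?N' \<omega>) * f2 (?N \<omega>)) \<partial>\<Omega>) = (\<integral>\<^sup>+(x, x'). ennreal (\<phi> x' powr (1 / p) * \<gamma> x powr (1 - 1 / q))
        \<partial>map_pmf (\<lambda>h. (\<lambda>i. fst (h i), \<lambda>i. snd (h i))) (Pi_pmf \<B> (0, 0) (\<lambda>i. poisson_coupling u (measure L i))))"
      unfolding roots using nn_integral_cell_counts[OF cB, of "\<lambda>z. ennreal (f1 (snd z) * f2 (fst z))"]
      by (simp add: case_prod_unfold)
    moreover have "measure_pmf.expectation ?\<pi> \<phi> powr (1 / p) * measure_pmf.expectation ?\<pi> \<gamma> powr (1 - 1 / q) \<le> R"
    proof -
      have "measure_pmf.expectation ?\<pi> \<phi> \<le> expectation (\<lambda>\<omega>. \<Phi> (\<eta> \<omega>) powr p)"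
        unfolding \<phi>_def f1_def by (rule expectation_cond_mean_powr_le[OF cB Ym \<Phi>K p])
      moreover have "measure_pmf.expectation ?\<pi> \<gamma> \<le> expectation (\<lambda>\<omega>. G \<omega> powr r)"
        unfolding \<gamma>_def f2_def by (rule expectation_cond_mean_powr_le[OF cB Gm GK r1])
      moreover have "0 \<le> measure_pmf.expectation ?\<pi> \<phi>" "0 \<le> measure_pmf.expectation ?\<pi> \<gamma>"
        using \<phi> \<gamma> by (simp_all add: integral_nonneg_AE)
      ultimately show ?thesis
        unfolding R_def using p q1 by (intro mult_mono powr_mono2) auto
    qed
    ultimately show ?thesis by (auto intro: order_trans ennreal_leI)
  qed
  have m12: "(\<lambda>\<omega>. ennreal (f1 (?N' \<omega>) * f2 (?N \<omega>))) \<in> borel_measurable \<Omega>"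
    and m1: "(\<lambda>\<omega>. ennreal \<bar>\<Phi> (\<zeta> \<omega>) - f1 (?N' \<omega>)\<bar>) \<in> borel_measurable \<Omega>"
    and m2: "(\<lambda>\<omega>. ennreal \<bar>G \<omega> - f2 (?N \<omega>)\<bar>) \<in> borel_measurable \<Omega>"
  proof -
    have "(\<lambda>\<omega>. f1 (?N' \<omega>)) \<in> borel_measurable \<Omega>" by (rule measurable_compose[OF N']) simp
    moreover have "(\<lambda>\<omega>. f2 (?N \<omega>)) \<in> borel_measurable \<Omega>" by (rule measurable_compose[OF N]) simp
    ultimately have x: "(\<lambda>\<omega>. f1 (?N' \<omega>) * f2 (?N \<omega>)) \<in> borel_measurable \<Omega>"
      "(\<lambda>\<omega>. \<bar>\<Phi> (\<zeta> \<omega>) - f1 (?N' \<omega>)\<bar>) \<in> borel_measurable \<Omega>" "(\<lambda>\<omega>. \<bar>G \<omega> - f2 (?N \<omega>)\<bar>) \<in> borel_measurable \<Omega>"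
      using Gm Zm by simp_all
    show "(\<lambda>\<omega>. ennreal (f1 (?N' \<omega>) * f2 (?N \<omega>))) \<in> borel_measurable \<Omega>"
      "(\<lambda>\<omega>. ennreal \<bar>\<Phi> (\<zeta> \<omega>) - f1 (?N' \<omega>)\<bar>) \<in> borel_measurable \<Omega>"
      "(\<lambda>\<omega>. ennreal \<bar>G \<omega> - f2 (?N \<omega>)\<bar>) \<in> borel_measurable \<Omega>"
      by (rule x[THEN measurable_compose, OF measurable_ennreal])+
  qed
  have "ennreal (expectation (\<lambda>\<omega>. \<Phi> (\<zeta> \<omega>) * G \<omega>)) = (\<integral>\<^sup>+\<omega>. ennreal (\<Phi> (\<zeta> \<omega>) * G \<omega>) \<partial>\<Omega>)"
  proof (rule nn_integral_eq_integral[symmetric])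
    have "\<bar>\<Phi> (\<zeta> \<omega>) * G \<omega>\<bar> \<le> K * K" for \<omega>
      using \<Phi>K GK K0 by (auto simp: abs_mult intro!: mult_mono)
    then show "integrable \<Omega> (\<lambda>\<omega>. \<Phi> (\<zeta> \<omega>) * G \<omega>)"
      by (intro integrable_const_bound[where B="K * K"] borel_measurable_times Zm Gm) simp
  qed (simp add: \<Phi>K GK)
  also have "\<dots> \<le> (\<integral>\<^sup>+\<omega>. ennreal (f1 (?N' \<omega>) * f2 (?N \<omega>)) + (ennreal K * ennreal \<bar>\<Phi> (\<zeta> \<omega>) - f1 (?N' \<omega>)\<bar> + ennreal K * ennreal \<bar>G \<omega> - f2 (?N \<omega>)\<bar>) \<partial>\<Omega>)"
  proof (rule nn_integral_mono)
    fix \<omega>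
    \<comment> \<open>The difference of the products is (\<Phi> - f1) G + f1 (G - f2), and both
      \<open>G\<close> and \<open>f1\<close> lie between 0 and \<open>K\<close>.\<close>
    have "(\<Phi> (\<zeta> \<omega>) - f1 (?N' \<omega>)) * G \<omega> \<le> K * \<bar>\<Phi> (\<zeta> \<omega>) - f1 (?N' \<omega>)\<bar>"
      using GK[of \<omega>] K0 mult_mono[of "\<Phi> (\<zeta> \<omega>) - f1 (?N' \<omega>)" "\<bar>\<Phi> (\<zeta> \<omega>) - f1 (?N' \<omega>)\<bar>" "G \<omega>" K] by (simp add: mult.commute)
    moreover have "f1 (?N' \<omega>) * (G \<omega> - f2 (?N \<omega>)) \<le> K * \<bar>G \<omega> - f2 (?N \<omega>)\<bar>"
    proof -
      have "f1 (?N' \<omega>) * (G \<omega> - f2 (?N \<omega>)) \<le> f1 (?N' \<omega>) * \<bar>G \<omega> - f2 (?N \<omega>)\<bar>"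
        using f1 by (intro mult_left_mono) auto
      also have "\<dots> \<le> K * \<bar>G \<omega> - f2 (?N \<omega>)\<bar>" using f1 by (intro mult_right_mono) auto
      finally show ?thesis .
    qed
    ultimately have "\<Phi> (\<zeta> \<omega>) * G \<omega> \<le> f1 (?N' \<omega>) * f2 (?N \<omega>) + (K * \<bar>\<Phi> (\<zeta> \<omega>) - f1 (?N' \<omega>)\<bar> + K * \<bar>G \<omega> - f2 (?N \<omega>)\<bar>)"
      by (simp add: algebra_simps)
    then show "ennreal (\<Phi> (\<zeta> \<omega>) * G \<omega>) \<le> ennreal (f1 (?N' \<omega>) * f2 (?N \<omega>)) + (ennreal K * ennreal \<bar>\<Phi> (\<zeta> \<omega>) - f1 (?N' \<omega>)\<bar> + ennreal K * ennreal \<bar>G \<omega> - f2 (?N \<omega>)\<bar>)"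
      using K0 f1 f2 by (simp add: ennreal_mult'[symmetric] ennreal_plus[symmetric] ennreal_leI del: ennreal_plus)
  qed
  also have "\<dots> = (\<integral>\<^sup>+\<omega>. ennreal (f1 (?N' \<omega>) * f2 (?N \<omega>)) \<partial>\<Omega>)
     + (ennreal K * (\<integral>\<^sup>+\<omega>. ennreal \<bar>\<Phi> (\<zeta> \<omega>) - f1 (?N' \<omega>)\<bar> \<partial>\<Omega>) + ennreal K * (\<integral>\<^sup>+\<omega>. ennreal \<bar>G \<omega> - f2 (?N \<omega>)\<bar> \<partial>\<Omega>))"
    using m1 m2 m12 by (simp add: nn_integral_add nn_integral_cmult)
  also have "\<dots> \<le> ennreal R + (ennreal K * (2 * ennreal e) + ennreal K * (2 * ennreal e))"
    using main A2 A3 by (intro add_mono mult_left_mono) auto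
  also have "\<dots> = ennreal (R + 4 * K * e)"
  proof -
    have "0 \<le> R" by (simp add: R_def)
    moreover have "2 * ennreal e = ennreal (2 * e)" using e by (simp add: ennreal_mult')
    ultimately show ?thesis
      using K0 e by (simp add: ennreal_mult'[symmetric] ennreal_plus[symmetric] algebra_simps del: ennreal_plus)
  qed
  finally have "expectation (\<lambda>\<omega>. \<Phi> (\<zeta> \<omega>) * G \<omega>) \<le> R + 4 * K * e"
    using K0 e by (subst (asm) ennreal_le_iff) (auto simp: R_def)
  also have "4 * K * e \<le> \<epsilon>" using K0 \<open>0 < \<epsilon>\<close> by (simp add: e_def field_simps)
  finally show "expectation (\<lambda>\<omega>. \<Phi> (\<zeta> \<omega>) * G \<omega>)
    \<le> expectation (\<lambda>\<omega>. \<Phi> (\<eta> \<omega>) powr p) powr (1 / p) * expectation (\<lambda>\<omega>. G \<omega> powr (q / (q - 1))) powr (1 - 1 / q) + \<epsilon>"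
    by (simp add: R_def r_def)
qed

text \<open>The bounded case is applied to truncations of \<open>F\<close>, which inherit the
  decrease because truncation is monotone; dominated convergence with majorant a multiple of
  \<open>F (\<zeta> \<omega>)\<close> in absolute value removes the truncation.\<close>

lemma dual_inequality:
  assumes p: "1 < p" and q: "q = 1 + (p - 1) / u"
    and F: "F \<in> borel_measurable (point_measure_algebra M)" and F0: "AE \<omega> in \<Omega>. 0 \<le> F (\<eta> \<omega>)" "AE \<omega> in \<Omega>. 0 \<le> F (\<zeta> \<omega>)"
    and dec: "\<And>x. x \<in> space M \<Longrightarrow> AE \<omega> in \<Omega>. F (measure_add M (\<eta> \<omega>) (return M x)) \<le> F (\<eta> \<omega>)"
    and Fp: "integrable \<Omega> (\<lambda>\<omega>. \<bar>F (\<eta> \<omega>)\<bar> powr p)" and Fi: "integrable \<Omega> (\<lambda>\<omega>. F (\<zeta> \<omega>))"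
    and G: "G \<in> borel_measurable \<Sigma>" and GK: "\<And>\<omega>. 0 \<le> G \<omega>" "\<And>\<omega>. G \<omega> \<le> K"
  shows "expectation (\<lambda>\<omega>. F (\<zeta> \<omega>) * G \<omega>)
    \<le> expectation (\<lambda>\<omega>. \<bar>F (\<eta> \<omega>)\<bar> powr p) powr (1 / p) * expectation (\<lambda>\<omega>. G \<omega> powr (q / (q - 1))) powr (1 - 1 / q)"
proof -
  have K0: "0 \<le> K" using GK(1)[of undefined] GK(2)[of undefined] by linarith
  have Gm: "G \<in> borel_measurable \<Omega>" by (rule measurable_from_subalg[OF subalgebra_\<Sigma> G])
  \<comment> \<open>The maximum with 0 provides nonnegativity at every point measure, while
    \<open>F\<close> has it only almost surely along the processes.\<close>
  define \<Phi> where "\<Phi> k \<mu> = min (max (F \<mu>) 0) (real k)" for k :: nat and \<mu>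
  have \<Phi>m: "\<Phi> k \<in> borel_measurable (point_measure_algebra M)" for k
    unfolding \<Phi>_def using F by (intro borel_measurable_min borel_measurable_max borel_measurable_const)
  have \<Phi>b: "0 \<le> \<Phi> k \<mu>" "\<Phi> k \<mu> \<le> max (real k) K" "\<Phi> k \<mu> \<le> \<bar>F \<mu>\<bar>" for k \<mu>
    by (auto simp: \<Phi>_def)
  have GK': "G \<omega> \<le> max (real k) K" for \<omega> k using GK(2)[of \<omega>] by linarith
  have le: "expectation (\<lambda>\<omega>. \<Phi> k (\<zeta> \<omega>) * G \<omega>)
    \<le> expectation (\<lambda>\<omega>. \<bar>F (\<eta> \<omega>)\<bar> powr p) powr (1 / p) * expectation (\<lambda>\<omega>. G \<omega> powr (q / (q - 1))) powr (1 - 1 / q)" for k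
  proof -
    have "expectation (\<lambda>\<omega>. \<Phi> k (\<zeta> \<omega>) * G \<omega>)
      \<le> expectation (\<lambda>\<omega>. \<Phi> k (\<eta> \<omega>) powr p) powr (1 / p) * expectation (\<lambda>\<omega>. G \<omega> powr (q / (q - 1))) powr (1 - 1 / q)"
    proof (rule bounded_inequality[OF p q \<Phi>m \<Phi>b(1,2) _ G GK(1) GK'])
      show "AE \<omega> in \<Omega>. \<Phi> k (measure_add M (\<eta> \<omega>) (return M x)) \<le> \<Phi> k (\<eta> \<omega>)" if "x \<in> space M" for x
        using dec[OF that] by eventually_elim (auto simp: \<Phi>_def)
    qed
    also have "\<dots> \<le> expectation (\<lambda>\<omega>. \<bar>F (\<eta> \<omega>)\<bar> powr p) powr (1 / p) * expectation (\<lambda>\<omega>. G \<omega> powr (q / (q - 1))) powr (1 - 1 / q)"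
    proof (intro mult_right_mono powr_mono2)
      show "expectation (\<lambda>\<omega>. \<Phi> k (\<eta> \<omega>) powr p) \<le> expectation (\<lambda>\<omega>. \<bar>F (\<eta> \<omega>)\<bar> powr p)"
        using Fp \<Phi>b(1,3) p by (intro integral_mono_AE' AE_I2 powr_mono2) auto
    qed (use p in auto)
    finally show ?thesis .
  qed
  have "(\<lambda>k. expectation (\<lambda>\<omega>. \<Phi> k (\<zeta> \<omega>) * G \<omega>)) \<longlonglongrightarrow> expectation (\<lambda>\<omega>. F (\<zeta> \<omega>) * G \<omega>)"
  proof (rule integral_dominated_convergence[where w="\<lambda>\<omega>. \<bar>F (\<zeta> \<omega>)\<bar> * K"])
    show "(\<lambda>\<omega>. F (\<zeta> \<omega>) * G \<omega>) \<in> borel_measurable \<Omega>"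
      using measurable_compose[OF measurable_\<zeta> F] Gm by (rule borel_measurable_times)
    show "(\<lambda>\<omega>. \<Phi> k (\<zeta> \<omega>) * G \<omega>) \<in> borel_measurable \<Omega>" for k
      using measurable_compose[OF measurable_\<zeta> \<Phi>m] Gm by (rule borel_measurable_times)
    show "integrable \<Omega> (\<lambda>\<omega>. \<bar>F (\<zeta> \<omega>)\<bar> * K)" by (intro integrable_mult_left integrable_abs Fi)
    show "AE \<omega> in \<Omega>. norm (\<Phi> k (\<zeta> \<omega>) * G \<omega>) \<le> \<bar>F (\<zeta> \<omega>)\<bar> * K" for k
      using \<Phi>b(1,3) GK by (intro AE_I2) (auto simp: abs_mult intro!: mult_mono)
    show "AE \<omega> in \<Omega>. (\<lambda>k. \<Phi> k (\<zeta> \<omega>) * G \<omega>) \<longlonglongrightarrow> F (\<zeta> \<omega>) * G \<omega>"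
      using F0(2)
    proof eventually_elim
      case (elim \<omega>)
      have "eventually (\<lambda>k. \<Phi> k (\<zeta> \<omega>) = F (\<zeta> \<omega>)) sequentially"
      proof (rule eventually_sequentiallyI)
        fix k assume "nat \<lceil>F (\<zeta> \<omega>)\<rceil> \<le> k"
        then have "F (\<zeta> \<omega>) \<le> real k" by linarith
        then show "\<Phi> k (\<zeta> \<omega>) = F (\<zeta> \<omega>)" using elim by (simp add: \<Phi>_def)
      qed
      then show ?case by (intro tendsto_mult tendsto_const tendsto_eventually)
    qed
  qed
  then show ?thesis by (rule LIMSEQ_le_const2) (use le in blast)
qed

text \<open>The bilinear bound is tested with the extremal dual function, the power q - 1 of the
  conditional expectation itself, truncated at \<open>k\<close> to make it bounded and all integrals
  finite. Monotone convergence in \<open>k\<close> then recovers the full q-norm.\<close>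

lemma hypercontractivity:
  assumes p: "1 < p" and q: "q = 1 + (p - 1) / u"
    and F: "F \<in> borel_measurable (point_measure_algebra M)" and F0: "AE \<omega> in \<Omega>. 0 \<le> F (\<eta> \<omega>)"
    and dec: "\<And>x. x \<in> space M \<Longrightarrow> AE \<omega> in \<Omega>. F (measure_add M (\<eta> \<omega>) (return M x)) \<le> F (\<eta> \<omega>)"
  shows "Lp_norm \<Omega> q (real_cond_exp \<Omega> \<Sigma> (\<lambda>\<omega>. F (\<zeta> \<omega>))) \<le> Lp_norm \<Omega> p (\<lambda>\<omega>. F (\<eta> \<omega>))"
proof (cases "(\<integral>\<^sup>+\<omega>. ennreal (\<bar>F (\<eta> \<omega>)\<bar> powr p) \<partial>\<Omega>) = \<infinity>")
  case True
  then show ?thesis by (simp add: Lp_norm_def)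
next
  case False
  have q1: "1 < q" using p u by (simp add: q)
  have Fm: "(\<lambda>\<omega>. F (\<eta> \<omega>)) \<in> borel_measurable \<Omega>" "(\<lambda>\<omega>. F (\<zeta> \<omega>)) \<in> borel_measurable \<Omega>"
    by (rule measurable_compose[OF measurable_\<eta> F] measurable_compose[OF measurable_\<zeta> F])+
  have Fpm: "(\<lambda>\<omega>. \<bar>F (\<eta> \<omega>)\<bar> powr p) \<in> borel_measurable \<Omega>" using Fm(1) by measurable
  have Fp: "integrable \<Omega> (\<lambda>\<omega>. \<bar>F (\<eta> \<omega>)\<bar> powr p)"
    using False Fpm by (intro integrableI_nonneg) (auto simp: less_top)
  have Fi: "integrable \<Omega> (\<lambda>\<omega>. F (\<eta> \<omega>))"
  proof (rule Bochner_Integration.integrable_bound)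
    show "integrable \<Omega> (\<lambda>\<omega>. 1 + \<bar>F (\<eta> \<omega>)\<bar> powr p)" using Fp by (intro Bochner_Integration.integrable_add) auto
    show "AE \<omega> in \<Omega>. norm (F (\<eta> \<omega>)) \<le> norm (1 + \<bar>F (\<eta> \<omega>)\<bar> powr p)"
    proof (rule AE_I2)
      fix \<omega>
      have "\<bar>F (\<eta> \<omega>)\<bar> \<le> 1 + \<bar>F (\<eta> \<omega>)\<bar> powr p"
      proof (cases "\<bar>F (\<eta> \<omega>)\<bar> \<le> 1")
        case False
        then have "\<bar>F (\<eta> \<omega>)\<bar> powr 1 \<le> \<bar>F (\<eta> \<omega>)\<bar> powr p" using p by (intro powr_mono) auto
        then show ?thesis using False by simp
      qed (simp add: add_increasing2)
      then show "norm (F (\<eta> \<omega>)) \<le> norm (1 + \<bar>F (\<eta> \<omega>)\<bar> powr p)" by simp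
    qed
  qed (rule Fm)
  \<comment> \<open>Integrability passes from \<eta> to \<zeta> by equality of the laws, so the
    conditional expectation may be tested against bounded functions.\<close>
  then have Fi': "integrable \<Omega> (\<lambda>\<omega>. F (\<zeta> \<omega>))"
    using integrable_distr_eq[OF measurable_\<zeta> F] integrable_distr_eq[OF measurable_\<eta> F] by (simp add: distr_\<zeta>)
  have set: "{\<mu> \<in> space (point_measure_algebra M). 0 \<le> F \<mu>} \<in> sets (point_measure_algebra M)" using F by measurable
  have F0': "AE \<omega> in \<Omega>. 0 \<le> F (\<zeta> \<omega>)"
  proof -
    have "AE \<mu> in distr \<Omega> (point_measure_algebra M) \<zeta>. 0 \<le> F \<mu>"
      unfolding distr_\<zeta> by (subst AE_distr_iff[OF measurable_\<eta> set]) (rule F0)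
    then show ?thesis by (subst (asm) AE_distr_iff[OF measurable_\<zeta> set])
  qed
  interpret S: finite_measure_subalgebra \<Omega> \<Sigma> by unfold_locales (rule subalgebra_\<Sigma>)
  define Y where "Y = real_cond_exp \<Omega> \<Sigma> (\<lambda>\<omega>. F (\<zeta> \<omega>))"
  have YS: "Y \<in> borel_measurable \<Sigma>" unfolding Y_def by (rule borel_measurable_cond_exp)
  have Ym: "Y \<in> borel_measurable \<Omega>" by (rule measurable_from_subalg[OF subalgebra_\<Sigma> YS])
  have Y0: "AE \<omega> in \<Omega>. 0 \<le> Y \<omega>" unfolding Y_def by (rule S.real_cond_exp_pos[OF F0' Fm(2)])
  define A where "A = expectation (\<lambda>\<omega>. \<bar>F (\<eta> \<omega>)\<bar> powr p) powr (1 / p)"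
  have A0: "0 \<le> A" by (simp add: A_def)
  have trunc: "(\<integral>\<^sup>+\<omega>. ennreal (min \<bar>Y \<omega>\<bar> (real k) powr q) \<partial>\<Omega>) \<le> ennreal (A powr q)" for k
  proof -
    define m where "m \<omega> = min \<bar>Y \<omega>\<bar> (real k)" for \<omega>
    \<comment> \<open>The conjugate power of \<open>G\<close> is \<open>m \<omega> powr q\<close>
      again, so the same integral \<open>J\<close> appears on both sides of the bound.\<close>
    define G where "G \<omega> = m \<omega> powr (q - 1)" for \<omega>
    define J where "J = expectation (\<lambda>\<omega>. m \<omega> powr q)"
    have m: "0 \<le> m \<omega>" "m \<omega> \<le> real k" for \<omega> by (auto simp: m_def)
    have mS: "m \<in> borel_measurable \<Sigma>" unfolding m_def using YS by measurable
    have GS: "G \<in> borel_measurable \<Sigma>" unfolding G_def using mS by measurable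
    have mm: "m \<in> borel_measurable \<Omega>" and Gm: "G \<in> borel_measurable \<Omega>"
      by (rule measurable_from_subalg[OF subalgebra_\<Sigma> mS] measurable_from_subalg[OF subalgebra_\<Sigma> GS])+
    have GK: "0 \<le> G \<omega>" "G \<omega> \<le> real k powr (q - 1)" for \<omega>
      using m q1 by (auto simp: G_def intro!: powr_mono2)
    have iGF: "integrable \<Omega> (\<lambda>\<omega>. G \<omega> * F (\<zeta> \<omega>))"
    proof (rule Bochner_Integration.integrable_bound)
      show "integrable \<Omega> (\<lambda>\<omega>. real k powr (q - 1) * F (\<zeta> \<omega>))" using Fi' by simp
      show "(\<lambda>\<omega>. G \<omega> * F (\<zeta> \<omega>)) \<in> borel_measurable \<Omega>" by (intro borel_measurable_times Gm Fm)
      show "AE \<omega> in \<Omega>. norm (G \<omega> * F (\<zeta> \<omega>)) \<le> norm (real k powr (q - 1) * F (\<zeta> \<omega>))"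
        using GK by (intro AE_I2) (auto simp: abs_mult intro!: mult_right_mono)
    qed
    have imq: "integrable \<Omega> (\<lambda>\<omega>. m \<omega> powr q)"
    proof (rule integrable_const_bound[where B="real k powr q"])
      show "AE \<omega> in \<Omega>. norm (m \<omega> powr q) \<le> real k powr q" using m q1 by (auto intro!: powr_mono2)
      show "(\<lambda>\<omega>. m \<omega> powr q) \<in> borel_measurable \<Omega>" using mm by measurable
    qed
    have J0: "0 \<le> J" by (simp add: J_def)
    have "J \<le> expectation (\<lambda>\<omega>. G \<omega> * Y \<omega>)"
      unfolding J_def
    proof (rule integral_mono_AE[OF imq])
      show "integrable \<Omega> (\<lambda>\<omega>. G \<omega> * Y \<omega>)"
        unfolding Y_def by (rule S.real_cond_exp_intg(1)[OF iGF GS Fm(2)])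
      show "AE \<omega> in \<Omega>. m \<omega> powr q \<le> G \<omega> * Y \<omega>"
        using Y0
      proof eventually_elim
        case (elim \<omega>)
        have "m \<omega> powr q = G \<omega> * m \<omega>"
          using m(1)[of \<omega>] powr_mult_base[of "m \<omega>" "q - 1"] by (simp add: G_def mult.commute)
        also have "\<dots> \<le> G \<omega> * Y \<omega>" using GK elim by (intro mult_left_mono) (auto simp: m_def)
        finally show ?case .
      qed
    qed
    also have "\<dots> = expectation (\<lambda>\<omega>. F (\<zeta> \<omega>) * G \<omega>)"
      unfolding Y_def by (simp add: S.real_cond_exp_intg(2)[OF iGF GS Fm(2)] mult.commute)
    also have "\<dots> \<le> A * expectation (\<lambda>\<omega>. G \<omega> powr (q / (q - 1))) powr (1 - 1 / q)"
      unfolding A_def by (rule dual_inequality[OF p q F F0 F0' dec Fp Fi' GS GK])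
    also have "(\<lambda>\<omega>. G \<omega> powr (q / (q - 1))) = (\<lambda>\<omega>. m \<omega> powr q)"
      using q1 by (simp add: G_def powr_powr)
    finally have JA: "J \<le> A * J powr (1 - 1 / q)" unfolding J_def .
    have "J \<le> A powr q"
    \<comment> \<open>\<open>J\<close> is finite thanks to the truncation, so if it is positive a
      power of it may be cancelled.\<close>
    proof (cases "J = 0")
      case False
      then have Jp: "0 < J" using J0 by simp
      have "J powr (1 / q) * J powr (1 - 1 / q) \<le> A * J powr (1 - 1 / q)"
        using JA Jp by (simp add: powr_add[symmetric])
      then have "J powr (1 / q) \<le> A" using Jp by simp
      then have "(J powr (1 / q)) powr q \<le> A powr q" using q1 by (intro powr_mono2) auto
      then show ?thesis using Jp q1 by (simp add: powr_powr)
    qed simp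
    moreover have "(\<integral>\<^sup>+\<omega>. ennreal (m \<omega> powr q) \<partial>\<Omega>) = ennreal J"
      unfolding J_def by (rule nn_integral_eq_integral[OF imq]) simp
    ultimately show ?thesis by (simp add: m_def ennreal_leI)
  qed
  define I where "I = (\<integral>\<^sup>+\<omega>. ennreal (\<bar>Y \<omega>\<bar> powr q) \<partial>\<Omega>)"
  \<comment> \<open>Every value is attained by its truncation at a large enough \<open>k\<close>, so
    the supremum dominates the integrand.\<close>
  have "I \<le> (\<integral>\<^sup>+\<omega>. (SUP k. ennreal (min \<bar>Y \<omega>\<bar> (real k) powr q)) \<partial>\<Omega>)"
    unfolding I_def
  proof (rule nn_integral_mono)
    fix \<omega>
    have "min \<bar>Y \<omega>\<bar> (real (nat \<lceil>\<bar>Y \<omega>\<bar>\<rceil>)) = \<bar>Y \<omega>\<bar>" by linarith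
    then show "ennreal (\<bar>Y \<omega>\<bar> powr q) \<le> (SUP k. ennreal (min \<bar>Y \<omega>\<bar> (real k) powr q))"
      by (intro SUP_upper2[of "nat \<lceil>\<bar>Y \<omega>\<bar>\<rceil>"]) auto
  qed
  also have "\<dots> = (SUP k. \<integral>\<^sup>+\<omega>. ennreal (min \<bar>Y \<omega>\<bar> (real k) powr q) \<partial>\<Omega>)"
  proof (rule nn_integral_monotone_convergence_SUP)
    show "incseq (\<lambda>k \<omega>. ennreal (min \<bar>Y \<omega>\<bar> (real k) powr q))"
      using q1 by (auto simp: incseq_def le_fun_def intro!: ennreal_leI powr_mono2)
    show "(\<lambda>\<omega>. ennreal (min \<bar>Y \<omega>\<bar> (real k) powr q)) \<in> borel_measurable \<Omega>" for k
      using Ym by measurable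
  qed
  also have "\<dots> \<le> ennreal (A powr q)" by (rule SUP_least) (rule trunc)
  finally have IA: "I \<le> ennreal (A powr q)" .
  then have If: "I \<noteq> \<infinity>" using ennreal_less_top[of "A powr q"] by (auto simp: top_unique)
  have "enn2real I \<le> A powr q" using IA by (intro enn2real_leI) auto
  then have "enn2real I powr (1 / q) \<le> (A powr q) powr (1 / q)" using q1 by (intro powr_mono2) auto
  also have "\<dots> = A" using q1 A0 by (simp add: powr_powr)
  finally have "Lp_norm \<Omega> q Y \<le> ennreal A"
    using If by (simp add: Lp_norm_def I_def Let_def ennreal_leI)
  also have "A = enn2real (\<integral>\<^sup>+\<omega>. ennreal (\<bar>F (\<eta> \<omega>)\<bar> powr p) \<partial>\<Omega>) powr (1 / p)"
    unfolding A_def by (subst integral_eq_nn_integral) (use Fpm in auto)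
  also have "ennreal \<dots> = Lp_norm \<Omega> p (\<lambda>\<omega>. F (\<eta> \<omega>))" using False by (simp add: Lp_norm_def Let_def)
  finally show ?thesis by (simp add: Y_def)
qed

end

theorem theorem1p4:
  fixes \<Omega> :: "'w measure" and M L :: "'a measure"
    and \<eta> \<eta>' :: "'w \<Rightarrow> 'a measure" and \<kappa> :: "'w \<Rightarrow> enat"
    and X :: "nat \<Rightarrow> 'w \<Rightarrow> 'a" and U :: "nat \<Rightarrow> 'w \<Rightarrow> real"
    and F :: "'a measure \<Rightarrow> real" and t p :: real
  assumes "prob_space \<Omega>"
    and "sets L = sets M" and "sigma_finite_measure L"
    and "poisson_process \<Omega> M L \<eta>"
    and "proper_representation \<Omega> M \<eta> \<kappa> X"
    and "uniform_marks \<Omega> M \<kappa> X U"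
    and "t \<ge> 0"
    and "poisson_process \<Omega> M (scale_measure (ennreal (1 - exp (- t))) L) \<eta>'"
    and "independent_rvs \<Omega>
           (point_measure_algebra M \<Otimes>\<^sub>M point_measure_algebra M)
           (\<lambda>\<omega>. (\<eta> \<omega>, thinning M \<kappa> X U (exp (- t)) \<omega>))
           (point_measure_algebra M) \<eta>'"
    and "F \<in> borel_measurable (point_measure_algebra M)"
    and "AE \<omega> in \<Omega>. F (\<eta> \<omega>) \<ge> 0"
    and "\<forall>x\<in>space M. AE \<omega> in \<Omega>. add_one_cost M x F (\<eta> \<omega>) \<le> 0"
    and "p > 1"
  shows "Lp_norm \<Omega> (1 + (p - 1) * exp t) (ou_semigroup \<Omega> M \<eta> \<kappa> X U \<eta>' t F)
           \<le> Lp_norm \<Omega> p (\<lambda>\<omega>. F (\<eta> \<omega>))"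
proof -
  interpret poisson_thinning \<Omega> M L \<eta> \<eta>' \<kappa> X U "exp (- t)"
    using assms by (simp add: poisson_thinning_def)
  have "Lp_norm \<Omega> (1 + (p - 1) * exp t) (real_cond_exp \<Omega> \<Sigma> (\<lambda>\<omega>. F (\<zeta> \<omega>))) \<le> Lp_norm \<Omega> p (\<lambda>\<omega>. F (\<eta> \<omega>))"
  proof (rule hypercontractivity)
    \<comment> \<open>The exponent of the theorem is the one of the locale at
      \<open>u = exp (- t)\<close>.\<close>
    show "1 + (p - 1) * exp t = 1 + (p - 1) / exp (- t)" by (simp add: exp_minus divide_inverse)
    show "AE \<omega> in \<Omega>. F (measure_add M (\<eta> \<omega>) (return M x)) \<le> F (\<eta> \<omega>)" if "x \<in> space M" for x
      using assms(12) that by (simp add: add_one_cost_def)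
  qed (use assms in auto)
  then show ?thesis by (simp add: ou_semigroup_def \<Sigma>_def \<zeta>_def \<theta>_def)
qed

end
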